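(* Let $s\ge1$ be an integer, let $\lambda$ be a real number with $\lambda\notin\sigma(P_s)$, and let $G\in\mathbb{G}_s$ be a connected graph that is not a tree, satisfies $G\neq G^{\circ}$, and satisfies $c(G)+q_s(G)\geq 3$. Then $m_G(\lambda)=2c(G)+q_s(G)-1$ if and only if $G\in\mathbb{B}(T,c(G))$ for some tree $T$ as in the definition of $\mathbb{B}(T,h)$ (with respect to $\lambda$ and $s$).
   Context: All graphs are finite, simple and undirected. $\sigma(G)$ is the set of eigenvalues of the adjacency matrix $A(G)$, and $m_G(\lambda)$ is the multiplicity of $\lambda$ as an eigenvalue of $A(G)$ ($0$ if $\lambda\notin\sigma(G)$). $P_n$ and $C_n$ are the path and cycle on $n$ vertices. $c(G)=|E(G)|-|V(G)|+1$ is the cyclomatic number of a connected graph $G$. A pendant vertex (leaf) is a vertex of degree 1. For a connected graph $G$ with at least one cycle, $G^{\circ}$ denotes the maximal leaf-free induced subgraph of $G$; thus $G\ne G^\circ$ means that $G$ has at least one pendant vertex. $s\ge1$ is a fixed integer. If $u_1u_2\cdots u_tu_{t+1}$ is an induced path in $G$ with $d_G(u_1)=1$, $d_G(u_2)=\dots=d_G(u_t)=2$, $d_G(u_{t+1})\ge3$, then $u_1\cdots u_t$ is called a pendant path of order $t$. $\mathbb{G}_s$ is the set of connected graphs in which every pendant path has order at least $s$. For $G\in\mathbb{G}_s$, $Q_s(G)$ is the set of vertices at distance $s$ from some pendant vertex (if $G$ is not a path, these are the vertices $u_{s+1}$ arising from the pendant paths $u_1\cdots u_t$ above), and $q_s(G)=|Q_s(G)|$.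 $T_k$ is the tree on $ks+1$ vertices obtained from $k$ disjoint copies of $P_s$ by joining one end vertex of each copy to a new vertex, called the center. For $l\ge1$, $T_{k,l}$ is the tree on $sk+l$ vertices obtained from $T_k$ by identifying its center with an end vertex of $P_l$; the other end vertex of $P_l$ is called the $l$-vertex of $T_{k,l}$ (for $l=1$, $T_{k,1}=T_k$ and the $l$-vertex is the center). For $l\ge1$, $C_{g,l}$ is the graph on $g+l-1$ vertices obtained from $C_g$ by identifying one of its vertices with an end vertex of $P_l$; the other end vertex of $P_l$ is called the $l$-vertex of $C_{g,l}$ (for $l=1$, $C_{g,1}=C_g$ and the $l$-vertex is that vertex of the cycle). If $H$ is a graph, $u\in V(H)$ with $d_H(u)\ge2$, and $G$ is obtained from the disjoint union of $H$ and $T_{k,l}$ (resp. $C_{g,l}$) by adding an edge between $u$ and the $l$-vertex, then $T_{k,l}$ (resp. $C_{g,l}$) is called a pendant-$T_{k,l}$ (resp. pendant-$C_{g,l}$) of $G$, attached at $u$. $\mathbb{B}(T,h)$: let $T\in\mathbb{G}_s$ be a tree which is not one of the trees $T_k$, with $\lambda\in\sigma(T)\setminus\sigma(P_s)$ and $m_T(\lambda)=q_s(T)-1$, and let $h\le q_s(T)$. Then $\mathbb{B}(T,h)$ is the set of all graphs obtained from $T$ by replacing $h$ distinct pendant-$T_{k_i,l_i}$'s ($1\le i\le h$) of $T$ with pendant-$C_{g_i,f_i}$'s (attached at the same vertices), where $m_{C_{g_i,f_i}}(\lambda)=2$ for each $i$. *)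

theory Defs
  imports
    "Graph_Theory.Graph_Theory"
    "Jordan_Normal_Form.Char_Poly"
    "HOL-Library.Countable_Set"
    "HOL-Library.Disjoint_Sets"
begin

text \<open>A finite simple undirected graph is a symmetric loopless digraph without parallel arcs, i.e.
  a \<^locale>\<open>pair_graph\<close>: each edge is represented by its two arcs, and the degree of a vertex is its
  out-degree.\<close>

definition edges :: "'a pair_pre_digraph \<Rightarrow> 'a set set" where
  "edges G = {{u, v} |u v. (u, v) \<in> parcs G}"

definition induce :: "'a pair_pre_digraph \<Rightarrow> 'a set \<Rightarrow> 'a pair_pre_digraph" where
  "induce G W = \<lparr>pverts = W, parcs = parcs G \<inter> W \<times> W\<rparr>"

definition iso_via :: "('a, 'a \<times> 'a, 'b, 'b \<times> 'b) digraph_isomorphism \<Rightarrow>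
    'a pair_pre_digraph \<Rightarrow> 'b pair_pre_digraph \<Rightarrow> bool" where
  "iso_via f G H \<longleftrightarrow>
     pre_digraph.digraph_isomorphism (with_proj G) f \<and> app_iso f (with_proj G) = with_proj H"

text \<open>In a symmetric digraph an edge traversed back and forth is a closed walk of length 2 accepted
  by \<^const>\<open>pre_digraph.cycle\<close>; hence the length condition, and hence \<^const>\<open>Digraph_Component.tree\<close>
  is not the notion wanted here.\<close>

definition is_tree :: "'a pair_pre_digraph \<Rightarrow> bool" where
  "is_tree G \<longleftrightarrow> pair_graph G \<and> Digraph_Component.connected (with_proj G) \<and>
     \<not> (\<exists>p. pre_digraph.cycle (with_proj G) p \<and> 3 \<le> length p)"

definition cyclomatic :: "'a pair_pre_digraph \<Rightarrow> int" where
  "cyclomatic G = int (card (edges G)) - int (card (pverts G)) + 1"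

text \<open>The rows and columns are indexed by the enumeration \<^term>\<open>from_nat_into (pverts G)\<close> of the
  vertices; spectrum and characteristic polynomial do not depend on the enumeration.\<close>

definition adj_matrix :: "'a pair_pre_digraph \<Rightarrow> real mat" where
  "adj_matrix G = mat (card (pverts G)) (card (pverts G))
     (\<lambda>(i, j). if (from_nat_into (pverts G) i, from_nat_into (pverts G) j) \<in> parcs G then 1 else 0)"

definition graph_spectrum :: "'a pair_pre_digraph \<Rightarrow> real set" where
  "graph_spectrum G = {x. eigenvalue (adj_matrix G) x}"

definition graph_mult :: "'a pair_pre_digraph \<Rightarrow> real \<Rightarrow> nat" where
  "graph_mult G x = order x (char_poly (adj_matrix G))"

definition pendant_vertex :: "'a pair_pre_digraph \<Rightarrow> 'a \<Rightarrow> bool" where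
  "pendant_vertex G v \<longleftrightarrow> v \<in> pverts G \<and> out_degree (with_proj G) v = 1"

text \<open>The maximal leaf-free induced subgraph. Leaf-free has to exclude isolated vertices as well, for
  otherwise there may be several maximal ones (a triangle with a pendant path \<open>a b\<close> of order 2
  would contain the leaf-free graph formed by the triangle and the isolated leaf \<open>b\<close>).
  Leaf-free vertex sets in this sense are closed under unions.\<close>

definition leaf_free :: "'a pair_pre_digraph \<Rightarrow> bool" where
  "leaf_free G \<longleftrightarrow> (\<forall>v \<in> pverts G. 2 \<le> out_degree (with_proj G) v)"

definition core :: "'a pair_pre_digraph \<Rightarrow> 'a pair_pre_digraph" where
  "core G = induce G (\<Union>{W. W \<subseteq> pverts G \<and> leaf_free (induce G W)})"

definition induced_path :: "'a pair_pre_digraph \<Rightarrow> 'a list \<Rightarrow> bool" where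
  "induced_path G us \<longleftrightarrow> set us \<subseteq> pverts G \<and> distinct us \<and>
     (\<forall>i < length us. \<forall>j < length us.
        (us ! i, us ! j) \<in> parcs G \<longleftrightarrow> j = Suc i \<or> i = Suc j)"

definition pendant_path :: "'a pair_pre_digraph \<Rightarrow> 'a list \<Rightarrow> bool" where
  "pendant_path G us \<longleftrightarrow> us \<noteq> [] \<and>
     (\<exists>w. induced_path G (us @ [w]) \<and>
        out_degree (with_proj G) (hd us) = 1 \<and>
        (\<forall>x \<in> set (tl us). out_degree (with_proj G) x = 2) \<and>
        3 \<le> out_degree (with_proj G) w)"

definition GG :: "nat \<Rightarrow> 'a pair_pre_digraph set" where
  "GG s = {G. pair_graph G \<and> Digraph_Component.connected (with_proj G) \<and>
              (\<forall>us. pendant_path G us \<longrightarrow> s \<le> length us)}"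

text \<open>The graph distance is the least cost of a walk, all arcs having cost 1.\<close>

definition Q :: "nat \<Rightarrow> 'a pair_pre_digraph \<Rightarrow> 'a set" where
  "Q s G = {v \<in> pverts G. \<exists>p. pendant_vertex G p \<and>
              wf_digraph.\<mu> (with_proj G) (\<lambda>_. 1) p v = ereal (real s)}"

definition q :: "nat \<Rightarrow> 'a pair_pre_digraph \<Rightarrow> nat" where
  "q s G = card (Q s G)"

definition mk_graph :: "'a set \<Rightarrow> ('a \<Rightarrow> 'a \<Rightarrow> bool) \<Rightarrow> 'a pair_pre_digraph" where
  "mk_graph V R = \<lparr>pverts = V, parcs = {(x, y). x \<in> V \<and> y \<in> V \<and> (R x y \<or> R y x)}\<rparr>"

definition path_graph :: "nat \<Rightarrow> nat pair_pre_digraph" where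
  "path_graph n = mk_graph {..<n} (\<lambda>i j. j = Suc i)"

text \<open>\<open>T\<^bsub>k,l\<^esub>\<close>: the center is \<open>(0, 0)\<close>, the identified copy of \<open>P\<^sub>l\<close> is
  \<open>(0, 0), \<dots>, (0, l - 1)\<close>, and the \<open>i\<close>-th copy of \<open>P\<^sub>s\<close> is \<open>(i, 1), \<dots>, (i, s)\<close>, whose
  end \<open>(i, 1)\<close> is joined to the center.\<close>

definition T_graph :: "nat \<Rightarrow> nat \<Rightarrow> nat \<Rightarrow> (nat \<times> nat) pair_pre_digraph" where
  "T_graph s k l = mk_graph ({0} \<times> {0..<l} \<union> {1..k} \<times> {1..s})
     (\<lambda>(a, b) (c, d). (a = c \<and> d = Suc b) \<or> ((a, b) = (0, 0) \<and> 1 \<le> c \<and> d = 1))"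

definition T_end :: "nat \<Rightarrow> nat \<times> nat" where
  "T_end l = (0, l - 1)"

text \<open>\<open>C\<^bsub>g,l\<^esub>\<close>: the path \<open>0, \<dots>, g + l - 2\<close> with the additional edge between \<open>0\<close> and
  \<open>g - 1\<close>. The cycle is \<open>0, \<dots>, g - 1\<close>, and the identified copy of \<open>P\<^sub>l\<close> is
  \<open>g - 1, \<dots>, g + l - 2\<close>.\<close>

definition C_graph :: "nat \<Rightarrow> nat \<Rightarrow> nat pair_pre_digraph" where
  "C_graph g l = mk_graph {..<g + l - 1} (\<lambda>i j. j = Suc i \<or> (i = 0 \<and> j = g - 1))"

definition C_end :: "nat \<Rightarrow> nat \<Rightarrow> nat" where
  "C_end g l = g + l - 2"

text \<open>\<open>S\<close> is the vertex set of a copy in \<open>G\<close> of the graph \<open>F\<close> that is joined to the rest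
  \<open>H\<close> of \<open>G\<close> by a single edge, from \<open>u\<close> to the vertex corresponding to \<open>r\<close>.\<close>

definition pendant_at ::
    "'a pair_pre_digraph \<Rightarrow> 'a set \<Rightarrow> 'a \<Rightarrow> 'b pair_pre_digraph \<Rightarrow> 'b \<Rightarrow> bool" where
  "pendant_at G S u F r \<longleftrightarrow> S \<subseteq> pverts G \<and> u \<in> pverts G - S \<and>
     2 \<le> out_degree (with_proj (induce G (pverts G - S))) u \<and>
     (\<exists>f. iso_via f F (induce G S) \<and>
          parcs G \<inter> (pverts G - S) \<times> S = {(u, iso_verts f r)})"

definition pendant_T :: "nat \<Rightarrow> nat \<Rightarrow> nat \<Rightarrow> 'a pair_pre_digraph \<Rightarrow> 'a set \<Rightarrow> 'a \<Rightarrow> bool" where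
  "pendant_T s k l G S u \<longleftrightarrow> 1 \<le> k \<and> 1 \<le> l \<and> pendant_at G S u (T_graph s k l) (T_end l)"

definition pendant_C :: "nat \<Rightarrow> nat \<Rightarrow> 'a pair_pre_digraph \<Rightarrow> 'a set \<Rightarrow> 'a \<Rightarrow> bool" where
  "pendant_C g l G S u \<longleftrightarrow> 3 \<le> g \<and> 1 \<le> l \<and> pendant_at G S u (C_graph g l) (C_end g l)"

text \<open>The trees from which the replacement starts.\<close>

definition base_tree :: "nat \<Rightarrow> real \<Rightarrow> 'a pair_pre_digraph \<Rightarrow> bool" where
  "base_tree s x T \<longleftrightarrow> is_tree T \<and> T \<in> GG s \<and>
     (\<forall>k \<ge> 1. \<not> digraph_iso (with_proj T) (with_proj (T_graph s k 1))) \<and>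
     x \<in> graph_spectrum T - graph_spectrum (path_graph s) \<and>
     int (graph_mult T x) = int (q s T) - 1"

text \<open>\<open>G\<close> arises from \<open>T\<close> by replacing the pendant trees on \<open>S 0, \<dots>, S (h - 1)\<close> with
  the pendant cycles on \<open>D 0, \<dots>, D (h - 1)\<close>: what is left of \<open>T\<close> and of \<open>G\<close> is isomorphic
  via \<open>f\<close>, and \<open>f\<close> respects the vertices of attachment. Replacing the pendant trees simultaneously
  presupposes that they are disjoint and that none of them contains a vertex of attachment. The
  graphs obtained are taken up to isomorphism; \<open>T\<close> and \<open>G\<close> may have vertices of different types.\<close>

definition BB :: "nat \<Rightarrow> real \<Rightarrow> 'b pair_pre_digraph \<Rightarrow> nat \<Rightarrow> 'a pair_pre_digraph set" where
  "BB s x T h = {G. pair_graph G \<and> base_tree s x T \<and> h \<le> q s T \<and>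
     (\<exists>S u D w f.
        disjoint_family_on S {..<h} \<and> disjoint_family_on D {..<h} \<and>
        (\<forall>i < h. u i \<in> pverts T - (\<Union>j<h. S j) \<and> w i \<in> pverts G - (\<Union>j<h. D j)) \<and>
        (\<forall>i < h. \<exists>k l. pendant_T s k l T (S i) (u i)) \<and>
        (\<forall>i < h. \<exists>g l. pendant_C g l G (D i) (w i) \<and> graph_mult (C_graph g l) x = 2) \<and>
        iso_via f (induce T (pverts T - (\<Union>j<h. S j))) (induce G (pverts G - (\<Union>j<h. D j))) \<and>
        (\<forall>i < h. iso_verts f (u i) = w i))}"

end

theory Submission
  imports Defs "Jordan_Normal_Form.Schur_Decomposition"
begin

text \<open>Eigenvectors are functions on the vertices, and the multiplicity is bounded from above by the size
  of a set of vertices on which only the zero eigenvector vanishes. Since \<open>x\<close> is not an eigenvalue of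
  \<open>P\<^sub>s\<close>, an eigenvector vanishing at a vertex of \<open>Q\<close> vanishes on the pendant paths ending
  there. Fix a spanning tree rooted at a vertex of \<open>Q\<close>. An eigenvector that vanishes at all ends of
  the \<open>c\<close> nontree edges and on \<open>Q\<close> without the root is zero, whence
  \<open>m \<le> 2 c + q - 1\<close>. In case of equality no vertex can be dropped from this set; with a spanning
  tree of maximal total depth, in which every nontree edge joins a vertex to an ancestor, this forces
  the fundamental cycles to be disjoint pendant cycles on which \<open>x\<close> has multiplicity 2. Replacing a
  pendant cycle by a suitable pendant path, or conversely, changes the multiplicity and \<open>q\<close> by 1
  each: an eigenvector vanishes at the vertices of attachment, so it splits into eigenvectors of the
  parts.\<close>

section \<open>Eigenvectors as functions on the vertices\<close>

hide_const (open) Coset.order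

text \<open>Three obstacles shape the proof. \<open>graph_mult\<close> is an algebraic multiplicity,
  while the argument counts eigenvectors; symmetry closes the gap, through a triangularization that
  lists the eigenvalue first. The exchange of branches changes the multiplicity by exactly 1 because
  the eigenspace of the tree branch is a line that does not vanish at the \<open>l\<close>-vertex,
  while that of the cycle branch is a plane: its additional eigenvector vanishes at the
  \<open>l\<close>-vertex and extends by zero. This needs \<open>x\<close> to be an eigenvalue of
  every replaced tree, which \<open>BB\<close> does not state and which has to be extracted from the
  extremality of the base tree. The root is taken in \<open>Q\<close> because its value is computed
  from the equation of a child and never tested; this is the \<open>-1\<close> of the bound. The
  condition \<open>c + q >= 3\<close> acts twice: it gives the base tree three vertices of
  \<open>Q\<close>, and it excludes the graph in which the way up from the only cycle meets no
  branching before the root.\<close>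

lemma underdetermined:
  fixes a :: "nat \<Rightarrow> nat \<Rightarrow> 'a :: field"
  assumes "m < n"
  shows "\<exists>c. (\<exists>j<n. c j \<noteq> 0) \<and> (\<forall>i<m. (\<Sum>j<n. a i j * c j) = 0)"
  using assms
proof (induction m arbitrary: n a)
  case 0
  then show ?case by (intro exI[of _ "\<lambda>_. 1"]) auto
next
  case (Suc m)
  then obtain n' where n: "n = Suc n'" and mn: "m < n'" by (cases n) auto
  show ?case
  proof (cases "\<exists>p<n. a m p \<noteq> 0")
    case False
    obtain c where "\<exists>j<n. c j \<noteq> 0" "\<forall>i<m. (\<Sum>j<n. a i j * c j) = 0"
      using Suc.IH[of n a] mn n by auto
    then show ?thesis using False by (intro exI[of _ c]) (auto simp: less_Suc_eq)
  next
    case True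
    then obtain p where p: "p < n" "a m p \<noteq> 0" by auto
    \<comment> \<open>\<open>\<sigma>\<close> enumerates the indices other than the pivot column
      \<open>p\<close>; the system \<open>b\<close> below is what remains after elimination of that
      column.\<close>
    define \<sigma> where "\<sigma> = (\<lambda>j. if j < p then j else Suc j)"
    have split: "(\<Sum>j<n. g j) = g p + (\<Sum>j<n'. g (\<sigma> j))" for g :: "nat \<Rightarrow> 'a"
    proof -
      have "bij_betw \<sigma> {..<n'} ({..<n} - {p})"
      proof (rule bij_betw_byWitness[where f' = "\<lambda>j. if j < p then j else j - 1"])
      qed (use p n in \<open>auto simp: \<sigma>_def\<close>)
      then have "(\<Sum>j<n'. g (\<sigma> j)) = (\<Sum>j\<in>{..<n} - {p}. g j)"
        by (rule sum.reindex_bij_betw)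
      then show ?thesis using p by (simp add: sum.remove[of "{..<n}" p])
    qed
    define b where "b = (\<lambda>i j. a i (\<sigma> j) - a i p / a m p * a m (\<sigma> j))"
    obtain c where c: "\<exists>j<n'. c j \<noteq> 0" "\<forall>i<m. (\<Sum>j<n'. b i j * c j) = 0"
      using Suc.IH[of n' b] mn by auto
    define \<tau> where "\<tau> = (\<lambda>j. if j < p then j else j - 1)"
    have \<tau>: "\<tau> (\<sigma> j) = j" "\<sigma> j \<noteq> p" for j by (auto simp: \<tau>_def \<sigma>_def)
    define d where "d = (\<lambda>j. if j = p then - (\<Sum>k<n'. a m (\<sigma> k) * c k) / a m p else c (\<tau> j))"
    have d: "d (\<sigma> j) = c j" "d p = - (\<Sum>k<n'. a m (\<sigma> k) * c k) / a m p" for j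
      by (auto simp: d_def \<tau>)
    have "(\<Sum>j<n. a i j * d j) = 0" if i: "i < Suc m" for i
    proof (cases "i = m")
      case True
      then show ?thesis using p by (simp add: split d field_simps)
    next
      case False
      with i have "(\<Sum>j<n'. b i j * c j) = 0" using c by auto
      then have "(\<Sum>j<n'. a i (\<sigma> j) * c j) = a i p / a m p * (\<Sum>j<n'. a m (\<sigma> j) * c j)"
        by (simp add: b_def algebra_simps sum_subtractf sum_distrib_left)
      then show ?thesis using p by (simp add: split d field_simps)
    qed
    moreover have "\<exists>j<n. d j \<noteq> 0"
    proof -
      obtain j where "j < n'" "c j \<noteq> 0" using c by auto
      moreover have "\<sigma> j < n" using \<open>j < n'\<close> n by (simp add: \<sigma>_def)
      ultimately show ?thesis using d(1)[of j] by (intro exI[of _ "\<sigma> j"]) simp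
    qed
    ultimately show ?thesis by blast
  qed
qed

text \<open>With \<open>w = A v\<close>, the squared norm of \<open>w\<close> is the pairing of
  \<open>A w = 0\<close> with \<open>v\<close>. This is how symmetry turns generalized eigenvectors
  into eigenvectors.\<close>

lemma hermitian_kernel_sq:
  fixes A :: "complex mat"
  assumes A: "A \<in> carrier_mat n n"
    and herm: "\<And>i j. i < n \<Longrightarrow> j < n \<Longrightarrow> A $$ (j, i) = cnj (A $$ (i, j))"
    and v: "v \<in> carrier_vec n" and 0: "A *\<^sub>v (A *\<^sub>v v) = 0\<^sub>v n"
  shows "A *\<^sub>v v = 0\<^sub>v n"
proof -
  define w where "w = A *\<^sub>v v"
  have w: "w \<in> carrier_vec n" using A v by (auto simp: w_def)
  have wi: "w $ i = (\<Sum>j<n. A $$ (i, j) * v $ j)" if "i < n" for i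
    using that A v by (auto simp: w_def scalar_prod_def lessThan_atLeast0 intro!: sum.cong)
  have Aw: "(\<Sum>j<n. A $$ (i, j) * w $ j) = 0" if "i < n" for i
  proof -
    have "(A *\<^sub>v w) $ i = 0" using 0 that by (simp add: w_def)
    then show ?thesis using that A w by (simp add: scalar_prod_def lessThan_atLeast0)
  qed
  have hc: "cnj (A $$ (i, j)) = A $$ (j, i)" if "i < n" "j < n" for i j
    using herm[OF that] by simp
  have "(\<Sum>i<n. w $ i * cnj (w $ i)) = (\<Sum>i<n. \<Sum>j<n. w $ i * cnj (A $$ (i, j)) * cnj (v $ j))"
    by (auto simp: wi sum_distrib_left mult.assoc intro!: sum.cong)
  also have "\<dots> = (\<Sum>j<n. \<Sum>i<n. w $ i * cnj (A $$ (i, j)) * cnj (v $ j))"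
    by (rule sum.swap)
  also have "\<dots> = (\<Sum>j<n. (\<Sum>i<n. A $$ (j, i) * w $ i) * cnj (v $ j))"
    by (auto simp: hc sum_distrib_right sum_distrib_left mult_ac intro!: sum.cong)
  also have "\<dots> = 0" by (simp add: Aw)
  finally have "(\<Sum>i<n. complex_of_real ((cmod (w $ i))\<^sup>2)) = 0"
    by (simp only: complex_norm_square)
  then have "complex_of_real (\<Sum>i<n. (cmod (w $ i))\<^sup>2) = 0"
    unfolding of_real_sum .
  then have "(\<Sum>i<n. (cmod (w $ i))\<^sup>2) = 0" by (simp only: of_real_eq_0_iff)
  then have "\<forall>i<n. w $ i = 0" by (simp add: sum_nonneg_eq_0_iff)
  then show ?thesis using w A unfolding w_def by (intro eq_vecI) auto
qed

lemma prod_linear_neq_0: "(\<Prod>a\<leftarrow>bs. [:- a, 1:]) \<noteq> (0 :: 'a :: idom poly)"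
  by (induction bs) (simp_all only: list.map prod_list.Nil prod_list.Cons mult_eq_0_iff, auto)

lemma order_prod_linear:
  "order x (\<Prod>a\<leftarrow>bs. [:- a, 1:]) = count_list bs (x :: complex)"
proof (induction bs)
  case (Cons b bs)
  let ?p = "\<Prod>a\<leftarrow>bs. [:- a, 1:]"
  have "[:- b, 1:] * ?p \<noteq> 0"
    using prod_linear_neq_0[of "b # bs"] by (simp only: list.map prod_list.Cons not_False_eq_True)
  then have "order x ([:- b, 1:] * ?p) = order x [:- b, 1:] + order x ?p"
    by (rule order_mult)
  moreover have "order x [:- b, 1:] = (if x = b then 1 else 0)"
    using order_linear_power[of x "- b" 1] by simp
  ultimately show ?case using Cons.IH by (simp only: list.map prod_list.Cons count_list.simps) auto
qed (simp add: order_1_eq_0)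

lemma degree_prod_linear: "degree (\<Prod>a\<leftarrow>bs. [:- a, 1:]) = length (bs :: complex list)"
proof (induction bs)
  case (Cons b bs)
  have "degree ([:- b, 1:] * (\<Prod>a\<leftarrow>bs. [:- a, 1:])) = degree [:- b, 1:] + degree (\<Prod>a\<leftarrow>bs. [:- a, 1:])"
    by (rule degree_mult_eq) (simp_all only: prod_linear_neq_0, auto)
  then show ?case using Cons.IH by (simp only: list.map prod_list.Cons) simp
qed simp

text \<open>Equality of algebraic and geometric multiplicity, phrased as a change of basis:
  \<open>k\<close> columns of \<open>P\<close> are eigenvectors, and the coordinates of every
  eigenvector vanish from \<open>k\<close> on. Schur's form is only triangular;
  \<open>hermitian_kernel_sq\<close> shows that its first \<open>k\<close> columns are those of
  \<open>x\<close> times the identity.\<close>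

lemma hermitian_eigenbasis:
  fixes A :: "complex mat" and x :: real
  assumes A: "A \<in> carrier_mat n n"
    and herm: "\<And>i j. i < n \<Longrightarrow> j < n \<Longrightarrow> A $$ (j, i) = cnj (A $$ (i, j))"
  defines "k \<equiv> order (complex_of_real x) (char_poly A)"
  shows "\<exists>P Q. P \<in> carrier_mat n n \<and> Q \<in> carrier_mat n n \<and> Q * P = 1\<^sub>m n \<and> P * Q = 1\<^sub>m n \<and> k \<le> n \<and>
     (\<forall>j<k. A *\<^sub>v col P j = complex_of_real x \<cdot>\<^sub>v col P j) \<and>
     (\<forall>v\<in>carrier_vec n. A *\<^sub>v v = complex_of_real x \<cdot>\<^sub>v v \<longrightarrow> (\<forall>i<n. k \<le> i \<longrightarrow> (Q *\<^sub>v v) $ i = 0))"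
proof -
  let ?x = "complex_of_real x"
  obtain as where as: "char_poly A = (\<Prod>a\<leftarrow>as. [:- a, 1:])"
    using char_poly_factorized[OF A] by auto
  \<comment> \<open>The copies of \<open>x\<close> come first on the diagonal, so that the leading
    \<open>k\<close> by \<open>k\<close> block of \<open>B - x I\<close> is strictly upper
    triangular and all later diagonal entries are nonzero.\<close>
  define es where "es = filter (\<lambda>a. a = ?x) as @ filter (\<lambda>a. a \<noteq> ?x) as"
  have "mset es = mset as" by (simp add: es_def)
  then have es: "char_poly A = (\<Prod>a\<leftarrow>es. [:- a, 1:])"
    unfolding as by (metis mset_map prod_mset_prod_list)
  have "k = count_list as ?x" by (simp add: k_def as order_prod_linear)
  then have k: "k = length (filter (\<lambda>a. a = ?x) as)"
    unfolding count_list_eq_length_filter by (metis (lifting) filter_cong)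
  have len: "length es = n"
    using degree_monic_char_poly[OF A] unfolding es degree_prod_linear by simp
  have kn: "k \<le> n" unfolding k len[symmetric] es_def by simp
  obtain B P Q where BPQ: "schur_decomposition A es = (B, P, Q)" by (cases "schur_decomposition A es") auto
  from schur_decomposition[OF A es BPQ] have
    sim: "similar_mat_wit A B P Q" and ut: "upper_triangular B" and dg: "diag_mat B = es" by auto
  from similar_mat_witD2[OF A sim] have PQ: "P * Q = 1\<^sub>m n" "Q * P = 1\<^sub>m n" "A = P * B * Q"
    and B: "B \<in> carrier_mat n n" and P: "P \<in> carrier_mat n n" and Q: "Q \<in> carrier_mat n n" by auto
  have Bd: "B $$ (i, i) = es ! i" if "i < n" for i
    using dg B that by (auto simp: diag_mat_def)
  have Bx: "B $$ (i, i) = ?x" if "i < k" for i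
    using that kn nth_mem[of i "filter (\<lambda>a. a = ?x) as"] by (auto simp: Bd es_def nth_append k)
  have Bnx: "B $$ (i, i) \<noteq> ?x" if "i < n" "k \<le> i" for i
  proof -
    have "es ! i = filter (\<lambda>a. a \<noteq> ?x) as ! (i - k)" using that by (auto simp: es_def nth_append k)
    moreover have "i - k < length (filter (\<lambda>a. a \<noteq> ?x) as)"
      using that len by (auto simp: es_def k)
    ultimately show ?thesis using nth_mem[of "i - k" "filter (\<lambda>a. a \<noteq> ?x) as"] that by (auto simp: Bd)
  qed
  have Blow: "B $$ (i, j) = 0" if "i < n" "j < i" for i j using ut that B by auto
  have AP: "A * P = P * B"
  proof -
    have "A * P = P * B * (Q * P)" unfolding PQ(3) using P B Q by (simp add: assoc_mult_mat[of _ n n _ n _ n])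
    then show ?thesis using PQ P B by simp
  qed
  have QA: "Q * A = B * Q"
  proof -
    have "Q * A = (Q * P) * B * Q" unfolding PQ(3) using P B Q by (simp add: assoc_mult_mat[of _ n n _ n _ n])
    then show ?thesis using PQ Q B by simp
  qed
  define M where "M = A - ?x \<cdot>\<^sub>m 1\<^sub>m n"
  define N where "N = B - ?x \<cdot>\<^sub>m 1\<^sub>m n"
  have M: "M \<in> carrier_mat n n" and N: "N \<in> carrier_mat n n" using A B by (auto simp: M_def N_def)
  have Mv: "M *\<^sub>v v = 0\<^sub>v n \<longleftrightarrow> A *\<^sub>v v = ?x \<cdot>\<^sub>v v" if v: "v \<in> carrier_vec n" for v
  proof -
    have "(?x \<cdot>\<^sub>m 1\<^sub>m n) *\<^sub>v v = ?x \<cdot>\<^sub>v v"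
      using v by (intro eq_vecI) (auto simp: smult_scalar_prod_distrib[of _ n])
    then have "M *\<^sub>v v = A *\<^sub>v v - ?x \<cdot>\<^sub>v v"
      unfolding M_def using v A by (simp add: minus_mult_distrib_mat_vec[of _ n n])
    then show ?thesis using v A
      by (auto simp: vec_eq_iff)
  qed
  have scal: "(?x \<cdot>\<^sub>m 1\<^sub>m n) * R = R * (?x \<cdot>\<^sub>m 1\<^sub>m n)" if "R \<in> carrier_mat n n" for R
    using that mult_smult_assoc_mat[of "1\<^sub>m n" n n R n ?x] mult_smult_distrib[of R n n "1\<^sub>m n" n ?x] by simp
  have I: "?x \<cdot>\<^sub>m 1\<^sub>m n \<in> carrier_mat n n" by simp
  have MP: "M * P = P * N"
    unfolding M_def N_def minus_mult_distrib_mat[OF A I P] mult_minus_distrib_mat[OF P B I] AP scal[OF P] ..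
  have QM: "Q * M = N * Q"
    unfolding M_def N_def minus_mult_distrib_mat[OF B I Q] mult_minus_distrib_mat[OF Q A I] QA scal[OF Q] ..
  have Mherm: "M $$ (j, i) = cnj (M $$ (i, j))" if "i < n" "j < n" for i j
    using that A herm[OF that] by (cases "i = j") (simp_all add: M_def)
  have Ne: "(N *\<^sub>v v) $ i = (\<Sum>l<n. N $$ (i, l) * v $ l)" if "i < n" "v \<in> carrier_vec n" for i v
    using that N by (auto simp: scalar_prod_def lessThan_atLeast0 intro!: sum.cong)
  have Nlow: "N $$ (i, j) = 0" if "i < n" "j < i" for i j using that B Blow by (auto simp: N_def)
  have Nd: "N $$ (i, i) = 0 \<longleftrightarrow> i < k" if "i < n" for i
    using that B Bx[of i] Bnx[of i] by (cases "i < k") (simp_all add: N_def)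
  have colP: "P *\<^sub>v unit_vec n j = col P j" if "j < n" for j using that P by (intro eq_vecI) auto
  have MPv: "M *\<^sub>v (P *\<^sub>v v) = P *\<^sub>v (N *\<^sub>v v)" if "v \<in> carrier_vec n" for v
    unfolding assoc_mult_mat_vec[OF M P that, symmetric] MP assoc_mult_mat_vec[OF P N that] ..
  have Z: "X *\<^sub>v 0\<^sub>v n = 0\<^sub>v n" if "X \<in> carrier_mat n n" for X :: "complex mat"
    using that by (intro eq_vecI) auto
  \<comment> \<open>Column \<open>j\<close> of \<open>N\<close> has entries above the diagonal only,
    and the earlier columns vanish by induction, so \<open>N\<close> kills column \<open>j\<close>.
    Then the square of \<open>M\<close> kills column \<open>j\<close> of \<open>P\<close>, and by
    \<open>hermitian_kernel_sq\<close> so does \<open>M\<close>.\<close>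
  have Nunit: "N *\<^sub>v unit_vec n j = 0\<^sub>v n" if "j < k" for j
    using that
  proof (induction j rule: less_induct)
    case (less j)
    have j: "j < n" using less.prems kn by auto
    define w where "w = N *\<^sub>v unit_vec n j"
    have w: "w \<in> carrier_vec n" using N by (auto simp: w_def)
    have wi: "w $ i = N $$ (i, j)" if "i < n" for i
      using that j N by (auto simp: w_def)
    have "(N *\<^sub>v w) $ i = 0" if i: "i < n" for i
    proof -
      have "N $$ (i, l) * w $ l = 0" if l: "l < n" for l
      proof (cases "l < j")
        case True
        then have "(N *\<^sub>v unit_vec n l) $ i = 0" using less.IH[of l] less.prems i by auto
        then show ?thesis using N i l by simp
      next
        case False
        then show ?thesis using wi l Nlow[of l j] Nd[of l] less.prems by (cases "l = j") auto
      qed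
      then show ?thesis unfolding Ne[OF i w] by (intro sum.neutral) simp
    qed
    then have NN: "N *\<^sub>v w = 0\<^sub>v n" using N by (intro eq_vecI) auto
    have u: "unit_vec n j \<in> carrier_vec n" by simp
    have c: "col P j \<in> carrier_vec n" using P j by auto
    have "M *\<^sub>v col P j = P *\<^sub>v w" using MPv[OF u] colP[OF j] by (simp add: w_def)
    moreover have "M *\<^sub>v (P *\<^sub>v w) = 0\<^sub>v n" using MPv[OF w] NN Z[OF P] by simp
    ultimately have "M *\<^sub>v col P j = 0\<^sub>v n"
      using hermitian_kernel_sq[OF M Mherm c] by simp
    then have "P *\<^sub>v w = 0\<^sub>v n" using \<open>M *\<^sub>v col P j = P *\<^sub>v w\<close> by simp
    then have "Q * P *\<^sub>v w = 0\<^sub>v n" unfolding assoc_mult_mat_vec[OF Q P w] using Z[OF Q] by simp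
    then show ?case using PQ w by (simp add: w_def)
  qed
  have "A *\<^sub>v col P j = ?x \<cdot>\<^sub>v col P j" if "j < k" for j
  proof -
    have j: "j < n" using that kn by auto
    have c: "col P j \<in> carrier_vec n" using P j by auto
    have "M *\<^sub>v col P j = P *\<^sub>v (N *\<^sub>v unit_vec n j)"
      using MPv[of "unit_vec n j"] colP[OF j] by simp
    then show ?thesis using Nunit[OF that] Z[OF P] Mv[OF c] by simp
  qed
  moreover have "(Q *\<^sub>v v) $ i = 0"
    if v: "v \<in> carrier_vec n" and Av: "A *\<^sub>v v = ?x \<cdot>\<^sub>v v" and i: "i < n" "k \<le> i" for v i
  proof -
    define w where "w = Q *\<^sub>v v"
    have w: "w \<in> carrier_vec n" using Q v by (auto simp: w_def)
    have "N *\<^sub>v w = Q *\<^sub>v (M *\<^sub>v v)"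
      unfolding w_def assoc_mult_mat_vec[OF N Q v, symmetric] QM[symmetric] assoc_mult_mat_vec[OF Q M v] ..
    also have "\<dots> = 0\<^sub>v n" using Mv[OF v] Av Z[OF Q] by simp
    finally have Nw: "N *\<^sub>v w = 0\<^sub>v n" .
    \<comment> \<open>Back substitution from the last row: row \<open>i\<close> of
      \<open>N w = 0\<close> has a nonzero diagonal entry, and the later entries of \<open>w\<close>
      vanish by induction.\<close>
    from i have "w $ i = 0"
    proof (induction "n - i" arbitrary: i rule: less_induct)
      case less
      have "0 = (\<Sum>l<n. N $$ (i, l) * w $ l)" using Ne[OF less.prems(1) w] Nw less.prems by simp
      also have "\<dots> = N $$ (i, i) * w $ i + (\<Sum>l\<in>{..<n} - {i}. N $$ (i, l) * w $ l)"
        using less.prems by (simp add: sum.remove)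
      also have "(\<Sum>l\<in>{..<n} - {i}. N $$ (i, l) * w $ l) = 0"
      proof (rule sum.neutral, rule ballI)
        fix l assume l: "l \<in> {..<n} - {i}"
        show "N $$ (i, l) * w $ l = 0"
        proof (cases "l < i")
          case False
          then have "n - l < n - i" "k \<le> l" using l less.prems by auto
          then show ?thesis using less.hyps[of l] l by simp
        qed (use less.prems Nlow[of i l] in simp)
      qed
      finally show ?case using Nd[of i] less.prems by auto
    qed
    then show ?thesis by (simp add: w_def)
  qed
  ultimately show ?thesis using P Q PQ kn by blast
qed

section \<open>Eigenspaces and the multiplicity of an eigenvalue\<close>

definition nb :: "'a pair_pre_digraph \<Rightarrow> 'a \<Rightarrow> 'a set" where
  "nb G v = {w. (v, w) \<in> parcs G}"

text \<open>Complex values, because the diagonalization goes through Schur decomposition over \<open>\<complex>\<close>.\<close>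

definition eigsp :: "'a pair_pre_digraph \<Rightarrow> real \<Rightarrow> ('a \<Rightarrow> complex) set" where
  "eigsp G x = {f. (\<forall>v. v \<notin> pverts G \<longrightarrow> f v = 0) \<and>
     (\<forall>v \<in> pverts G. (\<Sum>w\<in>nb G v. f w) = complex_of_real x * f v)}"

lemma out_degree_nb: "out_degree (with_proj G) v = card (nb G v)"
proof -
  have "out_arcs (with_proj G) v = Pair v ` nb G v"
    by (auto simp: out_arcs_def nb_def)
  then show ?thesis by (simp add: out_degree_def card_image inj_on_def)
qed

lemma pair_graph_simps:
  assumes "pair_graph G"
  shows "finite (pverts G)" "finite (parcs G)" "sym (parcs G)"
    and "(u, v) \<in> parcs G \<Longrightarrow> u \<in> pverts G" "(u, v) \<in> parcs G \<Longrightarrow> v \<in> pverts G"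
    and "(u, u) \<notin> parcs G"
proof -
  interpret pair_graph G by fact
  show "finite (pverts G)" "finite (parcs G)" by (auto simp: pair_finite_verts pair_finite_arcs)
  show "(u, v) \<in> parcs G \<Longrightarrow> u \<in> pverts G" "(u, v) \<in> parcs G \<Longrightarrow> v \<in> pverts G" by (auto dest: in_arcsD1 in_arcsD2)
  show "(u, u) \<notin> parcs G" using pair_no_loops[of "(u, u)"] by auto
  show "sym (parcs G)" using pair_sym_arcs by (simp add: symmetric_def)
qed

lemma pair_graphI:
  assumes "finite (pverts G)" "sym (parcs G)" "parcs G \<subseteq> pverts G \<times> pverts G" "\<And>u. (u, u) \<notin> parcs G"
  shows "pair_graph G"
proof -
  have "finite (parcs G)" using assms(1,3) by (meson finite_SigmaI finite_subset)
  then show ?thesis using assms by unfold_locales (auto simp: symmetric_def)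
qed

text \<open>The interface to the matrix, standing in for dimension theory: as many eigenvectors as
  the multiplicity, with dual functionals that separate the eigenspace. \<open>b\<close> comes from
  the columns of \<open>P\<close>, \<open>a\<close> from the rows of its inverse.\<close>

lemma eigsp_dual:
  fixes x :: real
  assumes G: "pair_graph G"
  defines "m \<equiv> graph_mult G x"
  shows "\<exists>b a. (\<forall>j<m. b j \<in> eigsp G x) \<and>
     (\<forall>i<m. \<forall>j<m. (\<Sum>v\<in>pverts G. a j v * b i v) = (if i = j then 1 else 0)) \<and>
     (\<forall>f\<in>eigsp G x. (\<forall>j<m. (\<Sum>v\<in>pverts G. a j v * f v) = 0) \<longrightarrow> f = (\<lambda>_. 0))"
proof -
  note GD = pair_graph_simps[OF G]
  let ?V = "pverts G"
  define n where "n = card ?V"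
  define e where "e = from_nat_into ?V"
  have bij: "bij_betw e {..<n} ?V"
    unfolding e_def n_def using bij_betw_from_nat_into_finite[OF GD(1)] .
  define i where "i = inv_into {..<n} e"
  have ei: "e j \<in> ?V" "i (e j) = j" if "j < n" for j
    using that bij by (auto simp: i_def bij_betw_def)
  have ie: "i v < n" "e (i v) = v" if "v \<in> ?V" for v
    using that bij inv_into_into[of v e "{..<n}"] f_inv_into_f[of v e "{..<n}"]
    by (auto simp: i_def bij_betw_def)
  have reidx: "(\<Sum>v\<in>?V. g v) = (\<Sum>j<n. g (e j))" for g :: "'a \<Rightarrow> complex"
    using sum.reindex_bij_betw[OF bij, of g] by simp
  define A where "A = map_mat complex_of_real (adj_matrix G)"
  have A: "A \<in> carrier_mat n n" by (simp add: A_def adj_matrix_def n_def)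
  have Aij: "A $$ (j, k) = (if (e j, e k) \<in> parcs G then 1 else 0)" if "j < n" "k < n" for j k
    using that by (simp add: A_def adj_matrix_def n_def e_def)
  have herm: "A $$ (k, j) = cnj (A $$ (j, k))" if "j < n" "k < n" for j k
    using that GD(3) by (auto simp: Aij dest: symD)
  \<comment> \<open>The order of a root does not change when the coefficients pass from the reals to
    the complex numbers.\<close>
  interpret R: map_poly_inj_idom_divide_hom complex_of_real by unfold_locales auto
  have "char_poly A = map_poly complex_of_real (char_poly (adj_matrix G))"
    unfolding A_def by (rule of_real_hom.char_poly_hom) (auto simp: adj_matrix_def)
  then have m: "order (complex_of_real x) (char_poly A) = m"
    by (simp add: m_def graph_mult_def R.order_hom)
  have Av: "(A *\<^sub>v vec n (\<lambda>j. f (e j))) $ j = (\<Sum>w\<in>nb G (e j). f w)" if "j < n" for f j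
  proof -
    have "(A *\<^sub>v vec n (\<lambda>j. f (e j))) $ j = (\<Sum>k<n. A $$ (j, k) * f (e k))"
      using that A by (auto simp: scalar_prod_def lessThan_atLeast0 intro!: sum.cong)
    also have "\<dots> = (\<Sum>k<n. if (e j, e k) \<in> parcs G then f (e k) else 0)"
      using that by (intro sum.cong) (auto simp: Aij)
    also have "\<dots> = (\<Sum>w\<in>?V. if (e j, w) \<in> parcs G then f w else 0)"
      by (simp add: reidx)
    also have "\<dots> = (\<Sum>w\<in>nb G (e j). f w)"
    proof -
      have "?V \<inter> {w. (e j, w) \<in> parcs G} = nb G (e j)" using GD(5) by (auto simp: nb_def)
      then show ?thesis using GD(1) by (simp add: sum.If_cases)
    qed
    finally show ?thesis .
  qed
  obtain P Q where PQ: "P \<in> carrier_mat n n" "Q \<in> carrier_mat n n" "Q * P = 1\<^sub>m n" "P * Q = 1\<^sub>m n" "m \<le> n"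
    and Pj: "\<forall>j<m. A *\<^sub>v col P j = complex_of_real x \<cdot>\<^sub>v col P j"
    and Qv: "\<forall>v\<in>carrier_vec n. A *\<^sub>v v = complex_of_real x \<cdot>\<^sub>v v \<longrightarrow> (\<forall>i<n. m \<le> i \<longrightarrow> (Q *\<^sub>v v) $ i = 0)"
    using hermitian_eigenbasis[OF A herm, of x] unfolding m by blast
  define b where "b = (\<lambda>j v. if v \<in> ?V then P $$ (i v, j) else 0)"
  define a where "a = (\<lambda>j v. Q $$ (j, i v))"
  have colb: "vec n (\<lambda>k. b j (e k)) = col P j" if "j < m" for j
    using that PQ by (intro eq_vecI) (auto simp: b_def ei)
  have "b j \<in> eigsp G x" if j: "j < m" for j
    unfolding eigsp_def
  proof (intro CollectI conjI ballI)
    show "\<forall>v. v \<notin> ?V \<longrightarrow> b j v = 0" by (simp add: b_def)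
    fix v assume v: "v \<in> ?V"
    have "(\<Sum>w\<in>nb G v. b j w) = (A *\<^sub>v col P j) $ i v"
      using Av[of "i v" "b j"] ie[OF v] colb[OF j] by simp
    then show "(\<Sum>w\<in>nb G v. b j w) = complex_of_real x * b j v"
      using Pj j v ie[OF v] PQ by (simp add: b_def)
  qed
  moreover have "(\<Sum>v\<in>?V. a j v * b k v) = (if k = j then 1 else 0)" if "k < m" "j < m" for k j
  proof -
    have "(\<Sum>v\<in>?V. a j v * b k v) = (\<Sum>l<n. Q $$ (j, l) * P $$ (l, k))"
      unfolding reidx by (intro sum.cong) (auto simp: a_def b_def ei)
    also have "\<dots> = (Q * P) $$ (j, k)"
      using that PQ(1,2,5) by (auto simp: scalar_prod_def lessThan_atLeast0 intro!: sum.cong)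
    also have "\<dots> = (if k = j then 1 else 0)" unfolding PQ(3) using that PQ(5) by simp
    finally show ?thesis .
  qed
  moreover have "f = (\<lambda>_. 0)" if f: "f \<in> eigsp G x" and 0: "\<forall>j<m. (\<Sum>v\<in>?V. a j v * f v) = 0" for f
  proof -
    define w where "w = vec n (\<lambda>j. f (e j))"
    have w: "w \<in> carrier_vec n" by (simp add: w_def)
    have "A *\<^sub>v w = complex_of_real x \<cdot>\<^sub>v w"
      using Av[of _ f] f A ei by (intro eq_vecI) (auto simp: w_def eigsp_def)
    then have Q1: "\<forall>i<n. m \<le> i \<longrightarrow> (Q *\<^sub>v w) $ i = 0" using Qv w by blast
    have Q2: "(Q *\<^sub>v w) $ j = (\<Sum>v\<in>?V. a j v * f v)" if "j < n" for j
      unfolding reidx using that PQ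
      by (auto simp: scalar_prod_def lessThan_atLeast0 a_def ei w_def intro!: sum.cong)
    have "Q *\<^sub>v w = 0\<^sub>v n"
      using Q1 Q2 0 PQ by (intro eq_vecI) (auto simp: not_less[symmetric])
    then have "P *\<^sub>v (Q *\<^sub>v w) = 0\<^sub>v n" using PQ by (intro eq_vecI) auto
    then have "w = 0\<^sub>v n" unfolding assoc_mult_mat_vec[OF PQ(1,2) w, symmetric] PQ(4) using w by simp
    then have fe: "f (e j) = 0" if "j < n" for j using that by (metis index_vec index_zero_vec(1) w_def)
    have "f v = 0" for v
    proof (cases "v \<in> ?V")
      case True
      then show ?thesis using fe[of "i v"] ie[of v] by simp
    qed (use f in \<open>simp add: eigsp_def\<close>)
    then show ?thesis by auto
  qed
  ultimately show ?thesis by blast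
qed

definition clin :: "(('a \<Rightarrow> complex) \<Rightarrow> complex) \<Rightarrow> bool" where
  "clin \<phi> \<longleftrightarrow> (\<forall>f g. \<phi> (\<lambda>v. f v + g v) = \<phi> f + \<phi> g) \<and> (\<forall>c f. \<phi> (\<lambda>v. c * f v) = c * \<phi> f)"

lemma clin_sum:
  assumes "clin \<phi>"
  shows "\<phi> (\<lambda>v. \<Sum>j<(n::nat). c j * b j v) = (\<Sum>j<n. c j * \<phi> (b j))"
proof (induction n)
  case 0
  have "\<phi> (\<lambda>v. c * f v) = c * \<phi> f" for c f using assms by (simp add: clin_def)
  from this[of 0 "\<lambda>_. 0"] show ?case by simp
next
  case (Suc n)
  then show ?case using assms by (simp add: clin_def)
qed

lemma clin_eval: "clin (\<lambda>f. f v)"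
  by (simp add: clin_def)

lemma clin_wsum: "clin (\<lambda>f. \<Sum>v\<in>S. a v * f v)"
  by (simp add: clin_def sum.distrib algebra_simps sum_distrib_left)

lemma eigsp_sum:
  assumes "\<And>j. j < n \<Longrightarrow> b j \<in> eigsp G x"
  shows "(\<lambda>v. \<Sum>j<(n::nat). c j * b j v) \<in> eigsp G x"
  unfolding eigsp_def
proof (intro CollectI conjI ballI)
  show "\<forall>v. v \<notin> pverts G \<longrightarrow> (\<Sum>j<n. c j * b j v) = 0"
    using assms by (auto simp: eigsp_def)
  fix v assume v: "v \<in> pverts G"
  have "(\<Sum>w\<in>nb G v. \<Sum>j<n. c j * b j w) = (\<Sum>j<n. c j * (\<Sum>w\<in>nb G v. b j w))"
    by (subst sum.swap) (simp add: sum_distrib_left)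
  also have "\<dots> = (\<Sum>j<n. c j * (complex_of_real x * b j v))"
    using assms v by (intro sum.cong) (auto simp: eigsp_def)
  finally show "(\<Sum>w\<in>nb G v. \<Sum>j<n. c j * b j w) = complex_of_real x * (\<Sum>j<n. c j * b j v)"
    by (simp add: sum_distrib_left algebra_simps)
qed

lemma eigsp_comb:
  assumes "f \<in> eigsp G x" "g \<in> eigsp G x"
  shows "(\<lambda>v. c * f v + d * g v) \<in> eigsp G x"
  using assms by (auto simp: eigsp_def sum.distrib sum_distrib_left[symmetric] algebra_simps)

text \<open>Otherwise there are more basis vectors than test functionals, so a nontrivial
  combination of the basis passes all tests; the dual functionals show that it is nonzero.\<close>

lemma graph_mult_le:
  assumes G: "pair_graph G"
    and lin: "\<And>j. j < k \<Longrightarrow> clin (\<phi> j)"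
    and inj: "\<And>f. f \<in> eigsp G x \<Longrightarrow> (\<And>j. j < k \<Longrightarrow> \<phi> j f = 0) \<Longrightarrow> f = (\<lambda>_. 0)"
  shows "graph_mult G x \<le> k"
proof (rule ccontr)
  let ?m = "graph_mult G x"
  assume "\<not> ?thesis"
  then have km: "k < ?m" by simp
  obtain b a where b: "\<And>j. j < ?m \<Longrightarrow> b j \<in> eigsp G x"
    and ab: "\<And>i j. i < ?m \<Longrightarrow> j < ?m \<Longrightarrow> (\<Sum>v\<in>pverts G. a j v * b i v) = (if i = j then 1 else 0)"
    using eigsp_dual[OF G, of x] by blast
  obtain c j0 where c: "j0 < ?m" "c j0 \<noteq> 0" "\<And>i. i < k \<Longrightarrow> (\<Sum>j<?m. \<phi> i (b j) * c j) = 0"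
    using underdetermined[OF km, of "\<lambda>i j. \<phi> i (b j)"] by blast
  define f where "f = (\<lambda>v. \<Sum>j<?m. c j * b j v)"
  have "f \<in> eigsp G x" unfolding f_def by (rule eigsp_sum[OF b])
  moreover have "\<phi> i f = 0" if "i < k" for i
    using c(3)[OF that] clin_sum[OF lin[OF that], where b = b and c = c and n = ?m]
    by (simp add: f_def mult.commute)
  ultimately have "f = (\<lambda>_. 0)" by (rule inj)
  then have "0 = (\<Sum>v\<in>pverts G. a j0 v * f v)" by simp
  also have "\<dots> = (\<Sum>j<?m. c j * (\<Sum>v\<in>pverts G. a j0 v * b j v))"
    using clin_sum[OF clin_wsum[where S = "pverts G" and a = "a j0"], where b = b and c = c and n = ?m] by (simp add: f_def)
  also have "\<dots> = (\<Sum>j<?m. if j = j0 then c j else 0)"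
    using ab c(1) by (intro sum.cong) auto
  also have "\<dots> = c j0" using c(1) by simp
  finally show False using c(2) by simp
qed

text \<open>The same count with the roles exchanged: a nontrivial combination of too many
  eigenvectors would be killed by all dual functionals.\<close>

lemma graph_mult_ge:
  assumes G: "pair_graph G"
    and b: "\<And>j. j < k \<Longrightarrow> b j \<in> eigsp G x"
    and indep: "\<And>c. (\<And>v. (\<Sum>j<k. c j * b j v) = 0) \<Longrightarrow> (\<And>j. j < k \<Longrightarrow> c j = 0)"
  shows "k \<le> graph_mult G x"
proof (rule ccontr)
  let ?m = "graph_mult G x"
  assume "\<not> ?thesis"
  then have km: "?m < k" by simp
  obtain a where a: "\<And>f. f \<in> eigsp G x \<Longrightarrow> (\<forall>j<?m. (\<Sum>v\<in>pverts G. a j v * f v) = 0) \<Longrightarrow> f = (\<lambda>_. 0)"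
    using eigsp_dual[OF G, of x] by blast
  obtain c j0 where c: "j0 < k" "c j0 \<noteq> 0" "\<And>i. i < ?m \<Longrightarrow> (\<Sum>j<k. (\<Sum>v\<in>pverts G. a i v * b j v) * c j) = 0"
    using underdetermined[OF km, of "\<lambda>i j. (\<Sum>v\<in>pverts G. a i v * b j v)"] by blast
  have "(\<lambda>v. \<Sum>j<k. c j * b j v) = (\<lambda>_. 0)"
  proof (rule a[OF eigsp_sum[OF b]])
    show "\<forall>i<?m. (\<Sum>v\<in>pverts G. a i v * (\<Sum>j<k. c j * b j v)) = 0"
      using c(3) clin_sum[OF clin_wsum[where S = "pverts G"], where b = b and c = c and n = k] by (simp add: mult.commute)
  qed
  then have "(\<Sum>j<k. c j * b j v) = 0" for v by (rule fun_cong)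
  then show False using indep[of c] c by blast
qed

lemma graph_spectrum_iff:
  assumes G: "pair_graph G"
  shows "x \<in> graph_spectrum G \<longleftrightarrow> (\<exists>f\<in>eigsp G x. f \<noteq> (\<lambda>_. 0))"
proof -
  have c: "adj_matrix G \<in> carrier_mat (card (pverts G)) (card (pverts G))" by (simp add: adj_matrix_def)
  have "char_poly (adj_matrix G) \<noteq> 0" using degree_monic_char_poly[OF c] by auto
  then have "x \<in> graph_spectrum G \<longleftrightarrow> 0 < graph_mult G x"
    using eigenvalue_root_char_poly[OF c] by (simp add: graph_spectrum_def graph_mult_def order_root)
  also have "\<dots> \<longleftrightarrow> (\<exists>f\<in>eigsp G x. f \<noteq> (\<lambda>_. 0))"
  proof
    assume m: "0 < graph_mult G x"
    obtain b a where "\<forall>j<graph_mult G x. b j \<in> eigsp G x"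
      "\<forall>i<graph_mult G x. \<forall>j<graph_mult G x. (\<Sum>v\<in>pverts G. a j v * b i v) = (if i = j then 1 else 0)"
      using eigsp_dual[OF G, of x] by blast
    then have "b 0 \<in> eigsp G x" "(\<Sum>v\<in>pverts G. a 0 v * b 0 v) = 1" using m by auto
    then show "\<exists>f\<in>eigsp G x. f \<noteq> (\<lambda>_. 0)" by (intro bexI[of _ "b 0"]) auto
  next
    assume "\<exists>f\<in>eigsp G x. f \<noteq> (\<lambda>_. 0)"
    then obtain f v where "f \<in> eigsp G x" "f v \<noteq> 0" by (auto simp: fun_eq_iff)
    then have "1 \<le> graph_mult G x"
      by (intro graph_mult_ge[OF G, where b = "\<lambda>_. f"]) auto
    then show "0 < graph_mult G x" by simp
  qed
  finally show ?thesis .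
qed

section \<open>Spanning trees\<close>

lemma connected_iff:
  assumes G: "pair_graph G"
  shows "Digraph_Component.connected (with_proj G) \<longleftrightarrow>
    pverts G \<noteq> {} \<and> (\<forall>u\<in>pverts G. \<forall>v\<in>pverts G. (u, v) \<in> (parcs G)\<^sup>*)"
proof -
  note GD = pair_graph_simps[OF G]
  have "parcs (mk_symmetric (with_proj G)) = parcs G"
    using GD(3) by (auto simp: mk_symmetric_def dest: symD)
  moreover have "pverts (mk_symmetric (with_proj G)) = pverts G" by (simp add: mk_symmetric_def)
  ultimately have mk: "mk_symmetric (with_proj G) = G" by (intro pair_pre_digraph.equality) auto
  have r: "(u, v) \<in> rtrancl_on (pverts G) (parcs G) \<longleftrightarrow> (u, v) \<in> (parcs G)\<^sup>*"
    if "u \<in> pverts G" for u v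
  proof
    show "(u, v) \<in> (parcs G)\<^sup>*" if "(u, v) \<in> rtrancl_on (pverts G) (parcs G)"
      using that by (rule rtrancl_on_rtranclI)
    show "(u, v) \<in> rtrancl_on (pverts G) (parcs G)" if "(u, v) \<in> (parcs G)\<^sup>*"
      using that
    proof induction
      case base
      then show ?case using \<open>u \<in> pverts G\<close> by auto
    next
      case (step y z)
      then show ?case using GD by (auto intro: rtrancl_on_into_rtrancl_on)
    qed
  qed
  show ?thesis
    unfolding Digraph_Component.connected_def mk strongly_connected_def reachable_def
    using r by auto
qed

lemma awalk_relpow:
  assumes G: "pair_graph G" and u: "u \<in> pverts G"
  shows "(\<exists>p. pre_digraph.awalk (with_proj G) u p v \<and> length p = k) \<longleftrightarrow> (u, v) \<in> parcs G ^^ k"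
proof -
  note GD = pair_graph_simps[OF G]
  have aw: "pre_digraph.awalk (with_proj G) u p v \<longleftrightarrow> u \<in> pverts G \<and> set p \<subseteq> parcs G \<and> pcas u p v" for u p v
    by (simp add: pre_digraph.awalk_def cas_with_proj_eq)
  show ?thesis using u
  proof (induction k arbitrary: u)
    case 0
    then show ?case by (auto simp: aw)
  next
    case (Suc k)
    show ?case
    proof
      assume "\<exists>p. pre_digraph.awalk (with_proj G) u p v \<and> length p = Suc k"
      then obtain e p where "pre_digraph.awalk (with_proj G) u (e # p) v" "length p = k"
        by (metis length_Suc_conv)
      then have e: "(u, snd e) \<in> parcs G" and "pre_digraph.awalk (with_proj G) (snd e) p v" "length p = k"
        using GD(5)[of "fst e" "snd e"] by (auto simp: aw)
      then have "(snd e, v) \<in> parcs G ^^ k" using Suc.IH[of "snd e"] GD(5)[OF e] by blast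
      then show "(u, v) \<in> parcs G ^^ Suc k" using e by (rule relpow_Suc_I2[rotated])
    next
      assume "(u, v) \<in> parcs G ^^ Suc k"
      then obtain w where w: "(u, w) \<in> parcs G" "(w, v) \<in> parcs G ^^ k" by (rule relpow_Suc_E2)
      then obtain p where "pre_digraph.awalk (with_proj G) w p v" "length p = k"
        using Suc.IH[of w] GD(5)[OF w(1)] by blast
      then show "\<exists>p. pre_digraph.awalk (with_proj G) u p v \<and> length p = Suc k"
        using w Suc.prems by (intro exI[of _ "(u, w) # p"]) (auto simp: aw)
    qed
  qed
qed

text \<open>Walks of length \<open>k\<close> correspond to the \<open>k\<close>-th relational power,
  so the infimum that defines the distance ranges over embedded natural numbers and is attained at
  the least one; it is infinite if there is no walk.\<close>

lemma dist_iff: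
  assumes G: "pair_graph G" and u: "u \<in> pverts G"
  shows "wf_digraph.\<mu> (with_proj G) (\<lambda>_. 1) u v = ereal (real k) \<longleftrightarrow>
    (u, v) \<in> parcs G ^^ k \<and> (\<forall>j<k. (u, v) \<notin> parcs G ^^ j)"
proof -
  interpret pair_graph G by fact
  have W: "wf_digraph (with_proj G)" by (simp add: wf_digraph_wp_iff pair_wf_digraph)
  let ?L = "{k. (u, v) \<in> parcs G ^^ k}"
  have cost: "wf_digraph.awalk_cost (\<lambda>_. 1) p = real (length p)" for p :: "('a \<times> 'a) list"
    unfolding wf_digraph.awalk_cost_def[OF W] by (induction p) auto
  have "(\<lambda>p. ereal (wf_digraph.awalk_cost (\<lambda>_. 1) p)) ` {p. pre_digraph.awalk (with_proj G) u p v} = (\<lambda>k. ereal (real k)) ` ?L"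
  proof -
    have "length ` {p. pre_digraph.awalk (with_proj G) u p v} = ?L"
      by (auto simp: awalk_relpow[OF G u, of v, symmetric])
    then show ?thesis by (simp add: cost image_image[symmetric, of "\<lambda>k. ereal (real k)" length])
  qed
  then have mu: "wf_digraph.\<mu> (with_proj G) (\<lambda>_. 1) u v = Inf ((\<lambda>k. ereal (real k)) ` ?L)"
    unfolding wf_digraph.\<mu>_def[OF W] by simp
  show ?thesis
  proof (cases "?L = {}")
    case True
    then show ?thesis unfolding mu by (auto simp: top_ereal_def)
  next
    case False
    define l where "l = (LEAST k. k \<in> ?L)"
    have l: "l \<in> ?L" "\<And>k. k \<in> ?L \<Longrightarrow> l \<le> k"
      using False LeastI_ex[of "\<lambda>k. k \<in> ?L"] Least_le[of "\<lambda>k. k \<in> ?L"] by (auto simp: l_def)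
    have "Inf ((\<lambda>k. ereal (real k)) ` ?L) = ereal (real l)"
      using l by (intro antisym INF_lower INF_greatest) auto
    moreover have "l = k \<longleftrightarrow> (u, v) \<in> parcs G ^^ k \<and> (\<forall>j<k. (u, v) \<notin> parcs G ^^ j)"
    proof
      assume "l = k"
      then show "(u, v) \<in> parcs G ^^ k \<and> (\<forall>j<k. (u, v) \<notin> parcs G ^^ j)" using l by force
    next
      assume "(u, v) \<in> parcs G ^^ k \<and> (\<forall>j<k. (u, v) \<notin> parcs G ^^ j)"
      then show "l = k" using l by (metis mem_Collect_eq linorder_neqE_nat not_less)
    qed
    ultimately show ?thesis unfolding mu by simp
  qed
qed

lemma card_parcs_edges:
  assumes G: "pair_graph G"
  shows "card (parcs G) = 2 * card (edges G)"
proof -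
  note GD = pair_graph_simps[OF G]
  let ?h = "\<lambda>(u, v). {u, v}"
  have E: "edges G = ?h ` parcs G" by (auto simp: edges_def)
  have "card (parcs G) = (\<Sum>e\<in>edges G. card {a \<in> parcs G. ?h a = e})"
    unfolding E card_eq_sum by (rule sum.image_gen[OF GD(2)])
  also have "\<dots> = (\<Sum>e\<in>edges G. 2)"
  proof (rule sum.cong[OF refl])
    fix e assume "e \<in> edges G"
    then obtain u v where uv: "(u, v) \<in> parcs G" "e = {u, v}" by (auto simp: edges_def)
    then have "{a \<in> parcs G. ?h a = e} = {(u, v), (v, u)}"
      using GD(3) by (auto simp: doubleton_eq_iff dest: symD)
    moreover have "u \<noteq> v" using uv GD(6) by auto
    ultimately show "card {a \<in> parcs G. ?h a = e} = 2" by simp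
  qed
  finally show ?thesis by simp
qed

text \<open>\<open>p\<close> is the parent function; the depth \<open>d\<close> excludes parent cycles.\<close>

definition rtree :: "'a pair_pre_digraph \<Rightarrow> 'a \<Rightarrow> ('a \<Rightarrow> 'a) \<Rightarrow> ('a \<Rightarrow> nat) \<Rightarrow> bool" where
  "rtree G r p d \<longleftrightarrow> r \<in> pverts G \<and> d r = 0 \<and>
     (\<forall>v\<in>pverts G - {r}. (v, p v) \<in> parcs G \<and> d v = Suc (d (p v)))"

text \<open>Every nontree edge contributes both of its arcs.\<close>

definition ntarcs :: "'a pair_pre_digraph \<Rightarrow> 'a \<Rightarrow> ('a \<Rightarrow> 'a) \<Rightarrow> ('a \<times> 'a) set" where
  "ntarcs G r p = {(v, w) \<in> parcs G. \<not> (v \<noteq> r \<and> w = p v) \<and> \<not> (w \<noteq> r \<and> v = p w)}"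

text \<open>The subtree hanging from \<open>w\<close>: the vertices whose way to the root passes
  through \<open>w\<close>.\<close>

inductive_set dsc for G r p w where
  dsc_base: "w \<in> pverts G \<Longrightarrow> w \<in> dsc G r p w"
| dsc_step: "v \<in> pverts G \<Longrightarrow> v \<noteq> r \<Longrightarrow> p v \<in> dsc G r p w \<Longrightarrow> v \<in> dsc G r p w"

lemma ntarcs_sym: "pair_graph G \<Longrightarrow> (v, w) \<in> ntarcs G r p \<longleftrightarrow> (w, v) \<in> ntarcs G r p"
  using pair_graph_simps(3)[of G] by (auto simp: ntarcs_def dest: symD)

text \<open>A breadth-first tree: the depth is the distance to \<open>r\<close>, and the parent is
  the second vertex of a shortest walk.\<close>

lemma rtree_exists:
  assumes G: "pair_graph G" and c: "Digraph_Component.connected (with_proj G)" and r: "r \<in> pverts G"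
  shows "\<exists>p d. rtree G r p d"
proof -
  note GD = pair_graph_simps[OF G]
  define d where "d = (\<lambda>v. LEAST n. (v, r) \<in> parcs G ^^ n)"
  have ex: "(v, r) \<in> parcs G ^^ d v" if "v \<in> pverts G" for v
  proof -
    have "(v, r) \<in> (parcs G)\<^sup>*" using c that r connected_iff[OF G] by auto
    then obtain n where "(v, r) \<in> parcs G ^^ n" by (auto simp: rtrancl_power)
    then show ?thesis unfolding d_def by (rule LeastI)
  qed
  have le: "d v \<le> n" if "(v, r) \<in> parcs G ^^ n" for v n
    using that unfolding d_def by (rule Least_le)
  have "\<exists>w. (v, w) \<in> parcs G \<and> d v = Suc (d w)" if v: "v \<in> pverts G" "v \<noteq> r" for v
  proof -
    obtain n where n: "d v = Suc n" using ex[OF v(1)] v(2) by (cases "d v") auto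
    then obtain w where w: "(v, w) \<in> parcs G" "(w, r) \<in> parcs G ^^ n"
      using ex[OF v(1)] by (metis relpow_Suc_E2)
    have "d w \<le> n" using le w(2) by auto
    moreover have "(v, r) \<in> parcs G ^^ Suc (d w)"
      using w(1) ex[OF GD(5)[OF w(1)]] by (rule relpow_Suc_I2)
    then have "d v \<le> Suc (d w)" by (rule le)
    ultimately show ?thesis using w n by auto
  qed
  then obtain p where "\<forall>v\<in>pverts G - {r}. (v, p v) \<in> parcs G \<and> d v = Suc (d (p v))"
    by (metis DiffE singletonI)
  moreover have "d r = 0" using le[of r 0] by auto
  ultimately show ?thesis using r by (auto simp: rtree_def)
qed

lemma rtreeD:
  assumes "rtree G r p d"
  shows "r \<in> pverts G" "d r = 0"
    and "v \<in> pverts G \<Longrightarrow> v \<noteq> r \<Longrightarrow> (v, p v) \<in> parcs G"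
    and "v \<in> pverts G \<Longrightarrow> v \<noteq> r \<Longrightarrow> d v = Suc (d (p v))"
  using assms unfolding rtree_def by blast+

lemma rtree_connected:
  assumes G: "pair_graph G" and t: "rtree G r p d"
  shows "Digraph_Component.connected (with_proj G)"
proof -
  note GD = pair_graph_simps[OF G]
  have up: "(v, r) \<in> (parcs G)\<^sup>*" if "v \<in> pverts G" for v
    using that
  proof (induction "d v" arbitrary: v)
    case 0
    then show ?case using rtreeD(4)[OF t, of v] by (cases "v = r") auto
  next
    case (Suc n)
    have vr: "v \<noteq> r" using Suc.hyps(2) rtreeD(2)[OF t] by auto
    have v: "(v, p v) \<in> parcs G" "n = d (p v)"
      using rtreeD(3,4)[OF t Suc.prems vr] Suc.hyps(2) by simp_all
    have "(p v, r) \<in> (parcs G)\<^sup>*" using Suc.hyps(1)[OF v(2) GD(5)[OF v(1)]] .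
    then show ?case using v by (meson converse_rtrancl_into_rtrancl)
  qed
  have "(r, v) \<in> (parcs G)\<^sup>*" if "v \<in> pverts G" for v
    using up[OF that] GD(3) by (meson sym_rtrancl symD)
  then show ?thesis
    unfolding connected_iff[OF G]
  proof (intro conjI ballI)
    show "pverts G \<noteq> {}" using rtreeD(1)[OF t] by blast
    show "(u, v) \<in> (parcs G)\<^sup>*" if "u \<in> pverts G" "v \<in> pverts G" for u v
      using up[OF that(1)] \<open>\<And>v. v \<in> pverts G \<Longrightarrow> (r, v) \<in> (parcs G)\<^sup>*\<close>[OF that(2)] by (rule rtrancl_trans)
  qed
qed

text \<open>The tree uses two arcs for each vertex other than the root; comparing depths shows that
  none is counted twice. The \<open>2 c\<close> in the bound arises here as a number of arcs, that
  is, of ends of nontree edges.\<close>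

lemma card_ntarcs:
  assumes G: "pair_graph G" and t: "rtree G r p d"
  shows "int (card (ntarcs G r p)) = 2 * cyclomatic G"
proof -
  note GD = pair_graph_simps[OF G]
  let ?V = "pverts G"
  let ?A = "(\<lambda>v. (v, p v)) ` (?V - {r})" and ?B = "(\<lambda>v. (p v, v)) ` (?V - {r})"
  have r: "r \<in> ?V" by (rule rtreeD(1)[OF t])
  have sub: "?A \<union> ?B \<subseteq> parcs G" using rtreeD(3)[OF t] GD(3) by (auto dest: symD)
  have dis: "?A \<inter> ?B = {}"
  proof -
    have False if "v \<in> ?V - {r}" "w \<in> ?V - {r}" "v = p w" "p v = w" for v w
    proof -
      have "d v = Suc (d w)" "d w = Suc (d v)" using that rtreeD(4)[OF t, of v] rtreeD(4)[OF t, of w] by auto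
      then show False by simp
    qed
    then show ?thesis by auto
  qed
  have cA: "card ?A = card ?V - 1" and cB: "card ?B = card ?V - 1"
    using GD(1) r by (auto simp: card_image inj_on_def)
  have N: "ntarcs G r p = parcs G - (?A \<union> ?B)"
    using GD(4,5) by (auto simp: ntarcs_def)
  have fin: "finite (?A \<union> ?B)" using GD(1) by auto
  have "card (?A \<union> ?B) = 2 * (card ?V - 1)"
    using card_Un_disjoint[OF _ _ dis] GD(1) cA cB by simp
  then have "card (ntarcs G r p) = card (parcs G) - 2 * (card ?V - 1)" "2 * (card ?V - 1) \<le> card (parcs G)"
    unfolding N using card_Diff_subset[OF fin sub] card_mono[OF GD(2) sub] by auto
  moreover have "card ?V \<ge> 1" using r GD(1) card_gt_0_iff[of ?V] by auto
  ultimately show ?thesis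
    using card_parcs_edges[OF G] by (simp add: cyclomatic_def of_nat_diff)
qed

context
  fixes G :: "'a pair_pre_digraph" and r p d
  assumes G: "pair_graph G" and t: "rtree G r p d"
begin

lemma rtree_p: "v \<in> pverts G \<Longrightarrow> v \<noteq> r \<Longrightarrow> (v, p v) \<in> parcs G \<and> p v \<in> pverts G \<and> d v = Suc (d (p v))"
  using rtreeD(3,4)[OF t] pair_graph_simps(5)[OF G] by blast

lemma dsc_in: "v \<in> dsc G r p w \<Longrightarrow> v \<in> pverts G"
  by (induction rule: dsc.induct) auto

lemma dsc_le: "v \<in> dsc G r p w \<Longrightarrow> d w \<le> d v"
proof (induction rule: dsc.induct)
  case (dsc_step v)
  then show ?case using rtree_p[of v] by auto
qed simp

lemma dsc_eq: "v \<in> dsc G r p w \<Longrightarrow> d v \<le> d w \<Longrightarrow> v = w"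
proof (induction rule: dsc.cases)
  case (dsc_step v)
  then show ?case using dsc_le[of "p v" w] rtree_p[of v] by auto
qed simp

lemma dsc_parent: "v \<in> dsc G r p w \<Longrightarrow> v \<noteq> w \<Longrightarrow> v \<noteq> r \<and> p v \<in> dsc G r p w"
  by (induction rule: dsc.cases) auto

lemma dsc_root: "v \<in> pverts G \<Longrightarrow> v \<in> dsc G r p r"
proof (induction "d v" arbitrary: v)
  case 0
  then show ?case using rtree_p[of v] by (cases "v = r") (auto intro: dsc.intros)
next
  case (Suc n)
  then have "v \<noteq> r" using rtreeD(2)[OF t] by auto
  with Suc show ?case using rtree_p[of v] by (auto intro: dsc_step)
qed

lemma dsc_trans: "v \<in> dsc G r p w \<Longrightarrow> w \<in> dsc G r p z \<Longrightarrow> v \<in> dsc G r p z"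
  by (induction rule: dsc.induct) (auto intro: dsc.intros)

lemma dsc_comparable:
  "v \<in> dsc G r p w \<Longrightarrow> v \<in> dsc G r p z \<Longrightarrow> w \<in> dsc G r p z \<or> z \<in> dsc G r p w"
proof (induction rule: dsc.induct)
  case (dsc_step v)
  then show ?case using dsc_parent[of v z] by (cases "v = z") (auto intro: dsc.intros)
qed auto

lemma dsc_child:
  "v \<in> dsc G r p w \<Longrightarrow> v \<noteq> w \<Longrightarrow> \<exists>c\<in>pverts G. c \<noteq> r \<and> p c = w \<and> v \<in> dsc G r p c"
proof (induction rule: dsc.induct)
  case (dsc_step v)
  show ?case
  proof (cases "p v = w")
    case True
    then show ?thesis using dsc_step by (intro bexI[of _ v]) (auto intro: dsc.intros)
  next
    case False
    then show ?thesis using dsc_step by (meson dsc.dsc_step)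
  qed
qed auto

lemma parent_notin_dsc: "w \<in> pverts G \<Longrightarrow> w \<noteq> r \<Longrightarrow> p w \<notin> dsc G r p w"
  using dsc_le[of "p w" w] rtree_p[of w] by auto

text \<open>Parent, children and nontree partners: the case distinction behind each use of the
  equation at a vertex.\<close>

lemma nb_rtree:
  assumes "v \<in> pverts G"
  shows "nb G v = (if v = r then {} else {p v}) \<union> {w \<in> pverts G. w \<noteq> r \<and> p w = v} \<union> {w. (v, w) \<in> ntarcs G r p}"
proof -
  note GD = pair_graph_simps[OF G]
  show ?thesis
  proof (intro equalityI subsetI)
    fix w assume "w \<in> nb G v"
    then show "w \<in> (if v = r then {} else {p v}) \<union> {w \<in> pverts G. w \<noteq> r \<and> p w = v} \<union> {w. (v, w) \<in> ntarcs G r p}"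
      using GD by (auto simp: nb_def ntarcs_def)
  next
    fix w assume "w \<in> (if v = r then {} else {p v}) \<union> {w \<in> pverts G. w \<noteq> r \<and> p w = v} \<union> {w. (v, w) \<in> ntarcs G r p}"
    then consider "v \<noteq> r" "w = p v" | "w \<in> pverts G" "w \<noteq> r" "p w = v" | "(v, w) \<in> ntarcs G r p"
      by (auto split: if_splits)
    then show "w \<in> nb G v"
      using rtree_p[of v] rtree_p[of w] assms GD(3) by cases (auto simp: nb_def ntarcs_def dest: symD)
  qed
qed

text \<open>The way from \<open>v\<close> to the root meets every depth from \<open>d v\<close> down
  to 0. The bound makes \<open>card V - d\<close> a measure for inductions towards the root, and it
  bounds the total depth.\<close>

lemma rtree_depth_less: "v \<in> pverts G \<Longrightarrow> d v < card (pverts G)"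
proof -
  assume v: "v \<in> pverts G"
  have "{0..d v} \<subseteq> d ` pverts G"
    using v
  proof (induction "d v" arbitrary: v)
    case 0
    then show ?case using image_eqI[of 0 d v] by auto
  next
    case (Suc n)
    then have "v \<noteq> r" using rtreeD(2)[OF t] by auto
    then have "{0..n} \<subseteq> d ` pverts G" using Suc rtree_p[of v] by (metis Suc_inject)
    moreover have "{0..d v} = insert (d v) {0..n}" using Suc(2) by auto
    ultimately show ?case using Suc(3) by auto
  qed
  then have "card {0..d v} \<le> card (d ` pverts G)"
    using pair_graph_simps(1)[OF G] by (intro card_mono) auto
  then show ?thesis using card_image_le[OF pair_graph_simps(1)[OF G], of d] by simp
qed

text \<open>A deepest vertex of the cycle would have its parent as both cyclic neighbours, although
  these differ when the length is at least 3.\<close>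

lemma no_ntarcs_no_cycle:
  assumes N: "ntarcs G r p = {}" and c: "pre_digraph.cycle (with_proj G) es" "3 \<le> length es"
  shows False
proof -
  note GD = pair_graph_simps[OF G]
  obtain u where u: "set es \<subseteq> parcs G" "pcas u es u" "distinct (tl (pawalk_verts u es))"
    using c(1) by (auto simp: pre_digraph.cycle_def pre_digraph.awalk_def cas_with_proj_eq awalk_verts_with_proj_eq)
  define n where "n = length es"
  have n3: "3 \<le> n" using c by (simp add: n_def)
  have dist: "distinct (map snd es)"
  proof -
    have "tl (pawalk_verts u es) = map snd es" if "pcas u es w" for u w
      using that
    proof (induction es arbitrary: u)
      case (Cons e es)
      then show ?case by (cases es) auto
    qed simp
    then show ?thesis using u by metis
  qed
  have nxt: "fst (es ! Suc i) = snd (es ! i)" if "Suc i < length es" "pcas u es w" for i u w and es :: "('a \<times> 'a) list"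
    using that
  proof (induction es arbitrary: u i)
    case (Cons e es)
    then show ?case by (cases i; cases es) auto
  qed simp
  have ends: "fst (es ! 0) = u \<and> snd (last es) = w" if "es \<noteq> []" "pcas u es w" for u w and es :: "('a \<times> 'a) list"
    using that
  proof (induction es arbitrary: u)
    case (Cons e es)
    then show ?case by (cases es) auto
  qed simp
  define ws where "ws = map snd es"
  have lw: "length ws = n" by (simp add: ws_def n_def)
  have arc: "(ws ! i, ws ! (Suc i mod n)) \<in> parcs G" if "i < n" for i
  proof (cases "Suc i < n")
    case True
    then have "(ws ! i, ws ! Suc i) = es ! Suc i" using nxt[of i es u u] u by (auto simp: ws_def n_def prod_eq_iff)
    moreover have "es ! Suc i \<in> parcs G" using u(1) True unfolding n_def by (meson nth_mem subsetD)
    ultimately show ?thesis using True by simp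
  next
    case False
    then have i: "Suc i = n" using that by simp
    have ne: "es \<noteq> []" using n3 by (auto simp: n_def)
    have "snd (es ! i) = snd (last es)" using ne unfolding last_conv_nth[OF ne] n_def[symmetric] i[symmetric] by simp
    then have "ws ! i = u" using ends[OF ne u(2)] i by (simp add: ws_def n_def)
    moreover have "snd (es ! 0) = ws ! 0" using ne by (simp add: ws_def)
    ultimately have "(ws ! i, ws ! 0) = es ! 0" using ends[OF ne u(2)] by (simp add: prod_eq_iff)
    moreover have "es ! 0 \<in> parcs G" using u(1) ne by (meson length_greater_0_conv nth_mem subsetD)
    ultimately show ?thesis using i by simp
  qed
  define m where "m = Max ((\<lambda>i. d (ws ! i)) ` {..<n})"
  have "(\<lambda>i. d (ws ! i)) ` {..<n} \<noteq> {}" using n3 by (auto simp: lessThan_empty_iff)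
  then have "m \<in> (\<lambda>i. d (ws ! i)) ` {..<n}" unfolding m_def by (intro Max_in) auto
  then obtain i where i: "i < n" "d (ws ! i) = m" by auto
  have mx: "d (ws ! j) \<le> m" if "j < n" for j unfolding m_def using that by auto
  define j where "j = (if i = 0 then n - 1 else i - 1)"
  have j: "j < n" "Suc j mod n = i" using n3 i by (auto simp: j_def)
  have tree: "w = p v" if "(v, w) \<in> parcs G" "d w \<le> d v" for v w
  proof -
    have "v \<noteq> r \<and> w = p v \<or> w \<noteq> r \<and> v = p w" using N that by (auto simp: ntarcs_def)
    then show ?thesis using rtree_p[of w] that GD(4,5) by (metis Suc_n_not_le_n)
  qed
  have "ws ! (Suc i mod n) = p (ws ! i)"
    using arc[OF i(1)] mx[of "Suc i mod n"] i n3 by (intro tree) auto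
  moreover have "ws ! j = p (ws ! i)"
    using arc[OF j(1)] mx[OF j(1)] i GD(3) unfolding j(2) by (intro tree) (auto dest: symD)
  ultimately have "ws ! (Suc i mod n) = ws ! j" by simp
  then have "Suc i mod n = j" using nth_eq_iff_index_eq[of ws "Suc i mod n" j] dist j n3 lw by (simp add: ws_def)
  then show False using n3 i by (cases "Suc i = n") (auto simp: j_def split: if_splits)
qed

text \<open>Deleting the nontree edge leaves the spanning tree intact, so the remaining graph
  \<open>H\<close> is connected, and a path in \<open>H\<close> between the two ends closes up with
  the deleted edge. The path has length at least 2 because the edge itself is gone.\<close>

lemma ntarcs_cycle:
  assumes N: "(a, y) \<in> ntarcs G r p"
  shows "\<exists>es. pre_digraph.cycle (with_proj G) es \<and> 3 \<le> length es"
proof -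
  note GD = pair_graph_simps[OF G]
  have ay: "(a, y) \<in> parcs G" "(y, a) \<in> parcs G" using N GD(3) by (auto simp: ntarcs_def dest: symD)
  define H where "H = \<lparr>pverts = pverts G, parcs = parcs G - {(a, y), (y, a)}\<rparr>"
  have H: "pair_graph H"
    using GD by (intro pair_graphI) (auto simp: H_def sym_def)
  have "rtree H r p d"
    using t N ntarcs_sym[OF G, of a y r p] by (auto simp: rtree_def H_def ntarcs_def)
  then have "Digraph_Component.connected (with_proj H)" using rtree_connected[OF H] by blast
  then have "(y, a) \<in> (parcs H)\<^sup>*"
    using connected_iff[OF H] GD ay by (auto simp: H_def)
  then obtain k where "(y, a) \<in> parcs H ^^ k" by (auto simp: rtrancl_power)
  then obtain q0 where q0: "pre_digraph.awalk (with_proj H) y q0 a"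
  proof -
    have "y \<in> pverts H" using GD(4)[OF ay(2)] by (simp add: H_def)
    then show ?thesis using awalk_relpow[OF H, of y a k] \<open>(y, a) \<in> parcs H ^^ k\<close> that by blast
  qed
  interpret H: wf_digraph "with_proj H" using H by (simp add: wf_digraph_wp_iff pair_graph_def pair_digraph_def pair_fin_digraph_def)
  obtain q where q: "H.apath y q a" using H.apath_awalk_to_apath[OF q0] by blast
  then have q': "set q \<subseteq> parcs H" "pcas y q a" "distinct (pawalk_verts y q)"
    by (auto simp: H.apath_def H.awalk_def cas_with_proj_eq awalk_verts_with_proj_eq)
  have app: "pcas u (q @ [(a, y)]) y \<and> pawalk_verts u (q @ [(a, y)]) = pawalk_verts u q @ [y]"
    if "pcas u q a" for u q
    using that by (induction q arbitrary: u) auto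
  have "pawalk_verts y q = y # tl (pawalk_verts y q)"
    using q'(2) by (cases q) auto
  then have "tl (pawalk_verts y q @ [y]) = tl (pawalk_verts y q) @ [y]" "y \<notin> set (tl (pawalk_verts y q))"
    using q'(3) by (metis list.sel(3) append_Cons, metis distinct.simps(2))
  then have "distinct (tl (pawalk_verts y (q @ [(a, y)])))"
    using app[OF q'(2)] q'(3) by (simp add: distinct_tl)
  then have "pre_digraph.cycle (with_proj G) (q @ [(a, y)])"
    unfolding pre_digraph.cycle_def pre_digraph.awalk_def cas_with_proj_eq awalk_verts_with_proj_eq
    using app[OF q'(2)] q'(1) ay GD by (intro exI[of _ y]) (auto simp: H_def)
  moreover have "2 \<le> length q"
  proof (rule ccontr)
    assume "\<not> ?thesis"
    then consider "q = []" | e where "q = [e]" by (cases q; cases "tl q") auto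
    then show False
      using q' ay GD by cases (auto simp: H_def)
  qed
  ultimately show ?thesis by (intro exI[of _ "q @ [(a, y)]"]) auto
qed

end

section \<open>Pendant paths\<close>

lemma graph_mult_le_card:
  assumes G: "pair_graph G" and W: "finite W"
    and inj: "\<And>f. f \<in> eigsp G x \<Longrightarrow> (\<And>w. w \<in> W \<Longrightarrow> f w = 0) \<Longrightarrow> f = (\<lambda>_. 0)"
  shows "graph_mult G x \<le> card W"
proof -
  obtain e where e: "bij_betw e {..<card W} W" using ex_bij_betw_nat_finite[OF W] by (auto simp: lessThan_atLeast0)
  show ?thesis
  proof (rule graph_mult_le[OF G, where \<phi> = "\<lambda>j f. f (e j)"])
    fix f assume f: "f \<in> eigsp G x" "\<And>j. j < card W \<Longrightarrow> f (e j) = 0"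
    show "f = (\<lambda>_. 0)"
    proof (rule inj[OF f(1)])
      fix w assume "w \<in> W"
      then obtain j where "j < card W" "w = e j" using e by (auto simp: bij_betw_def)
      then show "f w = 0" using f(2) by simp
    qed
  qed (rule clin_eval)
qed

text \<open>\<open>chebU x (n + 1)\<close> is the characteristic polynomial of \<open>P\<^sub>n\<close> at \<open>x\<close>.\<close>

fun chebU :: "real \<Rightarrow> nat \<Rightarrow> real" where
  "chebU x 0 = 0"
| "chebU x (Suc 0) = 1"
| "chebU x (Suc (Suc n)) = x * chebU x (Suc n) - chebU x n"

lemma pair_graph_mk_graph:
  assumes "finite V" "\<And>v. \<not> R v v"
  shows "pair_graph (mk_graph V R)"
  using assms by (intro pair_graphI) (auto simp: mk_graph_def sym_def)

lemma pair_graph_path: "pair_graph (path_graph n)"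
  unfolding path_graph_def by (rule pair_graph_mk_graph) auto

text \<open>The values of \<open>chebU x\<close> at \<open>1\<close>, ..., \<open>s\<close> satisfy
  the equations of \<open>P_s\<close>; the equation of the last vertex is the vanishing of the next
  value.\<close>

lemma chebU_path:
  assumes x: "x \<notin> graph_spectrum (path_graph s)" and s: "1 \<le> s"
  shows "chebU x (Suc s) \<noteq> 0"
proof
  assume 0: "chebU x (Suc s) = 0"
  define f where "f = (\<lambda>i. if i < s then complex_of_real (chebU x (Suc i)) else 0)"
  \<comment> \<open>At \<open>i = s\<close>, just beyond the path, both sides are zero by
    assumption; this lets the last vertex be treated like an inner one.\<close>
  have f': "f i = complex_of_real (chebU x (Suc i))" if "i \<le> s" for i
    using that 0 by (cases "i = s") (auto simp: f_def)
  have "f \<in> eigsp (path_graph s) x"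
    unfolding eigsp_def
  proof (intro CollectI conjI ballI)
    show "\<forall>v. v \<notin> pverts (path_graph s) \<longrightarrow> f v = 0"
      by (auto simp: path_graph_def mk_graph_def f_def)
    fix v assume "v \<in> pverts (path_graph s)"
    then have v: "v < s" by (simp add: path_graph_def mk_graph_def)
    have nb: "nb (path_graph s) v = {w. w < s \<and> (w = Suc v \<or> v = Suc w)}"
      using v by (auto simp: nb_def path_graph_def mk_graph_def)
    show "(\<Sum>w\<in>nb (path_graph s) v. f w) = complex_of_real x * f v"
    proof (cases v)
      case 0
      have "(\<Sum>w\<in>nb (path_graph s) v. f w) = f (Suc v)"
      proof (cases "Suc v < s")
        case True
        then have "nb (path_graph s) v = {Suc v}" unfolding nb using 0 by blast
        then show ?thesis by simp
      next
        case False
        then have "nb (path_graph s) v = {}" unfolding nb using 0 by blast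
        then show ?thesis using False by (simp add: f_def)
      qed
      then show ?thesis using f'[of "Suc v"] f'[of v] v 0 by simp
    next
      case (Suc u)
      have "(\<Sum>w\<in>nb (path_graph s) v. f w) = f u + f (Suc v)"
      proof (cases "Suc v < s")
        case True
        then have "nb (path_graph s) v = {u, Suc v}" unfolding nb using Suc by auto
        then show ?thesis using Suc by simp
      next
        case False
        then have "nb (path_graph s) v = {u}" unfolding nb using Suc v by auto
        then show ?thesis using False by (simp add: f_def)
      qed
      then show ?thesis using f'[of "Suc v"] f'[of v] f'[of u] v Suc by simp
    qed
  qed
  moreover have "f 0 \<noteq> 0" using s by (simp add: f_def)
  then have "f \<noteq> (\<lambda>_. 0)" by auto
  ultimately show False using x graph_spectrum_iff[OF pair_graph_path] by blast
qed

text \<open>\<open>us ! 0\<close> is a leaf and \<open>us ! s\<close>, which may have any degree, is the vertex of \<open>Q\<close>.\<close>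

definition legpath :: "nat \<Rightarrow> 'a pair_pre_digraph \<Rightarrow> 'a list \<Rightarrow> bool" where
  "legpath s G us \<longleftrightarrow> length us = Suc s \<and> distinct us \<and> set us \<subseteq> pverts G \<and>
     (\<forall>i<s. (us ! i, us ! Suc i) \<in> parcs G) \<and> card (nb G (us ! 0)) = 1 \<and>
     (\<forall>i. 1 \<le> i \<longrightarrow> i < s \<longrightarrow> card (nb G (us ! i)) = 2)"

lemma finite_nb: "pair_graph G \<Longrightarrow> finite (nb G v)"
  by (rule finite_subset[of _ "pverts G"]) (auto simp: nb_def pair_graph_simps)

lemma nb_sym: "pair_graph G \<Longrightarrow> w \<in> nb G v \<longleftrightarrow> v \<in> nb G w"
  using pair_graph_simps(3)[of G] by (auto simp: nb_def dest: symD)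

lemma parent_nb:
  "pair_graph G \<Longrightarrow> rtree G r p d \<Longrightarrow> v \<in> pverts G \<Longrightarrow> v \<noteq> r \<Longrightarrow> p v \<in> nb G v"
  using rtreeD(3) by (simp add: nb_def)

lemma child_nb:
  "pair_graph G \<Longrightarrow> rtree G r p d \<Longrightarrow> w \<in> pverts G \<Longrightarrow> w \<noteq> r \<Longrightarrow> p w = v \<Longrightarrow> w \<in> nb G v"
  using parent_nb[of G r p d w] nb_sym[of G "p w" w] by simp

lemma ntarcs_iff:
  "(v, w) \<in> ntarcs G r p \<longleftrightarrow> w \<in> nb G v \<and> \<not> (v \<noteq> r \<and> w = p v) \<and> \<not> (w \<noteq> r \<and> v = p w)"
  by (simp add: ntarcs_def nb_def)

lemma legpath_nb:
  assumes G: "pair_graph G" and l: "legpath s G us" and i: "i < s"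
  shows "nb G (us ! i) = (if i = 0 then {us ! 1} else {us ! (i - 1), us ! Suc i})"
proof -
  have fin: "finite (nb G (us ! i))" by (rule finite_nb[OF G])
  have 1: "us ! Suc i \<in> nb G (us ! i)" using l i by (auto simp: legpath_def nb_def)
  show ?thesis
  proof (cases "i = 0")
    case True
    then have "card (nb G (us ! i)) = 1" using l by (simp add: legpath_def)
    then obtain z where "nb G (us ! i) = {z}" by (rule card_1_singletonE)
    then show ?thesis using 1 True by simp
  next
    case False
    have "i - 1 < s" using i by simp
    then have "(us ! (i - 1), us ! Suc (i - 1)) \<in> parcs G" using l unfolding legpath_def by blast
    then have "us ! (i - 1) \<in> nb G (us ! i)" using False nb_sym[OF G] by (simp add: nb_def)
    moreover have "us ! (i - 1) \<noteq> us ! Suc i"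
      using l i by (auto simp: legpath_def nth_eq_iff_index_eq)
    moreover have "card (nb G (us ! i)) = 2" using l i False by (simp add: legpath_def)
    ultimately have "{us ! (i - 1), us ! Suc i} = nb G (us ! i)"
      using 1 fin by (intro card_subset_eq) auto
    then show ?thesis using False by simp
  qed
qed

lemma closed_all:
  assumes G: "pair_graph G" and c: "Digraph_Component.connected (with_proj G)"
    and W: "w \<in> W" "w \<in> pverts G" and cl: "\<And>v. v \<in> W \<Longrightarrow> nb G v \<subseteq> W"
  shows "pverts G \<subseteq> W"
proof
  fix v assume "v \<in> pverts G"
  then have "(w, v) \<in> (parcs G)\<^sup>*" using c W connected_iff[OF G] by auto
  then show "v \<in> W" using W(1)
  proof (induction rule: rtrancl_induct)
    case (step y z)
    then show ?case using cl[of y] by (auto simp: nb_def)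
  qed
qed

text \<open>The path is prolonged from the leaf one vertex at a time. A vertex of degree at least 3
  before step \<open>s\<close> would end a pendant path of order less than \<open>s\<close>, against
  \<open>GG s\<close>; a path that cannot be prolonged would be the whole graph, against
  \<open>w0\<close>.\<close>

lemma legpath_exists:
  assumes G: "pair_graph G" and c: "Digraph_Component.connected (with_proj G)"
    and GG: "G \<in> GG s" and big: "w0 \<in> pverts G" "3 \<le> card (nb G w0)"
    and l: "l \<in> pverts G" "card (nb G l) = 1"
  shows "\<exists>us. legpath s G us \<and> us ! 0 = l"
proof -
  have "\<exists>us. legpath n G us \<and> us ! 0 = l" if "n \<le> s" for n
    using that
  proof (induction n)
    case 0
    then show ?case using l by (intro exI[of _ "[l]"]) (auto simp: legpath_def)
  next
    case (Suc n)
    then obtain us where us: "legpath n G us" "us ! 0 = l" by auto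
    have len: "length us = Suc n" and dis: "distinct us" and sub: "set us \<subseteq> pverts G"
      and arc: "\<And>i. i < n \<Longrightarrow> (us ! i, us ! Suc i) \<in> parcs G"
      using us by (auto simp: legpath_def)
    note fin = finite_nb[OF G]
    have lnb: "nb G (us ! i) = (if i = 0 then {us ! 1} else {us ! (i - 1), us ! Suc i})" if "i < n" for i
      by (rule legpath_nb[OF G us(1) that])
    have inV: "us ! i \<in> pverts G" if "i \<le> n" for i using sub len that nth_mem[of i us] by auto
    have prev: "us ! (n - 1) \<in> nb G (us ! n)" if "n \<noteq> 0"
      using arc[of "n - 1"] that nb_sym[OF G] by (simp add: nb_def)
    have neq: "us ! i \<noteq> us ! j" if "i \<le> n" "j \<le> n" "i \<noteq> j" for i j
      using that len dis by (simp add: nth_eq_iff_index_eq)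
    have pos: "1 \<le> card (nb G (us ! n))"
      using prev us(2) l fin[of "us ! n"] by (cases "n = 0") (auto simp: Suc_le_eq card_gt_0_iff)
    have old: "w = us ! (n - 1) \<and> n \<noteq> 0" if w: "w \<in> nb G (us ! n)" "w \<in> set us" for w
    proof -
      obtain i where i: "i \<le> n" "w = us ! i" using w(2) len by (auto simp: in_set_conv_nth less_Suc_eq_le)
      have "i \<noteq> n" using w(1) i pair_graph_simps(6)[OF G] by (auto simp: nb_def)
      then have "i < n" using i by simp
      moreover have "us ! n \<in> nb G (us ! i)" using w(1) i nb_sym[OF G] by simp
      ultimately have "us ! n = us ! (i - 1) \<or> us ! n = us ! Suc i"
        using lnb[of i] by (auto split: if_splits)
      then have "n = Suc i"
        using neq[of n "i - 1"] neq[of n "Suc i"] \<open>i < n\<close> by auto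
      then show ?thesis using i by auto
    qed
    \<comment> \<open>If all neighbours of the last vertex lie on the path, then the path is closed
      under neighbours and contains every vertex by connectedness; but all its degrees are at most
      2.\<close>
    have close: False if cl: "nb G (us ! n) \<subseteq> set us" "card (nb G (us ! n)) \<le> 2"
    proof -
      have "nb G v \<subseteq> set us" if v: "v \<in> set us" for v
      proof -
        obtain i where i: "i \<le> n" "v = us ! i" 
        proof -
          obtain i where "i < length us" "us ! i = v" using v unfolding in_set_conv_nth by blast
          then show thesis using len by (intro that[of i]) auto
        qed
        show ?thesis
        proof (cases "i = n")
          case False
          then have "i < n" using i by simp
          then have "us ! 1 \<in> set us" if "i = 0" using that len by simp
          moreover have "us ! (i - 1) \<in> set us" "us ! Suc i \<in> set us" using \<open>i < n\<close> len by simp_all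
          ultimately show ?thesis using lnb[OF \<open>i < n\<close>] i(2) by auto
        qed (use cl i in simp)
      qed
      moreover have "us ! 0 \<in> set us" using len by simp
      ultimately have "pverts G \<subseteq> set us" using closed_all[OF G c, of "us ! 0" "set us"] inV[of 0] by blast
      then have "w0 \<in> set us" using big by blast
      then obtain i where "i < length us" "us ! i = w0" unfolding in_set_conv_nth by blast
      then have i: "i \<le> n" "w0 = us ! i" using len by auto
      show False
      proof (cases "i = n")
        case False
        then have "i < n" using i by simp
        then have "card (nb G w0) \<le> 2" using lnb[of i] i by (auto simp: card_insert_if)
        then show False using big by simp
      qed (use cl i big in simp)
    qed
    have deg: "card (nb G (us ! n)) = (if n = 0 then 1 else 2)"
    proof (cases "n = 0")
      case True
      then show ?thesis using us l by simp
    next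
      case False
      consider "card (nb G (us ! n)) = 1" | "card (nb G (us ! n)) = 2" | "3 \<le> card (nb G (us ! n))"
        using pos by linarith
      then show ?thesis
      proof cases
        case 1
        then obtain z where "nb G (us ! n) = {z}" by (rule card_1_singletonE)
        then have "nb G (us ! n) = {us ! (n - 1)}" using prev[OF False] by simp
        then show ?thesis using close len 1 by (auto intro!: nth_mem)
      next
        case 3
        define vs where "vs = take n us"
        have vs: "us = vs @ [us ! n]" using len by (simp add: vs_def take_Suc_conv_app_nth[symmetric])
        have lv: "length vs = n" by (simp add: vs_def len)
        have "induced_path G us"
          unfolding induced_path_def
        proof (intro conjI allI impI)
          fix i j assume ij: "i < length us" "j < length us"
          show "(us ! i, us ! j) \<in> parcs G \<longleftrightarrow> j = Suc i \<or> i = Suc j"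
          proof
            assume "j = Suc i \<or> i = Suc j"
            then show "(us ! i, us ! j) \<in> parcs G"
              using arc[of i] arc[of j] ij len pair_graph_simps(3)[OF G] by (auto dest: symD)
          next
            assume a: "(us ! i, us ! j) \<in> parcs G"
            then have a': "us ! j \<in> nb G (us ! i)" "us ! i \<in> nb G (us ! j)"
              using nb_sym[OF G, of "us ! i" "us ! j"] by (auto simp: nb_def)
            have ne: "i \<noteq> j" using a pair_graph_simps(6)[OF G] by auto
            consider "i < n" | "j < n" using ne ij len by linarith
            then show "j = Suc i \<or> i = Suc j"
            proof cases
              case 1
              then have "us ! j = us ! (i - 1) \<and> i \<noteq> 0 \<or> us ! j = us ! Suc i"
                using a' lnb[of i] by (auto split: if_splits)
              then show ?thesis using neq[of j "i - 1"] neq[of j "Suc i"] 1 ij len by force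
            next
              case 2
              then have "us ! i = us ! (j - 1) \<and> j \<noteq> 0 \<or> us ! i = us ! Suc j"
                using a' lnb[of j] by (auto split: if_splits)
              then show ?thesis using neq[of i "j - 1"] neq[of i "Suc j"] 2 ij len by force
            qed
          qed
        qed (use dis sub in auto)
        moreover have "hd vs = us ! 0" using False len by (cases us) (auto simp: vs_def hd_conv_nth take_Cons')
        moreover have "card (nb G z) = 2" if z: "z \<in> set (tl vs)" for z
        proof -
          obtain k where k: "k < length (tl vs)" "z = tl vs ! k" using z by (auto simp: in_set_conv_nth)
          then have "z = us ! Suc k" "Suc k < n" using lv by (auto simp: nth_tl vs_def)
          then show ?thesis using us(1) by (simp add: legpath_def)
        qed
        ultimately have "pendant_path G vs"
          unfolding pendant_path_def using False lv 3 us l vs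
          by (intro conjI exI[of _ "us ! n"]) (auto simp: out_degree_nb)
        then have "s \<le> n" using GG lv by (auto simp: GG_def)
        then show ?thesis using Suc.prems by simp
      qed (use False in simp)
    qed
    obtain w where w: "w \<in> nb G (us ! n)" "w \<notin> set us"
      using close deg by (auto split: if_splits)
    have "legpath (Suc n) G (us @ [w])"
      unfolding legpath_def
    proof (intro conjI allI impI)
      show "set (us @ [w]) \<subseteq> pverts G" using sub w pair_graph_simps(5)[OF G] by (auto simp: nb_def)
      show "((us @ [w]) ! i, (us @ [w]) ! Suc i) \<in> parcs G" if "i < Suc n" for i
        using that arc[of i] w len by (auto simp: nth_append nb_def less_Suc_eq)
      show "card (nb G ((us @ [w]) ! 0)) = 1" using us l len by (simp add: nth_append)
      show "card (nb G ((us @ [w]) ! i)) = 2" if "1 \<le> i" "i < Suc n" for i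
        using that us(1) deg len by (cases "i = n") (auto simp: nth_append legpath_def)
    qed (use len dis w in auto)
    moreover have "(us @ [w]) ! 0 = l" using us len by (simp add: nth_append)
    ultimately show ?case by blast
  qed
  then show ?thesis by blast
qed

text \<open>The inner vertices of the path have no other neighbours, so a walk of
  \<open>j <= s\<close> steps from the leaf reaches only the first \<open>j + 1\<close> vertices.
  Hence a leaf determines its vertex of \<open>Q\<close>.\<close>

lemma legpath_dist:
  assumes G: "pair_graph G" and l: "legpath s G us"
  shows "(us ! 0, v) \<in> parcs G ^^ s \<and> (\<forall>j<s. (us ! 0, v) \<notin> parcs G ^^ j) \<longleftrightarrow> v = us ! s"
proof -
  have len: "length us = Suc s" and dis: "distinct us" and arc: "\<And>i. i < s \<Longrightarrow> (us ! i, us ! Suc i) \<in> parcs G"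
    using l by (auto simp: legpath_def)
  have reach: "(us ! 0, us ! i) \<in> parcs G ^^ i" if "i \<le> s" for i
    using that arc by (induction i) (auto intro: relpow_Suc_I)
  have reached: "\<exists>i\<le>j. w = us ! i" if "(us ! 0, w) \<in> parcs G ^^ j" "j \<le> s" for j w
    using that
  proof (induction j arbitrary: w)
    case (Suc j)
    then obtain z where z: "(us ! 0, z) \<in> parcs G ^^ j" "(z, w) \<in> parcs G" by auto
    then obtain i where i: "i \<le> j" "z = us ! i" using Suc by auto
    then have "w \<in> nb G (us ! i)" "i < s" using z Suc.prems by (auto simp: nb_def)
    then have "w = us ! (i - 1) \<or> w = us ! Suc i" using legpath_nb[OF G l, of i] by (auto split: if_splits)
    then show ?case using i by (metis Suc_le_mono diff_le_self le_SucI le_trans)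
  qed auto
  show ?thesis
  proof
    assume a: "(us ! 0, v) \<in> parcs G ^^ s \<and> (\<forall>j<s. (us ! 0, v) \<notin> parcs G ^^ j)"
    then obtain i where "i \<le> s" "v = us ! i" using reached by blast
    then show "v = us ! s" using a reach[of i] by (cases "i = s") auto
  next
    assume v: "v = us ! s"
    have "(us ! 0, v) \<notin> parcs G ^^ j" if js: "j < s" for j
    proof
      assume "(us ! 0, v) \<in> parcs G ^^ j"
      then obtain i where "i \<le> j" "v = us ! i" using reached[of v j] less_imp_le[OF js] by blast
      then show False using v js dis len by (simp add: nth_eq_iff_index_eq)
    qed
    then show "(us ! 0, v) \<in> parcs G ^^ s \<and> (\<forall>j<s. (us ! 0, v) \<notin> parcs G ^^ j)" using v reach by auto
  qed
qed

text \<open>The equations propagate the value at the leaf: \<open>f (us ! i)\<close> is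
  \<open>chebU x (Suc i)\<close> times \<open>f (us ! 0)\<close>. At \<open>i = s\<close> the factor
  is nonzero because \<open>x\<close> is not an eigenvalue of \<open>P_s\<close>.\<close>

lemma legpath_eig:
  assumes G: "pair_graph G" and x: "x \<notin> graph_spectrum (path_graph s)" and s: "1 \<le> s"
    and f: "f \<in> eigsp G x" and l: "legpath s G us" and 0: "f (us ! s) = 0" and i: "i \<le> s"
  shows "f (us ! i) = 0"
proof -
  have "us ! j \<in> pverts G" if "j \<le> s" for j
    using l nth_mem[of j us] that by (auto simp: legpath_def)
  then have ev: "(\<Sum>w\<in>nb G (us ! j). f w) = complex_of_real x * f (us ! j)" if "j \<le> s" for j
    using f that by (auto simp: eigsp_def)
  have val: "f (us ! i) = complex_of_real (chebU x (Suc i)) * f (us ! 0)" if "i \<le> s" for i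
    using that
  proof (induction i rule: induct_nat_012)
    case 1
    then show ?case using ev[of 0] legpath_nb[OF G l, of 0] by simp
  next
    case (ge2 n)
    have "us ! n \<noteq> us ! Suc (Suc n)" using l ge2.prems by (auto simp: legpath_def nth_eq_iff_index_eq)
    then have "f (us ! n) + f (us ! Suc (Suc n)) = complex_of_real x * f (us ! Suc n)"
      using ev[of "Suc n"] legpath_nb[OF G l, of "Suc n"] ge2.prems by simp
    then have "f (us ! Suc (Suc n)) = complex_of_real x * f (us ! Suc n) - f (us ! n)"
      by (simp add: algebra_simps)
    then show ?case using ge2 by (simp add: algebra_simps)
  qed simp
  have "f (us ! 0) = 0" using val[of s] 0 chebU_path[OF x s] by simp
  then show ?thesis using val[OF i] by simp
qed

section \<open>Legs and the vertices of \<open>Q\<close> at their ends\<close>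

definition Legs :: "nat \<Rightarrow> 'a pair_pre_digraph \<Rightarrow> 'a set" where
  "Legs s G = {us ! i |us i. legpath s G us \<and> i < s}"

text \<open>The vertex of degree at least 3 excludes paths and cycles, so that every leaf starts a
  path as in \<open>legpath\<close>.\<close>

locale legged =
  fixes G :: "'a pair_pre_digraph" and s :: nat and x :: real
  assumes G: "pair_graph G" and c: "Digraph_Component.connected (with_proj G)"
    and GGs: "G \<in> GG s" and s: "1 \<le> s" and x: "x \<notin> graph_spectrum (path_graph s)"
    and big: "\<exists>w\<in>pverts G. 3 \<le> card (nb G w)"
begin

abbreviation "V \<equiv> pverts G"
abbreviation "L \<equiv> Legs s G"
abbreviation "QQ \<equiv> Q s G"

lemmas GD = pair_graph_simps[OF G]
lemmas fin_nb = finite_nb[OF G]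
lemmas nb_symm = nb_sym[OF G]

lemma leaf_leg: "l \<in> V \<Longrightarrow> card (nb G l) = 1 \<Longrightarrow> \<exists>us. legpath s G us \<and> us ! 0 = l"
  using legpath_exists[OF G c GGs] big by blast

text \<open>Replaces the metric definition of \<open>Q\<close>: the leg of a leaf ends at the only
  vertex at distance \<open>s\<close> from it.\<close>

lemma Q_iff: "v \<in> QQ \<longleftrightarrow> (\<exists>us. legpath s G us \<and> us ! s = v)"
proof
  assume "v \<in> QQ"
  then obtain l where l: "v \<in> V" "l \<in> V" "card (nb G l) = 1"
    "wf_digraph.\<mu> (with_proj G) (\<lambda>_. 1) l v = ereal (real s)"
    by (auto simp: Q_def pendant_vertex_def out_degree_nb)
  then obtain us where us: "legpath s G us" "us ! 0 = l" using leaf_leg by blast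
  have "(l, v) \<in> parcs G ^^ s \<and> (\<forall>j<s. (l, v) \<notin> parcs G ^^ j)"
    using l(4) dist_iff[OF G l(2), of v s] by simp
  then have "us ! s = v" using legpath_dist[OF G us(1), of v] us(2) by simp
  then show "\<exists>us. legpath s G us \<and> us ! s = v" using us by blast
next
  assume "\<exists>us. legpath s G us \<and> us ! s = v"
  then obtain us where us: "legpath s G us" "us ! s = v" by blast
  have len: "length us = Suc s" and sub: "set us \<subseteq> V" using us by (auto simp: legpath_def)
  then have V: "us ! 0 \<in> V" "v \<in> V" using us by (auto intro!: subsetD[OF sub] nth_mem)
  have "card (nb G (us ! 0)) = 1" using us by (simp add: legpath_def)
  moreover have "wf_digraph.\<mu> (with_proj G) (\<lambda>_. 1) (us ! 0) v = ereal (real s)"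
    using legpath_dist[OF G us(1), of v] us(2) dist_iff[OF G V(1), of v s] by simp
  ultimately show "v \<in> QQ" using V by (auto simp: Q_def pendant_vertex_def out_degree_nb)
qed

lemma legpath_in: "legpath s G us \<Longrightarrow> i \<le> s \<Longrightarrow> us ! i \<in> V"
  using nth_mem[of i us] by (auto simp: legpath_def)

lemma Q_sub: "QQ \<subseteq> V" using legpath_in by (auto simp: Q_iff)

lemma finite_Q: "finite QQ" using Q_sub GD(1) by (rule finite_subset)

lemma leaf_L: "l \<in> V \<Longrightarrow> card (nb G l) = 1 \<Longrightarrow> l \<in> L"
  using leaf_leg s by (fastforce simp: Legs_def)

lemma deg_L: "v \<in> L \<Longrightarrow> card (nb G v) \<le> 2"
proof -
  assume "v \<in> L"
  then obtain us i where "legpath s G us" "i < s" "v = us ! i" by (auto simp: Legs_def)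
  then show ?thesis using legpath_nb[OF G, of s us i] by (auto simp: card_insert_if)
qed

text \<open>Whatever the spanning tree, a leg that avoids the root hangs in it as a bare chain with
  the leaf lowest. The only neighbour of the leaf is its parent, and from there on each vertex has
  one neighbour below it and must have the other one as its parent.\<close>

lemma leg_tree:
  assumes t: "rtree G r p d" and r: "\<And>i. i < s \<Longrightarrow> us ! i \<noteq> r" and l: "legpath s G us" and i: "i < s"
  shows "p (us ! i) = us ! Suc i \<and> {w \<in> V. w \<noteq> r \<and> p w = us ! i} = (if i = 0 then {} else {us ! (i - 1)}) \<and>
    (\<forall>z. (us ! i, z) \<notin> ntarcs G r p)"
  using i
proof (induction i)
  case 0
  have nb: "nb G (us ! 0) = {us ! 1}" using legpath_nb[OF G l 0] by simp
  have V: "us ! 0 \<in> V" using legpath_in[OF l, of 0] by simp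
  have p: "p (us ! 0) = us ! 1" using parent_nb[OF G t V r[OF 0]] nb by simp
  have nc: "p w \<noteq> us ! 0" if w: "w \<in> V" "w \<noteq> r" for w
  proof
    assume pw: "p w = us ! 0"
    have "w = p (us ! 0)" using child_nb[OF G t w pw] nb p by simp
    then have "d w = d (p (us ! 0))" by (rule arg_cong)
    moreover have "d w = Suc (d (us ! 0))" using rtree_p[OF G t w] unfolding pw by blast
    moreover have "d (us ! 0) = Suc (d (p (us ! 0)))" using rtree_p[OF G t V r[OF 0]] by blast
    ultimately show False by linarith
  qed
  have "(us ! 0, z) \<notin> ntarcs G r p" for z
    unfolding ntarcs_iff nb using p r[OF 0] by simp
  then show ?case using p nc by auto
next
  case (Suc i)
  then have IH: "p (us ! i) = us ! Suc i" by auto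
  have i_s: "i < s" using Suc.prems by simp
  have nb: "nb G (us ! Suc i) = {us ! i, us ! Suc (Suc i)}" using legpath_nb[OF G l Suc.prems] by simp
  have V: "us ! Suc i \<in> V" "us ! i \<in> V" using legpath_in[OF l] Suc.prems by simp_all
  note r1 = r[OF Suc.prems] and r0 = r[OF i_s]
  have d0: "d (us ! i) = Suc (d (us ! Suc i))" using rtree_p[OF G t V(2) r0] unfolding IH by blast
  have d1: "d (us ! Suc i) = Suc (d (p (us ! Suc i)))" using rtree_p[OF G t V(1) r1] by blast
  have "p (us ! Suc i) \<noteq> us ! i"
  proof
    assume "p (us ! Suc i) = us ! i"
    then have "d (p (us ! Suc i)) = d (us ! i)" by (rule arg_cong)
    then show False using d0 d1 by linarith
  qed
  then have p: "p (us ! Suc i) = us ! Suc (Suc i)" using parent_nb[OF G t V(1) r1] nb by simp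
  have ch: "w = us ! i" if w: "w \<in> V" "w \<noteq> r" and pw: "p w = us ! Suc i" for w
  proof -
    have dw: "d w = Suc (d (us ! Suc i))" using rtree_p[OF G t w] unfolding pw by blast
    have "w \<noteq> us ! Suc (Suc i)"
    proof
      assume "w = us ! Suc (Suc i)"
      then have "d w = d (p (us ! Suc i))" using p by simp
      then show False using dw d1 by linarith
    qed
    then show ?thesis using child_nb[OF G t w pw] nb by simp
  qed
  have "{w \<in> V. w \<noteq> r \<and> p w = us ! Suc i} = {us ! i}"
    using V(2) IH r0 ch by blast
  moreover have "(us ! Suc i, z) \<notin> ntarcs G r p" for z
    unfolding ntarcs_iff nb using p r1 IH r0 by auto
  ultimately show ?case using p by simp
qed

text \<open>In an auxiliary tree rooted at a vertex of degree at least 3, a leg vertex has at most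
  one child, so two legs that meet agree all the way down to their leaves. Applied with
  \<open>i = s\<close> this keeps \<open>Q\<close> off the legs.\<close>

lemma legs_meet:
  assumes "legpath s G us" "legpath s G vs" "j < s" "i \<le> s" "us ! i = vs ! j"
  shows "i = j \<and> us ! 0 = vs ! 0"
proof -
  obtain r where r: "r \<in> V" "3 \<le> card (nb G r)" using big by auto
  have rL: "r \<notin> L" using deg_L[of r] r by auto
  have nr: "ws ! k \<noteq> r" if "legpath s G ws" "k < s" for ws k using that rL by (auto simp: Legs_def)
  obtain p d where t: "rtree G r p d" using rtree_exists[OF G c r(1)] by auto
  note T = leg_tree[OF t nr]
  show ?thesis using assms(3-5)
  proof (induction j arbitrary: i)
    case 0
    show ?case
    proof (cases i)
      case (Suc k)
      then have "us ! k \<in> {w \<in> V. w \<noteq> r \<and> p w = vs ! 0}"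
        using T[OF assms(1) _ assms(1), of k] 0 legpath_in[OF assms(1), of k] nr[OF assms(1), of k] by auto
      then show ?thesis using T[OF assms(2) _ assms(2), of 0] 0 by auto
    qed (use 0 in simp)
  next
    case (Suc j)
    show ?case
    proof (cases i)
      case 0
      then have "vs ! j \<in> {w \<in> V. w \<noteq> r \<and> p w = us ! 0}"
        using T[OF assms(2) _ assms(2), of j] Suc.prems legpath_in[OF assms(2), of j] nr[OF assms(2), of j] by auto
      then show ?thesis using T[OF assms(1) _ assms(1), of 0] s by auto
    next
      case (Suc k)
      then have "us ! k \<in> {w \<in> V. w \<noteq> r \<and> p w = vs ! Suc j}"
        using T[OF assms(1) _ assms(1), of k] Suc.prems legpath_in[OF assms(1), of k] nr[OF assms(1), of k] by auto
      then have "us ! k = vs ! j" using T[OF assms(2) _ assms(2), of "Suc j"] Suc.prems by auto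
      then show ?thesis using Suc.IH[of k] Suc.prems Suc by simp
    qed
  qed
qed

lemma Q_L_disjoint: "v \<in> QQ \<Longrightarrow> v \<notin> L"
  using legs_meet[of _ _ _ s] by (fastforce simp: Q_iff Legs_def)

lemma L_nb:
  assumes "y \<in> L" "w \<notin> L" "w \<in> nb G y"
  shows "\<exists>us. legpath s G us \<and> us ! s = w \<and> us ! (s - 1) = y"
proof -
  obtain us i where u: "legpath s G us" "i < s" "y = us ! i" using assms by (auto simp: Legs_def)
  then have "w = us ! (i - 1) \<or> w = us ! Suc i" using legpath_nb[OF G u(1,2)] assms by (auto split: if_splits)
  moreover have L: "us ! j \<in> L" if "j < s" for j using u(1) that by (auto simp: Legs_def)
  ultimately have w: "w = us ! Suc i" using assms(2) u(2) L[of "i - 1"] by auto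
  then have "\<not> Suc i < s" using assms(2) L[of "Suc i"] by auto
  then have "Suc i = s" using u by simp
  then show ?thesis using u w by (intro exI[of _ us]) auto
qed

lemma eig_leg:
  "f \<in> eigsp G x \<Longrightarrow> legpath s G us \<Longrightarrow> f (us ! s) = 0 \<Longrightarrow> i \<le> s \<Longrightarrow> f (us ! i) = 0"
  by (rule legpath_eig[OF G x s])

text \<open>The basic move. \<open>L_nb\<close> identifies \<open>w\<close> as the end of every leg
  that touches it, so these legs vanish with \<open>f w\<close>, and the equation of
  \<open>w\<close> leaves \<open>z\<close> as the only neighbour that might be nonzero.\<close>

lemma zrule:
  assumes f: "f \<in> eigsp G x" and w: "w \<in> V" "w \<notin> L" "f w = 0" and z: "z \<in> nb G w"
    and others: "\<And>y. y \<in> nb G w \<Longrightarrow> y \<noteq> z \<Longrightarrow> y \<notin> L \<Longrightarrow> f y = 0"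
  shows "f z = 0"
proof -
  have "f y = 0" if y: "y \<in> nb G w" "y \<noteq> z" for y
  proof (cases "y \<in> L")
    case True
    then obtain us where "legpath s G us" "us ! s = w" "us ! (s - 1) = y"
      using L_nb[of y w] w y nb_symm by blast
    then show ?thesis using eig_leg[OF f, of us "s - 1"] w by simp
  qed (use others y in simp)
  then have "(\<Sum>y\<in>nb G w. f y) = f z" using z fin_nb by (simp add: sum.remove)
  then show ?thesis using f w by (simp add: eigsp_def)
qed

lemma eig_zero:
  assumes f: "f \<in> eigsp G x" and 0: "\<And>v. v \<in> V \<Longrightarrow> v \<notin> L \<Longrightarrow> f v = 0"
  shows "f = (\<lambda>_. 0)"
proof
  fix v
  consider "v \<notin> V" | "v \<in> L" | "v \<in> V" "v \<notin> L" by blast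
  then show "f v = 0"
  proof cases
    case 2
    then obtain us i where u: "legpath s G us" "i < s" "v = us ! i" by (auto simp: Legs_def)
    have "us ! s \<in> QQ" using u Q_iff by blast
    then have "f (us ! s) = 0" using 0 Q_L_disjoint Q_sub by blast
    then show ?thesis using eig_leg[OF f u(1)] u by simp
  qed (use f 0 in \<open>auto simp: eigsp_def\<close>)
qed

end

section \<open>Graphs of maximal multiplicity\<close>

locale rooted_legged = legged +
  fixes r :: 'a and p :: "'a \<Rightarrow> 'a" and d :: "'a \<Rightarrow> nat"
  assumes t: "rtree G r p d" and rQ: "r \<in> QQ"
begin

abbreviation "N \<equiv> ntarcs G r p"
abbreviation "ds \<equiv> dsc G r p"

lemmas tp = rtree_p[OF G t]
lemmas t_dsc_in = dsc_in[OF G t]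
lemmas t_dsc_le = dsc_le[OF G t]
lemmas t_dsc_parent = dsc_parent[OF G t]
lemmas t_dsc_trans = dsc_trans[OF G t]
lemmas t_dsc_child = dsc_child[OF G t]
lemmas t_nb = nb_rtree[OF G t]
lemmas t_child_nb = child_nb[OF G t]
lemmas t_parent_nb = parent_nb[OF G t]
lemmas N_sym = ntarcs_sym[OF G, of _ _ r p]

lemma rV: "r \<in> V" using rtreeD(1)[OF t] .

lemma rL: "r \<notin> L" using Q_L_disjoint[OF rQ] .

lemma finite_N: "finite N" by (rule finite_subset[OF _ GD(2)]) (auto simp: ntarcs_def)

lemma N_V: "(a, y) \<in> N \<Longrightarrow> a \<in> V \<and> y \<in> V \<and> a \<noteq> y"
  using GD(4)[of a y] GD(5)[of a y] GD(6)[of a] by (auto simp: ntarcs_def)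

lemma d_parent: "v \<in> V \<Longrightarrow> v \<noteq> r \<Longrightarrow> d v = Suc (d (p v))"
  using tp by blast

lemma p_in: "v \<in> V \<Longrightarrow> v \<noteq> r \<Longrightarrow> p v \<in> V"
  using tp by blast

lemma leg_tree':
  assumes "legpath s G us" "i < s"
  shows "p (us ! i) = us ! Suc i" "{w \<in> V. w \<noteq> r \<and> p w = us ! i} = (if i = 0 then {} else {us ! (i - 1)})"
    "(us ! i, z) \<notin> N"
proof -
  have "us ! i \<noteq> r" if "i < s" for i using rL assms that by (auto simp: Legs_def)
  then show "p (us ! i) = us ! Suc i" "{w \<in> V. w \<noteq> r \<and> p w = us ! i} = (if i = 0 then {} else {us ! (i - 1)})"
    "(us ! i, z) \<notin> N"
    using leg_tree[OF t _ assms] by blast+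
qed

lemma N_L: "(a, y) \<in> N \<Longrightarrow> a \<notin> L \<and> y \<notin> L"
  using leg_tree'(3) N_sym[of a y] by (auto simp: Legs_def)

lemma child_L: "w \<in> V \<Longrightarrow> w \<noteq> r \<Longrightarrow> p w \<in> L \<Longrightarrow> w \<in> L"
proof -
  assume w: "w \<in> V" "w \<noteq> r" "p w \<in> L"
  then obtain us i where u: "legpath s G us" "i < s" "p w = us ! i" by (auto simp: Legs_def)
  then have "w \<in> (if i = 0 then {} else {us ! (i - 1)})" using leg_tree'(2)[OF u(1,2)] w by blast
  then have "i - 1 < s" "w = us ! (i - 1)" using u by (auto split: if_splits)
  then show ?thesis using u by (auto simp: Legs_def)
qed

lemma dsc_L: "z \<in> ds c \<Longrightarrow> c \<in> L \<Longrightarrow> z \<in> L"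
  by (induction rule: dsc.induct) (use child_L in auto)

lemma L_child_Q: "w \<in> V \<Longrightarrow> w \<noteq> r \<Longrightarrow> w \<in> L \<Longrightarrow> p w \<notin> L \<Longrightarrow> p w \<in> QQ"
  using L_nb[of w "p w"] t_parent_nb[of w] by (auto simp: Q_iff)

lemma r_notin_dsc: "w \<noteq> r \<Longrightarrow> r \<notin> ds w"
  using t_dsc_parent[of r w] by auto

text \<open>Induction from the deepest vertices upwards: in the equation of the vertex \<open>w\<close> all neighbours except the
  parent are known to vanish.\<close>

lemma zero_upward:
  assumes f: "f \<in> eigsp G x" and B: "B \<subseteq> V - L - {r}"
    and closed: "\<And>w v. w \<in> B \<Longrightarrow> v \<in> V \<Longrightarrow> v \<noteq> r \<Longrightarrow> v \<notin> L \<Longrightarrow> p v = w \<Longrightarrow> v \<in> B"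
    and ntz: "\<And>w z. w \<in> B \<Longrightarrow> (w, z) \<in> N \<Longrightarrow> f w = 0 \<and> f z = 0"
    and qz: "\<And>w. w \<in> B \<Longrightarrow> w \<in> QQ \<Longrightarrow> (\<And>v. v \<in> V \<Longrightarrow> v \<noteq> r \<Longrightarrow> p v = w \<Longrightarrow> v \<in> L) \<Longrightarrow>
        w \<notin> fst ` N \<Longrightarrow> f w = 0"
    and w: "w \<in> B"
  shows "f w = 0 \<and> f (p w) = 0"
  using w
proof (induction "card V - d w" arbitrary: w rule: less_induct)
  case less
  have wV: "w \<in> V" "w \<notin> L" "w \<noteq> r" using less.prems B by auto
  have ch: "f v = 0 \<and> f w = 0" if v: "v \<in> V" "v \<noteq> r" "v \<notin> L" "p v = w" for v
  proof -
    have "d v = Suc (d w)" using d_parent[OF v(1,2)] unfolding v(4) .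
    moreover have "d v < card V" using rtree_depth_less[OF G t v(1)] .
    ultimately have "card V - d v < card V - d w" by simp
    then show ?thesis using less.hyps[OF _ closed[OF less.prems v]] v(4) by simp
  qed
  have fw: "f w = 0"
  proof (cases "\<exists>v\<in>V. v \<noteq> r \<and> v \<notin> L \<and> p v = w")
    case False
    show ?thesis
    proof (cases "w \<in> fst ` N")
      case True
      then obtain z where "(w, z) \<in> N" by auto
      then show ?thesis using ntz less.prems by blast
    next
      case nN: False
      \<comment> \<open>Lying outside the legs, \<open>w\<close> is not a leaf. Without nonleg
        children and nontree arcs its further neighbour belongs to a leg, which puts
        \<open>w\<close> into \<open>Q\<close>.\<close>
      have "nb G w \<noteq> {p w}"
      proof
        assume "nb G w = {p w}"
        then have "card (nb G w) = 1" by simp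
        then show False using leaf_L wV by blast
      qed
      then obtain y where y: "y \<in> nb G w" "y \<noteq> p w" using t_parent_nb[OF wV(1,3)] by blast
      have "(w, y) \<notin> N" using nN by force
      then have yc: "y \<in> V" "y \<noteq> r" "p y = w" using y t_nb[OF wV(1)] by (auto split: if_splits)
      then have "y \<in> L" using False by blast
      then have "w \<in> QQ" using L_child_Q[OF yc(1,2)] yc wV by blast
      then show ?thesis using qz[OF less.prems _ _ nN] False by blast
    qed
  qed (use ch in blast)
  have "f (p w) = 0"
  proof (rule zrule[OF f wV(1,2) fw t_parent_nb[OF wV(1,3)]])
    fix y assume y: "y \<in> nb G w" "y \<noteq> p w" "y \<notin> L"
    then consider "y \<in> V" "y \<noteq> r" "p y = w" | "(w, y) \<in> N"
      using t_nb[OF wV(1)] by (auto split: if_splits)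
    then show "f y = 0"
      using ch y(3) ntz[OF less.prems] by cases blast+
  qed
  then show ?case using fw by blast
qed

text \<open>The test set behind the bound: ends of nontree arcs, and \<open>Q\<close> without the
  root. The root gets its value from the equation of a child outside the legs. A vertex of
  \<open>Q\<close> with a nonleg child gets its value from that child in the same way, which
  \<open>Q_leaf\<close> exploits.\<close>

lemma zero_everywhere:
  assumes f: "f \<in> eigsp G x" and v: "v \<in> V" "v \<notin> L" "v \<noteq> r"
    and ntz: "\<And>w. w \<in> fst ` N \<Longrightarrow> f w = 0"
    and qz: "\<And>w. w \<in> QQ \<Longrightarrow> w \<noteq> r \<Longrightarrow> (\<And>v. v \<in> V \<Longrightarrow> v \<noteq> r \<Longrightarrow> p v = w \<Longrightarrow> v \<in> L) \<Longrightarrow>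
        w \<notin> fst ` N \<Longrightarrow> f w = 0"
  shows "f = (\<lambda>_. 0)"
proof -
  have B: "f w = 0 \<and> f (p w) = 0" if w: "w \<in> V - L - {r}" for w
  proof (rule zero_upward[OF f _ _ _ _ w])
    show "f w = 0 \<and> f z = 0" if "(w, z) \<in> N" for w z
    proof -
      have "(z, w) \<in> N" using that N_sym by blast
      then show ?thesis using ntz that by force
    qed
    show "f w = 0" if "w \<in> V - L - {r}" "w \<in> QQ"
      "\<And>v. v \<in> V \<Longrightarrow> v \<noteq> r \<Longrightarrow> p v = w \<Longrightarrow> v \<in> L" "w \<notin> fst ` N" for w
      using qz[OF that(2) _ that(3,4)] that(1) by blast
  qed auto
  have "\<exists>w\<in>V - L - {r}. p w = r"
  proof -
    \<comment> \<open>A nonleg vertex of least depth, other than the root, hangs directly below the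
      root.\<close>
    obtain w where w: "w \<in> V - L - {r}" "\<And>w'. w' \<in> V - L - {r} \<Longrightarrow> d w \<le> d w'"
      using ex_has_least_nat[of "\<lambda>w. w \<in> V - L - {r}" v d] v by blast
    have "p w = r"
    proof (rule ccontr)
      assume "p w \<noteq> r"
      moreover have "p w \<in> V" using p_in w by blast
      moreover have "p w \<notin> L" using child_L[of w] w by blast
      ultimately have "d w \<le> d (p w)" using w(2) by blast
      then show False using d_parent[of w] w by auto
    qed
    then show ?thesis using w by blast
  qed
  then have "f r = 0" using B by metis
  then show ?thesis using eig_zero[OF f] B by blast
qed

end

locale extremal = rooted_legged +
  assumes eq: "2 * cyclomatic G + int (card QQ) - 1 \<le> int (graph_mult G x)"
    and nontriv: "\<exists>v\<in>V. v \<notin> L \<and> v \<noteq> r"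
begin

lemma eqN: "card N + card QQ \<le> Suc (graph_mult G x)"
  using eq card_ntarcs[OF G t] by linarith

lemma card_Q_r: "card (QQ - {r}) = card QQ - 1" "1 \<le> card QQ"
  using rQ finite_Q by (auto simp: card_gt_0_iff Suc_le_eq)

text \<open>The usual test set has at most \<open>card N + card QQ - 1\<close> elements. A test set
  with one element less contradicts equality; the structural facts below come from such
  savings.\<close>

lemma gain:
  assumes W: "finite W" "card W + 2 \<le> card N + card QQ"
    and f: "\<And>f. f \<in> eigsp G x \<Longrightarrow> (\<And>w. w \<in> W \<Longrightarrow> f w = 0) \<Longrightarrow> f = (\<lambda>_. 0)"
  shows False
proof -
  have "graph_mult G x \<le> card W" by (rule graph_mult_le_card[OF G W(1) f])
  then show False using W(2) eqN by linarith
qed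

lemma zero_outside:
  assumes f: "f \<in> eigsp G x"
    and ntz: "\<And>w. w \<in> fst ` N \<Longrightarrow> f w = 0"
    and qz: "\<And>w. w \<in> QQ \<Longrightarrow> w \<noteq> r \<Longrightarrow> f w = 0"
  shows "f = (\<lambda>_. 0)"
  using nontriv zero_everywhere[OF f _ _ _ ntz] qz by blast

lemma fin_fst: "finite (fst ` N)" "finite (fst ` N - S)" using finite_N by auto

text \<open>Two nontree arcs with a common tail would share a test vertex. Hence each vertex meets
  at most one nontree edge.\<close>

lemma inj_N: "inj_on fst N"
proof (rule ccontr)
  assume "\<not> ?thesis"
  then have lt: "card (fst ` N) < card N"
    using card_image_le[OF finite_N, of fst] inj_on_iff_eq_card[OF finite_N, of fst] by linarith
  show False
  proof (rule gain[of "fst ` N \<union> (QQ - {r})"])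
    show "card (fst ` N \<union> (QQ - {r})) + 2 \<le> card N + card QQ"
      using card_Un_le[of "fst ` N" "QQ - {r}"] card_Q_r lt by linarith
    show "f = (\<lambda>_. 0)" if "f \<in> eigsp G x" "\<And>w. w \<in> fst ` N \<union> (QQ - {r}) \<Longrightarrow> f w = 0" for f
      using zero_outside[OF that(1)] that(2) by blast
  qed (use fin_fst finite_Q in auto)
qed

lemma N_unique: "(a, y) \<in> N \<Longrightarrow> (a, z) \<in> N \<Longrightarrow> y = z"
  using inj_onD[OF inj_N, of "(a, y)" "(a, z)"] by simp

lemma card_fst: "card (fst ` N) = card N"
  by (rule card_image[OF inj_N])

lemma in_fst: "(a, y) \<in> N \<Longrightarrow> a \<in> fst ` N \<and> y \<in> fst ` N"
  using N_sym[of a y] by force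

text \<open>Otherwise \<open>w\<close> is already tested as an end of a nontree arc, or it vanishes
  because of a nonleg child; in both cases it can be left out of the part of the test set that comes
  from \<open>Q\<close>.\<close>

lemma Q_leaf:
  assumes w: "w \<in> QQ" "w \<noteq> r"
  shows "w \<notin> fst ` N" "v \<in> V \<Longrightarrow> v \<noteq> r \<Longrightarrow> p v = w \<Longrightarrow> v \<in> L"
proof -
  have "w \<notin> fst ` N \<and> (\<forall>v\<in>V. v \<noteq> r \<longrightarrow> p v = w \<longrightarrow> v \<in> L)"
  proof (rule ccontr)
    assume c: "\<not> ?thesis"
    show False
    proof (rule gain[of "fst ` N \<union> (QQ - {r} - {w})"])
      have "card (QQ - {r} - {w}) + 2 = card QQ"
        using w finite_Q card_Q_r card_Suc_Diff1[of "QQ - {r}" w] by simp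
      then show "card (fst ` N \<union> (QQ - {r} - {w})) + 2 \<le> card N + card QQ"
        using card_Un_le[of "fst ` N" "QQ - {r} - {w}"] card_fst by linarith
      show "f = (\<lambda>_. 0)" if f: "f \<in> eigsp G x" "\<And>w'. w' \<in> fst ` N \<union> (QQ - {r} - {w}) \<Longrightarrow> f w' = 0" for f
      proof -
        obtain v where v: "v \<in> V" "v \<notin> L" "v \<noteq> r" using nontriv by blast
        show ?thesis
        proof (rule zero_everywhere[OF f(1) v])
          show "f w' = 0" if "w' \<in> QQ" "w' \<noteq> r" "\<And>v. v \<in> V \<Longrightarrow> v \<noteq> r \<Longrightarrow> p v = w' \<Longrightarrow> v \<in> L"
            "w' \<notin> fst ` N" for w'
            using f(2)[of w'] that c by blast
        qed (use f(2) in blast)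
      qed
    qed (use fin_fst finite_Q in auto)
  qed
  then show "w \<notin> fst ` N" "v \<in> V \<Longrightarrow> v \<noteq> r \<Longrightarrow> p v = w \<Longrightarrow> v \<in> L" by blast+
qed

text \<open>If \<open>y\<close> is not below \<open>w\<close>, the nontree arcs that meet the
  subtree of \<open>w\<close> avoid \<open>a\<close>. Then the subtree vanishes without a test at
  \<open>a\<close>, the equation of \<open>w\<close> gives \<open>f a = 0\<close>, and the test at
  \<open>a\<close> is saved.\<close>

lemma child_sees:
  assumes N: "(a, y) \<in> N" and w: "w \<in> V" "w \<noteq> r" "w \<notin> L" "p w = a"
  shows "y \<in> ds w"
proof (rule ccontr)
  assume y: "y \<notin> ds w"
  show False
  proof (rule gain[of "(fst ` N - {a}) \<union> (QQ - {r})"])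
    have "card (fst ` N - {a}) + 1 = card N"
      using in_fst[OF N] fin_fst(1) card_fst card_Suc_Diff1[of "fst ` N" a] by simp
    then show "card (fst ` N - {a} \<union> (QQ - {r})) + 2 \<le> card N + card QQ"
      using card_Un_le[of "fst ` N - {a}" "QQ - {r}"] card_Q_r by linarith
    show "f = (\<lambda>_. 0)" if f: "f \<in> eigsp G x" "\<And>w. w \<in> fst ` N - {a} \<union> (QQ - {r}) \<Longrightarrow> f w = 0" for f
    proof -
      have aw: "a \<notin> ds w" using parent_notin_dsc[OF G t w(1,2)] w(4) by simp
      have "f w = 0 \<and> f (p w) = 0"
      proof (rule zero_upward[OF f(1), of "ds w - L"])
        show "ds w - L \<subseteq> V - L - {r}" using t_dsc_in r_notin_dsc[OF w(2)] by blast
        show "v \<in> ds w - L" if "w' \<in> ds w - L" "v \<in> V" "v \<noteq> r" "v \<notin> L" "p v = w'" for w' v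
          using that by (auto intro: dsc_step)
        show "f w' = 0 \<and> f z = 0" if w': "w' \<in> ds w - L" and z: "(w', z) \<in> N" for w' z
        proof -
          have "w' \<noteq> a" using aw w' by blast
          moreover have "z \<noteq> a"
          proof
            assume "z = a"
            then have "w' = y" using z N N_sym N_unique by blast
            then show False using y w' by blast
          qed
          ultimately show ?thesis using f(2) in_fst[OF z] by blast
        qed
        show "f w' = 0" if "w' \<in> ds w - L" "w' \<in> QQ" for w'
          using f(2)[of w'] that aw r_notin_dsc[OF w(2)] by blast
        show "w \<in> ds w - L" using w by (auto intro: dsc_base)
      qed
      then have fa: "f a = 0" using w by simp
      show ?thesis
      proof (rule zero_outside[OF f(1)])
        show "f w = 0" if "w \<in> fst ` N" for w using f(2)[of w] that fa by blast
      qed (use f(2) in blast)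
    qed
  qed (use fin_fst finite_Q in auto)
qed

lemma nt_notQ: "(a, y) \<in> N \<Longrightarrow> a \<noteq> r \<Longrightarrow> a \<notin> QQ"
  using Q_leaf(1)[of a] in_fst[of a y] by blast

text \<open>By \<open>child_sees\<close> a nonleg child of \<open>a\<close> would have
  \<open>y\<close> below it, and a child in a leg would put \<open>a\<close> into \<open>Q\<close>.
  In particular the lower end of a back arc is a leaf of the spanning tree.\<close>

lemma back_childless:
  assumes N: "(a, y) \<in> N" and a: "a \<noteq> r" and ny: "y \<notin> ds a"
    and c: "c \<in> V" "c \<noteq> r"
  shows "p c \<noteq> a"
proof
  assume pc: "p c = a"
  have "c \<notin> L"
    using L_child_Q[OF c] N_L[OF N] nt_notQ[OF N a] pc by blast
  then have "y \<in> ds c" using child_sees[OF N c _ pc] by blast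
  moreover have "c \<in> ds a" using c pc N_V[OF N] by (auto intro: dsc.intros)
  ultimately show False using ny t_dsc_trans by blast
qed

end

context legged
begin

text \<open>In a spanning tree of maximal total depth, an incomparable nontree arc would have childless ends, and
  moving one of them below the other would increase the total depth.\<close>

lemma normal_tree:
  assumes rQ: "r \<in> QQ"
    and eq: "2 * cyclomatic G + int (card QQ) - 1 \<le> int (graph_mult G x)"
    and nontriv: "\<exists>v\<in>V. v \<notin> L \<and> v \<noteq> r"
  shows "\<exists>p d. rtree G r p d \<and> (\<forall>(a, y)\<in>ntarcs G r p. a \<in> dsc G r p y \<or> y \<in> dsc G r p a)"
proof -
  define P where "P = (\<lambda>(p, d). rtree G r p d)"
  \<comment> \<open>The total depth. No depth reaches \<open>card V\<close>, so it is bounded and a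
    maximal tree exists.\<close>
  define F where "F = (\<lambda>(p :: 'a \<Rightarrow> 'a, d). \<Sum>v\<in>V. d v :: nat)"
  have rV: "r \<in> V" using rQ Q_sub by blast
  obtain p0 d0 where "rtree G r p0 d0" using rtree_exists[OF G c rV] by blast
  then have 1: "P (p0, d0)" by (simp add: P_def)
  have 2: "\<forall>y. P y \<longrightarrow> F y < Suc (card V * card V)"
  proof (intro allI impI)
    fix y assume "P y"
    then obtain p d where y: "y = (p, d)" "rtree G r p d" by (cases y) (auto simp: P_def)
    have "(\<Sum>v\<in>V. d v) \<le> of_nat (card V) * card V"
      by (rule sum_bounded_above) (use rtree_depth_less[OF G y(2)] in \<open>simp add: less_imp_le\<close>)
    then show "F y < Suc (card V * card V)" using y by (simp add: F_def)
  qed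
  obtain pd where pd: "P pd" "\<And>y. P y \<Longrightarrow> F y \<le> F pd"
    using ex_has_greatest_nat[of P, OF 1 2] by blast
  obtain p d where pd': "pd = (p, d)" by (cases pd)
  have t: "rtree G r p d" using pd(1) by (simp add: P_def pd')
  interpret extremal G s x r p d
    by unfold_locales (use t rQ eq nontriv in auto)
  have key: False if N: "(a, y) \<in> N" and ay: "a \<notin> ds y" "y \<notin> ds a" and le: "d a \<le> d y" for a y
  proof -
    have V: "a \<in> V" "y \<in> V" "a \<noteq> y" using N_V[OF N] by auto
    have ar: "a \<noteq> r" using ay dsc_root[OF G t V(2)] by blast
    have nc: "p c \<noteq> a" if "c \<in> V" "c \<noteq> r" for c using back_childless[OF N ar ay(2) that] .
    have "(a, y) \<in> parcs G" using N by (auto simp: ntarcs_def)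
    \<comment> \<open>Because \<open>a\<close> has no children, hanging it below \<open>y\<close>
      changes no other depth, and \<open>d a <= d y\<close> makes its own depth grow.\<close>
    then have "rtree G r (p(a := y)) (d(a := Suc (d y)))"
      using V ar nc tp rtreeD(2)[OF t] rV by (auto simp: rtree_def)
    then have "F (p(a := y), d(a := Suc (d y))) \<le> F pd" by (intro pd(2)) (simp add: P_def)
    moreover have "(\<Sum>v\<in>V. (d(a := Suc (d y))) v) = Suc (d y) + (\<Sum>v\<in>V - {a}. d v)"
      using V GD(1) by (simp add: sum.remove[of V a])
    moreover have "(\<Sum>v\<in>V. d v) = d a + (\<Sum>v\<in>V - {a}. d v)"
      using V GD(1) by (simp add: sum.remove[of V a])
    ultimately show False using le by (simp add: F_def pd')
  qed
  have "a \<in> ds y \<or> y \<in> ds a" if N: "(a, y) \<in> N" for a y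
    using key[OF N] key[of y a] N N_sym[of a y] le_cases[of "d a" "d y"] by blast
  then show ?thesis using t by (intro exI[of _ p] exI[of _ d]) auto
qed

end

text \<open>Take a vertex where some eigenvector is nonzero: a second nonzero eigenvector vanishing
  there would be independent of the first. Used to test a whole branch by one vertex.\<close>

lemma eigsp_unique_coordinate:
  assumes G: "pair_graph G" and m: "graph_mult G x \<le> 1" and V: "pverts G \<noteq> {}"
  shows "\<exists>u\<in>pverts G. \<forall>g\<in>eigsp G x. g u = 0 \<longrightarrow> g = (\<lambda>_. 0)"
proof (cases "\<forall>g\<in>eigsp G x. g = (\<lambda>_. 0)")
  case True
  then show ?thesis using V by blast
next
  case False
  then obtain g1 u where g1: "g1 \<in> eigsp G x" "g1 u \<noteq> 0" by (auto simp: fun_eq_iff)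
  have u: "u \<in> pverts G" using g1 by (auto simp: eigsp_def)
  have "g = (\<lambda>_. 0)" if g: "g \<in> eigsp G x" "g u = 0" for g
  proof (rule ccontr)
    assume "\<not> ?thesis"
    then obtain w where w: "g w \<noteq> 0" by (auto simp: fun_eq_iff)
    have "2 \<le> graph_mult G x"
    proof (rule graph_mult_ge[OF G, where b = "\<lambda>j. if j = 0 then g1 else g"])
      show "(if j = 0 then g1 else g) \<in> eigsp G x" if "j < 2" for j :: nat using g1 g by simp
      fix c :: "nat \<Rightarrow> complex" and j :: nat
      assume c: "\<And>v. (\<Sum>j<2. c j * (if j = 0 then g1 else g) v) = 0" and j: "j < 2"
      have e: "c 0 * g1 v + c 1 * g v = 0" for v using c[of v] by (simp add: numeral_2_eq_2)
      have "c 0 = 0" using e[of u] g g1 by simp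
      moreover have "c 1 = 0" using e[of w] w calculation by simp
      ultimately show "c j = 0" using j by (cases j) (auto simp: numeral_2_eq_2 less_Suc_eq)
    qed
    then show False using m by simp
  qed
  then show ?thesis using u by blast
qed

lemma pair_graph_induce:
  assumes "pair_graph G" "W \<subseteq> pverts G"
  shows "pair_graph (induce G W)"
  using pair_graph_simps(1,3,6)[OF assms(1)] assms(2) finite_subset[OF assms(2)]
  by (intro pair_graphI) (auto simp: induce_def sym_def)

lemma nb_induce: "v \<in> W \<Longrightarrow> nb (induce G W) v = nb G v \<inter> W"
  by (auto simp: nb_def induce_def)

lemma pverts_induce [simp]: "pverts (induce G W) = W"
  by (simp add: induce_def)

lemma eigsp_restrict:
  assumes G: "pair_graph G" and W: "W \<subseteq> pverts G" and f: "f \<in> eigsp G x"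
    and b: "\<And>v w. v \<in> W \<Longrightarrow> w \<in> nb G v \<Longrightarrow> w \<notin> W \<Longrightarrow> f w = 0"
  shows "(\<lambda>v. if v \<in> W then f v else 0) \<in> eigsp (induce G W) x"
  unfolding eigsp_def pverts_induce
proof (intro CollectI conjI ballI allI impI)
  fix v assume v: "v \<in> W"
  have "(\<Sum>w\<in>nb (induce G W) v. if w \<in> W then f w else 0) = (\<Sum>w\<in>nb G v \<inter> W. f w)"
    unfolding nb_induce[OF v] by (intro sum.cong) auto
  also have "\<dots> = (\<Sum>w\<in>nb G v. f w)"
    using b[OF v] finite_nb[OF G] by (intro sum.mono_neutral_left) auto
  also have "\<dots> = complex_of_real x * f v" using f W v by (auto simp: eigsp_def)
  finally show "(\<Sum>w\<in>nb (induce G W) v. if w \<in> W then f w else 0) = complex_of_real x * (if v \<in> W then f v else 0)"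
    using v by simp
qed simp

section \<open>The pendant cycle of a back arc\<close>

locale extremal_normal = extremal +
  assumes normal: "(a, y) \<in> N \<Longrightarrow> a \<in> ds y \<or> y \<in> ds a"
    and cq: "3 \<le> cyclomatic G + int (card QQ)"

text \<open>\<open>b\<close> is the lower and \<open>v\<close> the upper end of a nontree edge. The
  fundamental cycle runs through the ancestors \<open>P k\<close> of \<open>b\<close> up to
  \<open>v\<close>, and the stem of the pendant cycle continues upwards from there.\<close>

locale back_arc = extremal_normal +
  fixes b v
  assumes bv: "(b, v) \<in> N" and bdv: "b \<in> ds v"
begin

abbreviation "P k \<equiv> (p ^^ k) b"

lemma b_facts: "b \<in> V" "v \<in> V" "b \<noteq> v" "b \<notin> L" "v \<notin> L" "b \<noteq> r" "(v, b) \<in> N"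
  using N_V[OF bv] N_L[OF bv] t_dsc_parent[OF bdv] N_sym[of b v] bv by auto

lemma chain: "k \<le> d b \<Longrightarrow> P k \<in> V \<and> d (P k) + k = d b \<and> b \<in> ds (P k) \<and> P k \<notin> L"
proof (induction k)
  case 0
  then show ?case using b_facts by (auto intro: dsc_base)
next
  case (Suc k)
  then have IH: "P k \<in> V" "d (P k) + k = d b" "b \<in> ds (P k)" "P k \<notin> L" by auto
  have r: "P k \<noteq> r"
  proof
    assume "P k = r"
    then have "d (P k) = 0" using rtreeD(2)[OF t] by simp
    then show False using IH Suc.prems by linarith
  qed
  have P: "P (Suc k) = p (P k)" by simp
  have "P (Suc k) \<in> V" unfolding P using p_in[OF IH(1) r] .
  moreover have "d (P (Suc k)) + Suc k = d b" using d_parent[OF IH(1) r] IH(2) unfolding P by linarith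
  moreover have "P k \<in> ds (P (Suc k))" unfolding P using IH(1) r p_in[OF IH(1) r] by (auto intro: dsc.intros)
  then have "b \<in> ds (P (Suc k))" using IH(3) t_dsc_trans by blast
  moreover have "P (Suc k) \<notin> L" unfolding P using child_L[OF IH(1) r] IH(4) by blast
  ultimately show ?case by blast
qed

lemma P_r: "k < d b \<Longrightarrow> P k \<noteq> r"
proof
  assume k: "k < d b" "P k = r"
  then have "d (P k) = 0" using rtreeD(2)[OF t] by simp
  then show False using chain[of k] k by linarith
qed

lemma P_db: "P (d b) = r"
proof (rule ccontr)
  assume "P (d b) \<noteq> r"
  then have "d (P (d b)) = Suc (d (p (P (d b))))" using d_parent chain[of "d b"] by blast
  then show False using chain[of "d b"] by linarith
qed

lemma P_inj: "i \<le> d b \<Longrightarrow> j \<le> d b \<Longrightarrow> P i = P j \<Longrightarrow> i = j"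
  using chain[of i] chain[of j] by (metis add_left_cancel)

text \<open>Ancestors of \<open>b\<close> are comparable, so each is identified by its
  depth.\<close>

lemma on_chain:
  assumes "b \<in> ds w"
  shows "d w \<le> d b \<and> w = P (d b - d w)"
proof -
  have le: "d w \<le> d b" using t_dsc_le[OF assms] .
  let ?u = "P (d b - d w)"
  have u: "d ?u = d w" "b \<in> ds ?u" using chain[of "d b - d w"] le by auto
  have "w \<in> ds ?u \<or> ?u \<in> ds w" using dsc_comparable[OF G t assms u(2)] .
  then have "w = ?u" using dsc_eq[OF G t] u(1) by (metis order_refl)
  then show ?thesis using le by blast
qed

text \<open>The number of tree edges from \<open>b\<close> up to \<open>v\<close>; the cycle has
  \<open>n + 1\<close> vertices.\<close>

definition "n = d b - d v"

lemma n: "P n = v" "2 \<le> n" "n \<le> d b"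
proof -
  show Pn: "P n = v" using on_chain[OF bdv] by (simp add: n_def)
  show "n \<le> d b" by (simp add: n_def)
  have "n \<noteq> 0" using Pn b_facts by (metis funpow_0)
  moreover have "n \<noteq> 1"
  proof
    assume "n = 1"
    then have "p b = v" using Pn by simp
    then show False using bv b_facts by (simp add: ntarcs_iff)
  qed
  ultimately show "2 \<le> n" by linarith
qed

lemma b_childless: "w \<in> V \<Longrightarrow> w \<noteq> r \<Longrightarrow> p w \<noteq> b"
proof -
  have "v \<notin> ds b"
  proof
    assume "v \<in> ds b"
    then have "d b \<le> d v" by (rule t_dsc_le)
    then show False using dsc_eq[OF G t bdv] b_facts by blast
  qed
  then show "w \<in> V \<Longrightarrow> w \<noteq> r \<Longrightarrow> p w \<noteq> b" using back_childless[OF bv] b_facts by blast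
qed

text \<open>A subtree without \<open>b\<close> does not contain \<open>v\<close> either, and no
  nontree arc leads from it to \<open>b\<close> or \<open>v\<close>, since these two are each
  other's partners. So it vanishes without tests at \<open>b\<close> and \<open>v\<close>.\<close>

lemma off_chain:
  assumes f: "f \<in> eigsp G x" and f0: "\<And>w. w \<in> fst ` N \<Longrightarrow> w \<noteq> b \<Longrightarrow> w \<noteq> v \<Longrightarrow> f w = 0"
    and fQ: "\<And>w. w \<in> QQ \<Longrightarrow> w \<noteq> r \<Longrightarrow> f w = 0"
    and w: "w \<in> V" "w \<noteq> r" "w \<notin> L" "b \<notin> ds w"
  shows "f w = 0 \<and> f (p w) = 0"
proof (rule zero_upward[OF f, of "ds w - L"])
  have vw: "v \<notin> ds w" using w(4) t_dsc_trans[OF bdv] by blast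
  show "ds w - L \<subseteq> V - L - {r}" using t_dsc_in r_notin_dsc[OF w(2)] by blast
  show "v \<in> ds w - L" if "w' \<in> ds w - L" "v \<in> V" "v \<noteq> r" "v \<notin> L" "p v = w'" for w' v
    using that by (auto intro: dsc_step)
  show "f w' = 0 \<and> f z = 0" if w': "w' \<in> ds w - L" and z: "(w', z) \<in> N" for w' z
  proof -
    have ne: "w' \<noteq> b" "w' \<noteq> v" using w' w(4) vw by auto
    have "(z, w') \<in> N" using z N_sym by blast
    then have "z \<noteq> b" "z \<noteq> v" using N_unique bv b_facts(7) ne by blast+
    then show ?thesis using f0 ne in_fst[OF z] by blast
  qed
  show "f w' = 0" if "w' \<in> ds w - L" "w' \<in> QQ" for w'
    using fQ[of w'] that r_notin_dsc[OF w(2)] by blast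
  show "w \<in> ds w - L" using w by (auto intro: dsc_base)
qed

lemma card_gain: "card (insert u (fst ` N - {b, v}) \<union> (QQ - {r})) + 2 \<le> card N + card QQ"
proof -
  have "{b, v} \<subseteq> fst ` N" using in_fst[OF bv] by blast
  then have "card (fst ` N - {b, v}) = card N - 2" "2 \<le> card N"
    using card_Diff_subset[of "{b, v}" "fst ` N"] card_fst b_facts(3) card_mono[OF fin_fst(1), of "{b, v}"] by auto
  then have "card (insert u (fst ` N - {b, v})) + 1 \<le> card N"
    using card_insert_le_m1[of "card N - 1" "fst ` N - {b, v}" u] by linarith
  then show ?thesis
    using card_Un_le[of "insert u (fst ` N - {b, v})" "QQ - {r}"] card_Q_r by linarith
qed

text \<open>A single vertex \<open>u\<close> that replaces both \<open>b\<close> and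
  \<open>v\<close> in the test set saves a test. Whenever the cycle is not as claimed, such a
  \<open>u\<close> is found.\<close>

lemma gain_bv:
  assumes "\<And>f. f \<in> eigsp G x \<Longrightarrow> f u = 0 \<Longrightarrow> (\<And>w. w \<in> fst ` N \<Longrightarrow> w \<noteq> b \<Longrightarrow> w \<noteq> v \<Longrightarrow> f w = 0) \<Longrightarrow>
    (\<And>w. w \<in> QQ \<Longrightarrow> w \<noteq> r \<Longrightarrow> f w = 0) \<Longrightarrow> f b = 0 \<and> f v = 0"
  shows False
proof (rule gain[OF _ card_gain[of u]])
  fix f assume f: "f \<in> eigsp G x" "\<And>w. w \<in> insert u (fst ` N - {b, v}) \<union> (QQ - {r}) \<Longrightarrow> f w = 0"
  have bv0: "f b = 0 \<and> f v = 0" using assms[OF f(1)] f(2) by blast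
  show "f = (\<lambda>_. 0)"
  proof (rule zero_outside[OF f(1)])
    show "f w = 0" if "w \<in> fst ` N" for w
      using f(2)[of w] that bv0 by (cases "w = b \<or> w = v") auto
  qed (use f(2) in blast)
qed (use fin_fst finite_Q in auto)

text \<open>A further child of an inner vertex \<open>P k\<close> of the cycle would make
  \<open>f (P k)\<close> vanish without a test. A test at \<open>P (k - 1)\<close> then gives two
  consecutive zeros, which run down to \<open>b\<close> and through the back arc to
  \<open>v\<close>. At \<open>v\<close> itself, \<open>child_sees\<close> forbids a nonleg child
  without \<open>b\<close> below it.\<close>

lemma single:
  assumes k: "1 \<le> k" "k \<le> n" and w: "w \<in> V" "w \<noteq> r" "w \<notin> L" "p w = P k"
  shows "w = P (k - 1)"
proof (rule ccontr)
  assume ne: "w \<noteq> P (k - 1)"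
  have kd: "k \<le> d b" using k n(3) by linarith
  have bw: "b \<notin> ds w"
  proof
    assume "b \<in> ds w"
    then have 1: "d w \<le> d b" "w = P (d b - d w)" using on_chain by blast+
    have "d w = Suc (d (P k))" using d_parent[OF w(1,2)] unfolding w(4) .
    then have "d b - d w = k - 1" using chain[OF kd] by linarith
    then show False using 1 ne by simp
  qed
  show False
  proof (cases "k = n")
    case True
    then have "b \<in> ds w" using child_sees[OF b_facts(7) w(1-3)] w(4) n(1) by simp
    then show False using bw by blast
  next
    case False
    then have kn: "k < n" using k by simp
    show False
    proof (rule gain_bv[of "P (k - 1)"])
      fix f assume f: "f \<in> eigsp G x" "f (P (k - 1)) = 0"
        and f0: "\<And>w. w \<in> fst ` N \<Longrightarrow> w \<noteq> b \<Longrightarrow> w \<noteq> v \<Longrightarrow> f w = 0"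
        and fQ: "\<And>w. w \<in> QQ \<Longrightarrow> w \<noteq> r \<Longrightarrow> f w = 0"
      have off: "f w = 0 \<and> f (p w) = 0" if "w \<in> V" "w \<noteq> r" "w \<notin> L" "b \<notin> ds w" for w
        using off_chain[OF f(1) _ _ that] f0 fQ by blast
      have fk: "f (P k) = 0" using off[OF w(1-3) bw] w(4) by simp
      have down: "f (P (k - i)) = 0 \<and> f (P (k - i - 1)) = 0" if "i < k" for i
        using that
      proof (induction i)
        case (Suc i)
        define j where "j = k - Suc i"
        have j: "1 \<le> j" "j < k" "k - i = Suc j" using Suc.prems by (auto simp: j_def)
        then have IH: "f (P (Suc j)) = 0" "f (P j) = 0" using Suc by auto
        have jd: "j < d b" "j - 1 < d b" using j kd by auto
        have V: "P j \<in> V" "P j \<notin> L" "P j \<noteq> r" using chain[of j] P_r[of j] jd by auto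
        have V': "P (j - 1) \<in> V" "P (j - 1) \<noteq> r" using chain[of "j - 1"] P_r[of "j - 1"] jd by auto
        have pj: "p (P (j - 1)) = P j" using j(1) by (cases j) simp_all
        have neq: "P j \<noteq> b" "P j \<noteq> v"
          using P_inj[of j 0] P_inj[of j n] n j kn jd by auto
        have "f (P (j - 1)) = 0"
        proof (rule zrule[OF f(1) V(1,2) IH(2) t_child_nb[OF V' pj]])
          fix y assume y: "y \<in> nb G (P j)" "y \<noteq> P (j - 1)" "y \<notin> L"
          then consider "y = P (Suc j)" | "y \<in> V" "y \<noteq> r" "p y = P j" | "(P j, y) \<in> N"
            using t_nb[OF V(1)] V(3) by auto
          then show "f y = 0"
          proof cases
            case 2
            have "b \<notin> ds y"
            proof
              assume "b \<in> ds y"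
              then have 1: "d y \<le> d b" "y = P (d b - d y)" using on_chain by blast+
              have "d y = Suc (d (P j))" using d_parent[OF 2(1,2)] unfolding 2(3) .
              then have "d b - d y = j - 1" using chain[of j] jd by linarith
              then show False using 1 y(2) by simp
            qed
            then show ?thesis using off[OF 2(1,2) y(3)] by blast
          next
            case 3
            have "(y, P j) \<in> N" using 3 N_sym by blast
            then have "y \<noteq> b" "y \<noteq> v" using N_unique bv b_facts(7) neq by blast+
            then show ?thesis using f0 in_fst[OF 3] by blast
          qed (use IH in simp)
        qed
        then show ?case using IH j by (simp add: j_def)
      qed (use fk f(2) in simp)
      have "k - (k - 1) = 1" using k by simp
      then have f1: "f (P 1) = 0" "f b = 0" using down[of "k - 1"] k by auto
      have "f v = 0"
      proof (rule zrule[OF f(1) b_facts(1,4) f1(2)])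
        show "v \<in> nb G b" using bv by (simp add: ntarcs_iff)
        fix y assume y: "y \<in> nb G b" "y \<noteq> v" "y \<notin> L"
        then consider "y = p b" | "y \<in> V" "y \<noteq> r" "p y = b" | "(b, y) \<in> N"
          using t_nb[OF b_facts(1)] b_facts(6) by auto
        then show "f y = 0"
          using f1 b_childless N_unique[OF bv] y(2) by cases auto
      qed
      then show "f b = 0 \<and> f v = 0" using f1 by blast
    qed
  qed
qed

section \<open>From the cycle up to the vertex of attachment\<close>

abbreviation "sc k \<equiv> (\<forall>w\<in>V. w \<noteq> r \<longrightarrow> w \<notin> L \<longrightarrow> p w = P k \<longrightarrow> w = P (k - 1))"

lemma dsc_chain_P:
  assumes "\<And>j. 1 \<le> j \<Longrightarrow> j \<le> k \<Longrightarrow> sc j" "z \<in> ds (P k)" "z \<notin> L"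
  shows "\<exists>i\<le>k. z = P i"
  using assms
proof (induction k)
  case 0
  then show ?case using t_dsc_child[of z b] b_childless by auto
next
  case (Suc k)
  show ?case
  proof (cases "z = P (Suc k)")
    case False
    then obtain w where w: "w \<in> V" "w \<noteq> r" "p w = P (Suc k)" "z \<in> ds w"
      using t_dsc_child[OF Suc.prems(2)] by blast
    have "w \<notin> L" using dsc_L[OF w(4)] Suc.prems(3) by blast
    then have "w = P k" using Suc.prems(1)[of "Suc k"] w by auto
    then show ?thesis using Suc.IH[OF Suc.prems(1)] Suc.prems(3) w(4) by (meson le_SucI)
  qed auto
qed

lemma p_P: "p (P k) = P (Suc k)" by simp

text \<open>By \<open>normal\<close> the arc goes up or down. Upwards, \<open>P i\<close> would be a
  lower end with the child \<open>P (i - 1)\<close>, against \<open>back_childless\<close>.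
  Downwards, the other end lies on the chain and has no children, so it is \<open>b\<close>, whose
  partner is \<open>v\<close>.\<close>

lemma chain_N:
  assumes i: "1 \<le> i" "i \<le> d b" and sc: "\<And>j. 1 \<le> j \<Longrightarrow> j \<le> i \<Longrightarrow> sc j" and z: "(P i, z) \<in> N"
  shows "P i = v"
proof -
  have child: "P (j - 1) \<in> V" "P (j - 1) \<noteq> r" "p (P (j - 1)) = P j" if "1 \<le> j" "j \<le> i" for j
    using chain[of "j - 1"] P_r[of "j - 1"] that i p_P[of "j - 1"] by auto
  have ne: "P i \<noteq> z" using N_V[OF z] by blast
  have anti: "\<not> (u \<in> ds w \<and> w \<in> ds u)" if "u \<noteq> w" for u w
    using dsc_eq[OF G t, of u w] t_dsc_le[of w u] that by blast
  from normal[OF z] show ?thesis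
  proof
    assume a: "P i \<in> ds z"
    then have "P i \<noteq> r" using t_dsc_parent[OF a] ne by blast
    then show ?thesis using back_childless[OF z _ _ child(1,2)[of i]] child(3)[of i] anti[OF ne] a i by blast
  next
    assume a: "z \<in> ds (P i)"
    have zL: "z \<notin> L" using N_L[OF z] by blast
    obtain j where j: "j \<le> i" "z = P j" using dsc_chain_P[OF sc a zL] by blast
    have zN: "(z, P i) \<in> N" using z N_sym by blast
    have "z \<noteq> r" using t_dsc_parent[OF a] ne by blast
    then have "\<not> 1 \<le> j"
      using back_childless[OF zN _ _ child(1,2)[of j]] child(3)[of j] j anti[OF ne] a by blast
    then have "z = b" using j by (simp add: not_le)
    then show ?thesis using N_unique[OF bv] zN by blast
  qed
qed

text \<open>Above \<open>v\<close> the chain is followed until something else branches off. The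
  first vertex \<open>P t\<close> that is the root or has another nonleg child becomes the vertex of
  attachment; the branch consists of \<open>P 0\<close>, ..., \<open>P (t - 1)\<close>.\<close>

definition "stop j \<longleftrightarrow> n \<le> j \<and> (P j = r \<or> \<not> sc j)"
definition "t = (LEAST j. stop j)"

lemma t_facts: "stop t" "t \<le> d b" "\<And>j. n \<le> j \<Longrightarrow> j < t \<Longrightarrow> P j \<noteq> r \<and> sc j" "n \<le> t"
proof -
  have "stop (d b)" using P_db n by (simp add: stop_def)
  then show st: "stop t" "t \<le> d b" unfolding t_def using LeastI[of stop "d b"] Least_le[of stop "d b"] by auto
  show "n \<le> t" using st(1) by (simp add: stop_def)
  show "P j \<noteq> r \<and> sc j" if "n \<le> j" "j < t" for j
    using not_less_Least[of j stop] that by (auto simp: t_def stop_def)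
qed

lemma sc_t: "1 \<le> j \<Longrightarrow> j < t \<Longrightarrow> sc j"
  using single[of j] t_facts(3)[of j] by (cases "j \<le> n") auto

lemma P_notr: "j < t \<Longrightarrow> P j \<noteq> r"
  using P_r[of j] t_facts(2) by linarith

text \<open>By \<open>Q_leaf\<close> a vertex of \<open>Q\<close> other than the root has no nonleg
  child, but \<open>P j\<close> has the child \<open>P (j - 1)\<close>; and \<open>b\<close> is
  excluded as an end of a nontree arc.\<close>

lemma P_notQ:
  assumes "j < t"
  shows "P j \<notin> QQ"
proof (cases "j = 0")
  case True
  then show ?thesis using nt_notQ[OF bv] b_facts by simp
next
  case False
  have j1: "j - 1 < d b" using assms t_facts(2) by linarith
  have "P (j - 1) \<in> V" "P (j - 1) \<noteq> r" "P (j - 1) \<notin> L" using chain[of "j - 1"] P_r[OF j1] j1 by auto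
  moreover have "p (P (j - 1)) = P j" using False p_P[of "j - 1"] by simp
  ultimately show ?thesis using Q_leaf(2)[of "P j" "P (j - 1)"] P_notr[OF assms] by blast
qed

lemma chain_N_t: "j < t \<Longrightarrow> (P j, z) \<in> N \<Longrightarrow> j = 0 \<and> z = v \<or> j = n \<and> z = b"
proof -
  assume j: "j < t" and z: "(P j, z) \<in> N"
  show ?thesis
  proof (cases "j = 0")
    case True
    then show ?thesis using N_unique[OF bv] z by simp
  next
    case False
    then have "P j = v" using chain_N[of j z] z j t_facts(2) sc_t by simp
    then show ?thesis using P_inj[of j n] n j t_facts(2) N_unique[OF b_facts(7)] z by auto
  qed
qed

text \<open>If the root were reached without a branching, the graph apart from its legs would be the
  chain, with one nontree edge and no vertex of \<open>Q\<close> but the root, against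
  \<open>cq\<close>.\<close>

lemma other_child: "\<exists>w\<in>V. w \<noteq> r \<and> w \<notin> L \<and> p w = P t \<and> w \<noteq> P (t - 1)"
proof (rule ccontr)
  assume "\<not> ?thesis"
  then have sct: "sc t" by blast
  then have Pt: "P t = r" using t_facts(1) by (simp add: stop_def)
  have sc: "sc j" if "1 \<le> j" "j \<le> t" for j using sc_t[OF that(1)] sct that by (cases "j = t") auto
  have all: "\<exists>i\<le>t. z = P i" if z: "z \<in> V" "z \<notin> L" for z
    by (rule dsc_chain_P[OF sc _ z(2)]) (use dsc_root[OF G t z(1)] Pt in auto)
  have "(u, z) \<in> {(b, v), (v, b)}" if N: "(u, z) \<in> N" for u z
  proof -
    obtain i where i: "i \<le> t" "u = P i" using all[of u] N_V[OF N] N_L[OF N] by blast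
    show ?thesis
    proof (cases "i = 0")
      case True
      then show ?thesis using i N_unique[OF bv] N by auto
    next
      case False
      have td: "t \<le> d b" by (rule t_facts(2))
      have "P i = v" using chain_N[of i z] False i N td sc by auto
      then show ?thesis using i N_unique[OF b_facts(7)] N by auto
    qed
  qed
  then have sub: "N \<subseteq> {(b, v), (v, b)}" by (meson subrelI)
  have "card N \<le> card {(b, v), (v, b)}" by (rule card_mono[OF _ sub]) simp
  also have "\<dots> \<le> 2" using card_length[of "[(b, v), (v, b)]"] by simp
  finally have "cyclomatic G \<le> 1" using card_ntarcs[OF G rooted_legged_axioms[THEN rooted_legged.t]] by linarith
  moreover have "QQ \<subseteq> {r}"
  proof
    fix w assume w: "w \<in> QQ"
    then obtain i where i: "i \<le> t" "w = P i" using all[of w] Q_sub Q_L_disjoint by blast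
    then show "w \<in> {r}" using P_notQ[of i] w Pt by (cases "i = t") auto
  qed
  then have "card QQ \<le> 1" using card_mono[of "{r}" QQ] by simp
  ultimately show False using cq by linarith
qed

lemma n_less_t: "n < t"
proof (rule ccontr)
  assume "\<not> n < t"
  then have "t = n" using t_facts(4) by simp
  then show False using other_child single[of n] n by auto
qed

lemma nb_chain:
  assumes "i < t"
  shows "nb G (P i) = {P (Suc i)} \<union> (if i = 0 then {v} else {P (i - 1)}) \<union> (if i = n then {b} else {})"
proof -
  have it: "i < d b" using assms t_facts(2) by linarith
  have V: "P i \<in> V" "P i \<noteq> r" "P i \<notin> L" using chain[of i] P_r[OF it] it by auto
  have ch: "{w \<in> V. w \<noteq> r \<and> p w = P i} = (if i = 0 then {} else {P (i - 1)})"
  proof (cases "i = 0")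
    case True
    then show ?thesis using b_childless by auto
  next
    case False
    have i1: "i - 1 < d b" using it by linarith
    have "P (i - 1) \<in> V" "P (i - 1) \<noteq> r" using chain[of "i - 1"] P_r[OF i1] i1 by simp_all
    moreover have "p (P (i - 1)) = P i" using False by (cases i) simp_all
    moreover have "w = P (i - 1)" if w: "w \<in> V" "w \<noteq> r" "p w = P i" for w
    proof -
      have "p w \<notin> L" "p w \<notin> QQ" using w(3) V(3) P_notQ[OF assms] by simp_all
      then have "w \<notin> L" using L_child_Q[OF w(1,2)] by blast
      moreover have "1 \<le> i" using False by simp
      ultimately show ?thesis using sc_t[OF _ assms] w by blast
    qed
    ultimately have "{w \<in> V. w \<noteq> r \<and> p w = P i} = {P (i - 1)}" by blast
    then show ?thesis using False by simp
  qed
  have nt: "{z. (P i, z) \<in> N} = (if i = 0 then {v} else if i = n then {b} else {})"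
  proof (cases "i = 0")
    case True
    have "{z. (b, z) \<in> N} = {v}" using N_unique[OF bv] bv by blast
    then show ?thesis using True by simp
  next
    case False
    show ?thesis
    proof (cases "i = n")
      case True
      have "{z. (v, z) \<in> N} = {b}" using N_unique[OF b_facts(7)] b_facts(7) by blast
      then show ?thesis using True False n(1) by simp
    next
      case ni: False
      have "(P i, z) \<notin> N" for z using chain_N_t[OF assms, of z] False ni by blast
      then show ?thesis using False ni by simp
    qed
  qed
  have pp: "p (P i) = P (Suc i)" by simp
  show ?thesis
    unfolding t_nb[OF V(1)] ch nt pp using V(2) n(2) by (cases "i = 0"; cases "i = n") simp_all
qed

abbreviation "D \<equiv> (\<lambda>i. P i) ` {..<t}"

lemma D_sub: "D \<subseteq> V" "D \<inter> L = {}" "D \<inter> QQ = {}" "r \<notin> D" "P t \<notin> D"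
proof -
  have lt: "i < t \<Longrightarrow> i \<le> d b" for i using t_facts(2) by simp
  show "D \<subseteq> V" "D \<inter> L = {}" using chain lt by blast+
  show "D \<inter> QQ = {}" "r \<notin> D" using P_notQ P_notr by auto
  show "P t \<notin> D"
  proof
    assume "P t \<in> D"
    then obtain i where i: "i < t" "P t = P i" by blast
    then show False using P_inj[OF t_facts(2) lt[OF i(1)]] by simp
  qed
qed

lemma nb_D: "u \<in> D \<Longrightarrow> w \<in> nb G u \<Longrightarrow> w \<in> D \<or> (w = P t \<and> u = P (t - 1))"
proof -
  assume u: "u \<in> D" "w \<in> nb G u"
  then obtain i where i: "i < t" "u = P i" by auto
  have "b \<in> D" "v \<in> D" using n_less_t n(1) imageI[of 0 "{..<t}" P] imageI[of n "{..<t}" P] by auto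
  moreover have "P (i - 1) \<in> D" using i by auto
  moreover have "P (Suc i) \<in> D \<or> P (Suc i) = P t \<and> u = P (t - 1)"
  proof (cases "Suc i = t")
    case True
    then have "t - 1 = i" by linarith
    then show ?thesis using i True by simp
  next
    case False
    then have "Suc i < t" using i by simp
    then show ?thesis by blast
  qed
  moreover have "w = P (Suc i) \<or> w = v \<or> w = P (i - 1) \<or> w = b"
    using u(2) unfolding i(2) nb_chain[OF i(1)] by (cases "i = 0"; cases "i = n") auto
  ultimately show ?thesis by blast
qed

text \<open>The neighbours found are \<open>P (t - 1)\<close>, the other child, and the parent or,
  if \<open>P t\<close> is the root, the leg that ends there.\<close>

lemma card_nb_t: "2 \<le> card (nb G (P t) - D)" "3 \<le> card (nb G (P t))"
proof -
  obtain w where w: "w \<in> V" "w \<noteq> r" "w \<notin> L" "p w = P t" "w \<noteq> P (t - 1)" using other_child by blast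
  have td: "t \<le> d b" by (rule t_facts(2))
  have t1: "t - 1 < d b" using td n_less_t by linarith
  have wD: "w \<notin> D"
  proof
    assume "w \<in> D"
    then obtain i where i: "i < t" "w = P i" by auto
    then have "P (Suc i) = P t" using w(4) by simp
    then have "Suc i = t" using P_inj[of "Suc i" t] i td by auto
    then have "t - 1 = i" by linarith
    then show False using i w(5) by simp
  qed
  have wn: "w \<in> nb G (P t)" using t_child_nb[OF w(1,2,4)] .
  have "\<exists>y. y \<in> nb G (P t) \<and> y \<notin> D \<and> y \<noteq> w"
  proof (cases "P t = r")
    case True
    then obtain us where us: "legpath s G us" "us ! s = r" using rQ by (auto simp: Q_iff)
    have s1: "s - 1 < s" "Suc (s - 1) = s" using s by simp_all
    have y: "us ! (s - 1) \<in> L" unfolding Legs_def using us(1) s1(1) by blast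
    have "(us ! (s - 1), us ! Suc (s - 1)) \<in> parcs G" using us(1) s1(1) unfolding legpath_def by blast
    then have "us ! s \<in> nb G (us ! (s - 1))" using s1(2) by (simp add: nb_def)
    then have "us ! (s - 1) \<in> nb G (P t)" unfolding True us(2) by (rule nb_symm[THEN iffD1])
    then show ?thesis using y D_sub(2) w(3) by blast
  next
    case False
    have V: "P t \<in> V" using chain[OF td] by blast
    have pd: "d (P t) = Suc (d (p (P t)))" using d_parent[OF V False] .
    have "p (P t) \<notin> D"
    proof
      assume "p (P t) \<in> D"
      then obtain i where i: "i < t" "p (P t) = P i" by auto
      then have "d (p (P t)) + i = d b" using chain[of i] td by auto
      then show False using pd chain[OF td] i(1) by linarith
    qed
    moreover have "p (P t) \<noteq> w"
    proof
      assume "p (P t) = w"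
      then have "d (p (P t)) = d w" by simp
      moreover have "d w = Suc (d (P t))" using d_parent[OF w(1,2)] unfolding w(4) .
      ultimately show False using pd by linarith
    qed
    ultimately show ?thesis using t_parent_nb[OF V False] by blast
  qed
  then obtain y where y: "y \<in> nb G (P t)" "y \<notin> D" "y \<noteq> w" by blast
  have "card {w, y} \<le> card (nb G (P t) - D)"
    by (rule card_mono) (use y wn wD fin_nb in auto)
  then show 2: "2 \<le> card (nb G (P t) - D)" using y(3) by (simp add: eq_commute)
  have "P (t - 1) \<in> nb G (P t)"
    using t_child_nb[of "P (t - 1)" "P t"] chain[of "t - 1"] P_r[OF t1] p_P[of "t - 1"] t1 n_less_t by simp
  moreover have "P (t - 1) \<in> D" using n_less_t by auto
  ultimately have "card (nb G (P t) - D) < card (nb G (P t))"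
    using fin_nb by (intro psubset_card_mono) auto
  then show "3 \<le> card (nb G (P t))" using 2 by linarith
qed

text \<open>The other child at \<open>P t\<close> makes \<open>f\<close> vanish there, so
  \<open>f\<close> restricts to an eigenvector of the branch. Were the multiplicity at most 1, one
  vertex of the branch would determine this restriction and replace \<open>b\<close> and
  \<open>v\<close> in the test set.\<close>

lemma mult_D: "2 \<le> graph_mult (induce G D) x"
proof (rule ccontr)
  assume "\<not> ?thesis"
  then have m: "graph_mult (induce G D) x \<le> 1" by simp
  have "b \<in> D" "v \<in> D" using n_less_t n(1) imageI[of 0 "{..<t}" P] imageI[of n "{..<t}" P] by auto
  then obtain u where u: "u \<in> D" "\<And>g. g \<in> eigsp (induce G D) x \<Longrightarrow> g u = 0 \<Longrightarrow> g = (\<lambda>_. 0)"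
    using eigsp_unique_coordinate[OF pair_graph_induce[OF G D_sub(1)] m] by auto
  obtain w where w: "w \<in> V" "w \<noteq> r" "w \<notin> L" "p w = P t" "w \<noteq> P (t - 1)" using other_child by blast
  have bw: "b \<notin> ds w"
  proof
    assume "b \<in> ds w"
    then have 1: "d w \<le> d b" "w = P (d b - d w)" using on_chain by blast+
    have "d w = Suc (d (P t))" using d_parent[OF w(1,2)] unfolding w(4) .
    then have "d b - d w = t - 1" using chain[OF t_facts(2)] by linarith
    then show False using 1 w(5) by simp
  qed
  show False
  proof (rule gain_bv[of u])
    fix f assume f: "f \<in> eigsp G x" "f u = 0"
      and f0: "\<And>w. w \<in> fst ` N \<Longrightarrow> w \<noteq> b \<Longrightarrow> w \<noteq> v \<Longrightarrow> f w = 0"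
      and fQ: "\<And>w. w \<in> QQ \<Longrightarrow> w \<noteq> r \<Longrightarrow> f w = 0"
    have ft: "f (P t) = 0" using off_chain[OF f(1) _ _ w(1-3) bw] f0 fQ w(4) by simp
    have "(\<lambda>v. if v \<in> D then f v else 0) \<in> eigsp (induce G D) x"
      by (rule eigsp_restrict[OF G D_sub(1) f(1)]) (use nb_D ft in blast)
    then have "(\<lambda>v. if v \<in> D then f v else 0) = (\<lambda>_. 0)" using u f(2) by simp
    then have "(if w \<in> D then f w else 0) = 0" for w by (rule fun_cong)
    then have "f w = 0" if "w \<in> D" for w using that by presburger
    then show "f b = 0 \<and> f v = 0" using \<open>b \<in> D\<close> \<open>v \<in> D\<close> by blast
  qed
qed

end

section \<open>Graphs with attached branches\<close>

text \<open>An isomorphism given by its vertex map, which determines the map on arcs; it is what the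
  records in \<open>iso_via\<close> amount to.\<close>

definition giso :: "('a \<Rightarrow> 'b) \<Rightarrow> 'a pair_pre_digraph \<Rightarrow> 'b pair_pre_digraph \<Rightarrow> bool" where
  "giso \<phi> F H \<longleftrightarrow> inj_on \<phi> (pverts F) \<and> pverts H = \<phi> ` pverts F \<and>
     parcs F \<subseteq> pverts F \<times> pverts F \<and> parcs H = map_prod \<phi> \<phi> ` parcs F"

lemma iso_via_giso:
  assumes "iso_via f F H"
  shows "giso (iso_verts f) F H"
proof -
  have d: "pre_digraph.digraph_isomorphism (with_proj F) f" and a: "app_iso f (with_proj F) = with_proj H"
    using assms by (auto simp: iso_via_def)
  have tl: "iso_tail f = fst" and hd: "iso_head f = snd" and V: "iso_verts f ` pverts F = pverts H"
    and A: "iso_arcs f ` parcs F = parcs H"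
    using arg_cong[OF a, of tail] arg_cong[OF a, of head] arg_cong[OF a, of verts] arg_cong[OF a, of arcs]
    by simp_all
  have "iso_arcs f e = map_prod (iso_verts f) (iso_verts f) e" if "e \<in> parcs F" for e
    using d that by (auto simp: pre_digraph.digraph_isomorphism_def tl hd prod_eq_iff)
  then have "parcs H = map_prod (iso_verts f) (iso_verts f) ` parcs F"
    unfolding A[symmetric] by (intro image_cong) auto
  moreover have "parcs F \<subseteq> pverts F \<times> pverts F"
  proof -
    have "pair_wf_digraph F" using d by (simp add: pre_digraph.digraph_isomorphism_def wf_digraph_wp_iff)
    then show ?thesis by (auto dest: pair_wf_digraph.in_arcsD1 pair_wf_digraph.in_arcsD2)
  qed
  ultimately show ?thesis
    using d V by (simp add: giso_def pre_digraph.digraph_isomorphism_def)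
qed

lemma giso_iso_via:
  assumes "giso \<phi> F H"
  shows "\<exists>f. iso_via f F H \<and> iso_verts f = \<phi>"
proof -
  define f where "f = \<lparr>iso_verts = \<phi>, iso_arcs = map_prod \<phi> \<phi>, iso_head = snd, iso_tail = fst\<rparr>"
  have sub: "parcs F \<subseteq> pverts F \<times> pverts F" and inj: "inj_on \<phi> (pverts F)" using assms by (auto simp: giso_def)
  have "pair_wf_digraph F" using sub by unfold_locales auto
  moreover have "inj_on (map_prod \<phi> \<phi>) (parcs F)"
    using map_prod_inj_on[OF inj inj] sub by (rule inj_on_subset)
  ultimately have "pre_digraph.digraph_isomorphism (with_proj F) f"
    using inj by (simp add: pre_digraph.digraph_isomorphism_def wf_digraph_wp_iff f_def)
  moreover have "app_iso f (with_proj F) = with_proj H"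
    using assms by (simp add: app_iso_def f_def with_proj_def giso_def)
  ultimately show ?thesis by (intro exI[of _ f]) (simp add: iso_via_def f_def)
qed

lemma giso_arc:
  assumes "giso \<phi> F H" "u \<in> pverts F" "v \<in> pverts F"
  shows "(\<phi> u, \<phi> v) \<in> parcs H \<longleftrightarrow> (u, v) \<in> parcs F"
proof
  assume "(\<phi> u, \<phi> v) \<in> parcs H"
  then obtain a b where ab: "(a, b) \<in> parcs F" "\<phi> u = \<phi> a" "\<phi> v = \<phi> b" using assms(1) by (auto simp: giso_def)
  moreover have "a \<in> pverts F" "b \<in> pverts F" using ab(1) assms(1) by (auto simp: giso_def)
  ultimately show "(u, v) \<in> parcs F" using assms by (metis giso_def inj_onD)
next
  assume "(u, v) \<in> parcs F"
  then show "(\<phi> u, \<phi> v) \<in> parcs H" using assms(1) by (auto simp: giso_def)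
qed

lemma giso_nb:
  assumes "giso \<phi> F H" "v \<in> pverts F"
  shows "nb H (\<phi> v) = \<phi> ` nb F v"
proof
  show "\<phi> ` nb F v \<subseteq> nb H (\<phi> v)" using assms(1) by (auto simp: nb_def giso_def)
  show "nb H (\<phi> v) \<subseteq> \<phi> ` nb F v"
  proof
    fix w assume "w \<in> nb H (\<phi> v)"
    then obtain a b where ab: "(a, b) \<in> parcs F" "\<phi> v = \<phi> a" "w = \<phi> b" using assms(1) by (auto simp: nb_def giso_def)
    moreover have "a \<in> pverts F" using ab(1) assms(1) by (auto simp: giso_def)
    ultimately have "a = v" using assms by (metis giso_def inj_onD)
    then show "w \<in> \<phi> ` nb F v" using ab by (auto simp: nb_def)
  qed
qed

lemma giso_nb_sub: "giso \<phi> F H \<Longrightarrow> nb F v \<subseteq> pverts F"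
  by (auto simp: nb_def giso_def)

lemma giso_inv:
  assumes "giso \<phi> F H"
  shows "giso (inv_into (pverts F) \<phi>) H F"
proof -
  let ?\<psi> = "inv_into (pverts F) \<phi>"
  have inj: "inj_on \<phi> (pverts F)" and V: "pverts H = \<phi> ` pverts F" and sub: "parcs F \<subseteq> pverts F \<times> pverts F"
    and A: "parcs H = map_prod \<phi> \<phi> ` parcs F" using assms by (auto simp: giso_def)
  have "map_prod ?\<psi> ?\<psi> ` parcs H = (\<lambda>e. e) ` parcs F"
    unfolding A image_image using sub inj by (intro image_cong) (auto simp: inv_into_f_f)
  moreover have "?\<psi> ` pverts H = pverts F" unfolding V using inj by simp
  moreover have "inj_on ?\<psi> (pverts H)" unfolding V by (rule inj_on_inv_into) simp
  moreover have "parcs H \<subseteq> pverts H \<times> pverts H" unfolding A V using sub by auto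
  ultimately show ?thesis by (simp add: giso_def)
qed

lemma giso_pair_graph:
  assumes g: "giso \<phi> F H" and F: "pair_graph F"
  shows "pair_graph H"
proof (rule pair_graphI)
  note FD = pair_graph_simps[OF F]
  show "finite (pverts H)" using g FD(1) by (simp add: giso_def)
  show "sym (parcs H)" using g FD(3) by (auto simp: giso_def sym_def)
  show "parcs H \<subseteq> pverts H \<times> pverts H" using giso_inv[OF g] by (simp add: giso_def)
  show "(u, u) \<notin> parcs H" for u
  proof
    assume "(u, u) \<in> parcs H"
    then obtain a b where ab: "(a, b) \<in> parcs F" "u = \<phi> a" "u = \<phi> b" using g by (auto simp: giso_def)
    then have "a = b" using g FD(4,5)[OF ab(1)] by (metis giso_def inj_onD)
    then show False using ab FD(6) by simp
  qed
qed

lemma giso_eigsp: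
  assumes g: "giso \<phi> F H" and f: "f \<in> eigsp H x"
  shows "(\<lambda>v. if v \<in> pverts F then f (\<phi> v) else 0) \<in> eigsp F x"
  unfolding eigsp_def
proof (intro CollectI conjI ballI)
  fix v assume v: "v \<in> pverts F"
  have "(\<Sum>w\<in>nb F v. if w \<in> pverts F then f (\<phi> w) else 0) = (\<Sum>w\<in>nb F v. f (\<phi> w))"
    using giso_nb_sub[OF g, of v] by (intro sum.cong) auto
  also have "\<dots> = (\<Sum>w\<in>nb H (\<phi> v). f w)"
  proof -
    have "inj_on \<phi> (nb F v)" using g giso_nb_sub[OF g] by (meson giso_def inj_on_subset)
    then show ?thesis unfolding giso_nb[OF g v] by (simp add: sum.reindex)
  qed
  also have "\<dots> = complex_of_real x * f (\<phi> v)" using f v g by (auto simp: eigsp_def giso_def)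
  finally show "(\<Sum>w\<in>nb F v. if w \<in> pverts F then f (\<phi> w) else 0) =
    complex_of_real x * (if v \<in> pverts F then f (\<phi> v) else 0)" using v by simp
qed auto

lemma graph_mult_le_giso:
  assumes g: "giso \<phi> F H" and F: "pair_graph F"
  shows "graph_mult H x \<le> graph_mult F x"
proof -
  have H: "pair_graph H" by (rule giso_pair_graph[OF g F])
  obtain b a where b: "\<And>j. j < graph_mult H x \<Longrightarrow> b j \<in> eigsp H x"
    and ab: "\<And>i j. i < graph_mult H x \<Longrightarrow> j < graph_mult H x \<Longrightarrow>
      (\<Sum>v\<in>pverts H. a j v * b i v) = (if i = j then 1 else 0)"
    using eigsp_dual[OF H, of x] by blast
  let ?m = "graph_mult H x"
  show ?thesis
  proof (rule graph_mult_ge[OF F, where b = "\<lambda>j v. if v \<in> pverts F then b j (\<phi> v) else 0"])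
    show "(\<lambda>v. if v \<in> pverts F then b j (\<phi> v) else 0) \<in> eigsp F x" if "j < ?m" for j
      by (rule giso_eigsp[OF g b[OF that]])
    fix c j assume c: "\<And>v. (\<Sum>j<?m. c j * (if v \<in> pverts F then b j (\<phi> v) else 0)) = 0" and j: "j < ?m"
    have z: "(\<Sum>i<?m. c i * b i w) = 0" if wH: "w \<in> pverts H" for w
    proof -
      have "w \<in> \<phi> ` pverts F" using wH g by (simp add: giso_def)
      then obtain v where v: "v \<in> pverts F" "w = \<phi> v" by blast
      then show ?thesis using c[of v] by simp
    qed
    have "0 = (\<Sum>w\<in>pverts H. a j w * (\<Sum>i<?m. c i * b i w))" by (simp add: z)
    also have "\<dots> = (\<Sum>i<?m. c i * (\<Sum>w\<in>pverts H. a j w * b i w))"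
      using clin_sum[OF clin_wsum[where S = "pverts H"], where b = b and c = c and n = ?m] by simp
    also have "\<dots> = (\<Sum>i<?m. if i = j then c i else 0)" using ab j by (intro sum.cong) auto
    also have "\<dots> = c j" using j by simp
    finally show "c j = 0" by simp
  qed
qed

lemma graph_mult_giso:
  assumes g: "giso \<phi> F H" and F: "pair_graph F"
  shows "graph_mult H x = graph_mult F x"
  using graph_mult_le_giso[OF g F] graph_mult_le_giso[OF giso_inv[OF g] giso_pair_graph[OF g F]]
  by (rule antisym)

text \<open>Keeps of the pendant graphs only the attaching edges and nothing of their shape, so that
  pendant trees and pendant cycles can be treated alike.\<close>

definition att :: "'a pair_pre_digraph \<Rightarrow> nat \<Rightarrow> (nat \<Rightarrow> 'a set) \<Rightarrow> (nat \<Rightarrow> 'a) \<Rightarrow> (nat \<Rightarrow> 'a) \<Rightarrow> bool" where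
  "att G h D w e \<longleftrightarrow> pair_graph G \<and> disjoint_family_on D {..<h} \<and>
     (\<forall>i<h. D i \<subseteq> pverts G \<and> w i \<in> pverts G - (\<Union>j<h. D j) \<and> e i \<in> D i \<and>
       parcs G \<inter> (pverts G - D i) \<times> D i = {(w i, e i)})"

locale attached =
  fixes G :: "'a pair_pre_digraph" and h D w e
  assumes att: "att G h D w e"
begin

abbreviation "V \<equiv> pverts G"
abbreviation "R \<equiv> V - (\<Union>j<h. D j)"

lemma G: "pair_graph G" using att by (simp add: att_def)

lemmas GD = pair_graph_simps[OF G]
lemmas fin_nb = finite_nb[OF G]
lemmas nb_symm = nb_sym[OF G]

lemma D_V: "i < h \<Longrightarrow> D i \<subseteq> V" and w_R: "i < h \<Longrightarrow> w i \<in> R" and e_D: "i < h \<Longrightarrow> e i \<in> D i"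
  and cut: "i < h \<Longrightarrow> parcs G \<inter> (V - D i) \<times> D i = {(w i, e i)}"
  using att by (auto simp: att_def)

lemma D_disj: "i < h \<Longrightarrow> j < h \<Longrightarrow> v \<in> D i \<Longrightarrow> v \<in> D j \<Longrightarrow> i = j"
  using att by (auto simp: att_def disjoint_family_on_def)

lemma w_notD: "i < h \<Longrightarrow> j < h \<Longrightarrow> w i \<notin> D j"
  using w_R by auto

lemma e_inj: "i < h \<Longrightarrow> j < h \<Longrightarrow> e i = e j \<Longrightarrow> i = j"
  using D_disj[of i j "e i"] e_D[of i] e_D[of j] by simp

lemma enter: "i < h \<Longrightarrow> u \<in> D i \<Longrightarrow> v \<in> nb G u \<Longrightarrow> v \<notin> D i \<Longrightarrow> u = e i \<and> v = w i"
proof -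
  assume i: "i < h" "u \<in> D i" "v \<in> nb G u" "v \<notin> D i"
  then have "(v, u) \<in> parcs G" using nb_symm[of v u] by (simp add: nb_def)
  then have "(v, u) \<in> parcs G \<inter> (V - D i) \<times> D i" using i GD(4) by blast
  then show ?thesis unfolding cut[OF i(1)] by simp
qed

lemma we: "i < h \<Longrightarrow> w i \<in> nb G (e i) \<and> e i \<in> nb G (w i)"
  using cut[of i] nb_symm[of "w i" "e i"] by (auto simp: nb_def)

lemma nb_D: "i < h \<Longrightarrow> u \<in> D i \<Longrightarrow> nb G u = (nb G u \<inter> D i) \<union> (if u = e i then {w i} else {})"
  using enter[of i u] we[of i] by auto

lemma nb_R: "v \<in> R \<Longrightarrow> nb G v = (nb G v \<inter> R) \<union> e ` {i. i < h \<and> w i = v}"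
proof
  assume v: "v \<in> R"
  show "nb G v \<subseteq> (nb G v \<inter> R) \<union> e ` {i. i < h \<and> w i = v}"
  proof
    fix u assume u: "u \<in> nb G v"
    show "u \<in> (nb G v \<inter> R) \<union> e ` {i. i < h \<and> w i = v}"
    proof (cases "u \<in> R")
      case False
      then obtain i where i: "i < h" "u \<in> D i" using u GD(5) by (auto simp: nb_def)
      have "v \<in> nb G u" using u by (rule nb_symm[THEN iffD1])
      then have "u = e i \<and> v = w i" using enter[OF i] v i by blast
      then show ?thesis using i by blast
    qed (use u in blast)
  qed
  show "(nb G v \<inter> R) \<union> e ` {i. i < h \<and> w i = v} \<subseteq> nb G v" using we by blast
qed

lemma card_nb_R:
  assumes v: "v \<in> R"
  shows "card (nb G v) = card (nb G v \<inter> R) + card {i. i < h \<and> w i = v}"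
proof -
  have "card (nb G v) = card ((nb G v \<inter> R) \<union> e ` {i. i < h \<and> w i = v})" using nb_R[OF v] by simp
  also have "\<dots> = card (nb G v \<inter> R) + card (e ` {i. i < h \<and> w i = v})"
    using fin_nb e_D by (intro card_Un_disjoint) auto
  also have "card (e ` {i. i < h \<and> w i = v}) = card {i. i < h \<and> w i = v}"
    using e_inj by (intro card_image) (auto simp: inj_on_def)
  finally show ?thesis .
qed

lemma sum_nb_R:
  fixes f :: "'a \<Rightarrow> complex"
  assumes v: "v \<in> R"
  shows "(\<Sum>u\<in>nb G v. f u) = (\<Sum>u\<in>nb G v \<inter> R. f u) + (\<Sum>i | i < h \<and> w i = v. f (e i))"
proof -
  have "(\<Sum>u\<in>nb G v. f u) = (\<Sum>u\<in>(nb G v \<inter> R) \<union> e ` {i. i < h \<and> w i = v}. f u)" using nb_R[OF v] by simp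
  also have "\<dots> = (\<Sum>u\<in>nb G v \<inter> R. f u) + (\<Sum>u\<in>e ` {i. i < h \<and> w i = v}. f u)"
    using fin_nb e_D by (intro sum.union_disjoint) auto
  also have "(\<Sum>u\<in>e ` {i. i < h \<and> w i = v}. f u) = (\<Sum>i | i < h \<and> w i = v. f (e i))"
    using e_inj by (subst sum.reindex) (auto simp: inj_on_def)
  finally show ?thesis .
qed

lemma sum_nb_D:
  fixes f :: "'a \<Rightarrow> complex"
  assumes i: "i < h" and u: "u \<in> D i"
  shows "(\<Sum>v\<in>nb G u. f v) = (\<Sum>v\<in>nb G u \<inter> D i. f v) + (if u = e i then f (w i) else 0)"
proof -
  have "(\<Sum>v\<in>nb G u. f v) = (\<Sum>v\<in>(nb G u \<inter> D i) \<union> (if u = e i then {w i} else {}). f v)"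
    using nb_D[OF i u] by simp
  also have "\<dots> = (\<Sum>v\<in>nb G u \<inter> D i. f v) + (\<Sum>v\<in>(if u = e i then {w i} else {}). f v)"
    using fin_nb w_notD[OF i i] by (intro sum.union_disjoint) auto
  finally show ?thesis by simp
qed

text \<open>Pairing the eigenvector equation of \<open>f\<close> on the branch with an eigenvector \<open>g\<close> of the branch
  leaves the single boundary term \<open>g (e i) * f (w i)\<close>.\<close>

lemma attach_zero:
  assumes i: "i < h" and f: "f \<in> eigsp G x" and g: "g \<in> eigsp (induce G (D i)) x" "g (e i) \<noteq> 0"
  shows "f (w i) = 0"
proof -
  have fin: "finite (D i)" using D_V[OF i] GD(1) by (rule finite_subset)
  define B where "B = (\<lambda>u v. if v \<in> nb G u then 1 else 0 :: complex)"
  have B: "B u v = B v u" for u v using nb_symm[of u v] by (simp add: B_def)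
  have s: "(\<Sum>v\<in>nb G u \<inter> D i. F v) = (\<Sum>v\<in>D i. B u v * F v)" for u and F :: "'a \<Rightarrow> complex"
    using fin by (intro sum.mono_neutral_cong_left) (auto simp: B_def)
  have fe: "(\<Sum>v\<in>D i. B u v * f v) + (if u = e i then f (w i) else 0) = complex_of_real x * f u" if "u \<in> D i" for u
    using sum_nb_D[OF i that, of f] f D_V[OF i] that s[of f u] by (auto simp: eigsp_def)
  have ge: "(\<Sum>v\<in>D i. B u v * g v) = complex_of_real x * g u" if "u \<in> D i" for u
    using g(1) that s[of g u] by (simp add: eigsp_def nb_induce)
  have "(\<Sum>u\<in>D i. g u * (complex_of_real x * f u)) =
    (\<Sum>u\<in>D i. g u * ((\<Sum>v\<in>D i. B u v * f v) + (if u = e i then f (w i) else 0)))"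
    by (intro sum.cong) (auto simp: fe)
  also have "\<dots> = (\<Sum>u\<in>D i. g u * (\<Sum>v\<in>D i. B u v * f v)) + (\<Sum>u\<in>D i. g u * (if u = e i then f (w i) else 0))"
    by (simp add: distrib_left sum.distrib)
  also have "(\<Sum>u\<in>D i. g u * (if u = e i then f (w i) else 0)) = (\<Sum>u\<in>D i. if u = e i then g u * f (w i) else 0)"
    by (intro sum.cong) auto
  also have "\<dots> = g (e i) * f (w i)"
    using fin e_D[OF i] by simp
  also have "(\<Sum>u\<in>D i. g u * (\<Sum>v\<in>D i. B u v * f v)) = (\<Sum>u\<in>D i. \<Sum>v\<in>D i. (B v u * g u) * f v)"
    unfolding sum_distrib_left by (intro sum.cong refl) (subst B, simp add: mult_ac)
  also have "\<dots> = (\<Sum>v\<in>D i. (\<Sum>u\<in>D i. B v u * g u) * f v)"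
    by (subst sum.swap) (simp add: sum_distrib_right)
  also have "\<dots> = (\<Sum>v\<in>D i. g v * (complex_of_real x * f v))"
    by (intro sum.cong) (auto simp: ge)
  finally have "g (e i) * f (w i) = 0" by simp
  then show ?thesis using g(2) by simp
qed

text \<open>With zeros at the vertices of attachment the equations decouple: each branch satisfies
  its own, and the rest sees a branch only through the value \<open>f (e i)\<close>.\<close>

lemma eigsp_att:
  assumes w0: "\<And>i. i < h \<Longrightarrow> f (w i) = 0"
  shows "f \<in> eigsp G x \<longleftrightarrow> (\<forall>v. v \<notin> V \<longrightarrow> f v = 0) \<and>
    (\<forall>i<h. (\<lambda>v. if v \<in> D i then f v else 0) \<in> eigsp (induce G (D i)) x) \<and>
    (\<forall>v\<in>R. (\<Sum>u\<in>nb G v \<inter> R. f u) + (\<Sum>i | i < h \<and> w i = v. f (e i)) = complex_of_real x * f v)"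
    (is "_ \<longleftrightarrow> ?A \<and> ?B \<and> ?C")
proof -
  have D: "(\<lambda>v. if v \<in> D i then f v else 0) \<in> eigsp (induce G (D i)) x \<longleftrightarrow>
    (\<forall>u\<in>D i. (\<Sum>v\<in>nb G u. f v) = complex_of_real x * f u)" if i: "i < h" for i
  proof -
    have "(\<Sum>v\<in>nb (induce G (D i)) u. if v \<in> D i then f v else 0) = (\<Sum>v\<in>nb G u. f v)" if u: "u \<in> D i" for u
      unfolding nb_induce[OF u] sum_nb_D[OF i u] using w0[OF i] by (auto intro!: sum.cong)
    then show ?thesis by (simp add: eigsp_def)
  qed
  have split: "(\<forall>v\<in>V. E v) \<longleftrightarrow> (\<forall>i<h. \<forall>u\<in>D i. E u) \<and> (\<forall>v\<in>R. E v)" for E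
  proof -
    have "V = (\<Union>i<h. D i) \<union> R" using D_V by blast
    then have "(\<forall>v\<in>V. E v) \<longleftrightarrow> (\<forall>v\<in>(\<Union>i<h. D i) \<union> R. E v)" by simp
    then show ?thesis by (simp only: ball_Un ball_UN lessThan_iff Ball_def[of "{..<h}"])
  qed
  have "f \<in> eigsp G x \<longleftrightarrow> ?A \<and> (\<forall>i<h. \<forall>u\<in>D i. (\<Sum>v\<in>nb G u. f v) = complex_of_real x * f u) \<and>
    (\<forall>v\<in>R. (\<Sum>u\<in>nb G v. f u) = complex_of_real x * f v)"
    unfolding eigsp_def mem_Collect_eq split ..
  moreover have "?C \<longleftrightarrow> (\<forall>v\<in>R. (\<Sum>u\<in>nb G v. f u) = complex_of_real x * f v)"
    by (rule ball_cong[OF refl]) (simp only: sum_nb_R)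
  moreover have "?B \<longleftrightarrow> (\<forall>i<h. \<forall>u\<in>D i. (\<Sum>v\<in>nb G u. f v) = complex_of_real x * f u)"
    using D by blast
  ultimately show ?thesis by blast
qed

end

text \<open>Moves an eigenvector vanishing at the vertices of attachment to a graph with other branches, where it
  becomes a multiple of \<open>g i\<close> on the \<open>i\<close>-th branch.\<close>

definition transport :: "nat \<Rightarrow> (nat \<Rightarrow> 'b set) \<Rightarrow> 'b set \<Rightarrow> ('b \<Rightarrow> 'a) \<Rightarrow> (nat \<Rightarrow> 'a) \<Rightarrow> (nat \<Rightarrow> 'b \<Rightarrow> complex) \<Rightarrow>
    ('a \<Rightarrow> complex) \<Rightarrow> 'b \<Rightarrow> complex" where
  "transport h D R \<psi> e g f v = (if v \<in> R then f (\<psi> v) else \<Sum>i<h. if v \<in> D i then f (e i) * g i v else 0)"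

text \<open>Linearity of \<open>transport\<close> in the eigenvector, in the form in which it enters
  \<open>graph_mult_le\<close> as a test functional.\<close>

lemma clin_transport: "clin (\<lambda>f. \<Sum>v\<in>S. a v * transport h D R \<psi> e g f v)"
proof -
  have add: "transport h D R \<psi> e g (\<lambda>v. f v + f' v) u = transport h D R \<psi> e g f u + transport h D R \<psi> e g f' u" for f f' u
  proof (cases "u \<in> R")
    case False
    have "(\<Sum>i<h. if u \<in> D i then (f (e i) + f' (e i)) * g i u else 0) =
      (\<Sum>i<h. (if u \<in> D i then f (e i) * g i u else 0) + (if u \<in> D i then f' (e i) * g i u else 0))"
      by (rule sum.cong) (simp_all add: distrib_right)
    then show ?thesis using False by (simp add: transport_def sum.distrib)
  qed (simp add: transport_def)
  have scale: "transport h D R \<psi> e g (\<lambda>v. c * f v) u = c * transport h D R \<psi> e g f u" for c f u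
  proof (cases "u \<in> R")
    case False
    have "(\<Sum>i<h. if u \<in> D i then (c * f (e i)) * g i u else 0) =
      (\<Sum>i<h. c * (if u \<in> D i then f (e i) * g i u else 0))"
      by (rule sum.cong) simp_all
    then show ?thesis using False by (simp add: transport_def sum_distrib_left)
  qed (simp add: transport_def)
  have "(\<Sum>v\<in>S. a v * (c * F v)) = c * (\<Sum>v\<in>S. a v * F v)" for c F
    by (simp add: sum_distrib_left mult.left_commute)
  then show ?thesis
    unfolding clin_def add scale by (simp add: sum.distrib distrib_left)
qed

section \<open>Two graphs with the same rest and different branches\<close>

locale two_attached = T: attached T h S u a + G: attached G h D w e
  for T :: "'b pair_pre_digraph" and G :: "'a pair_pre_digraph" and h S u a D w e +
  fixes \<phi> :: "'b \<Rightarrow> 'a"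
  assumes iso: "giso \<phi> (induce T T.R) (induce G G.R)" and \<phi>u: "\<And>i. i < h \<Longrightarrow> \<phi> (u i) = w i"
begin

lemma \<phi>R: "v \<in> T.R \<Longrightarrow> \<phi> v \<in> G.R" and R_img: "G.R = \<phi> ` T.R" and inj: "inj_on \<phi> T.R"
  using iso by (auto simp: giso_def)

abbreviation "\<psi> \<equiv> inv_into T.R \<phi>"

text \<open>Makes every lemma of the locale available in the opposite direction.\<close>

lemma swap: "two_attached G T h D w e S u a \<psi>"
proof unfold_locales
  show "giso \<psi> (induce G G.R) (induce T T.R)" using giso_inv[OF iso] by simp
  show "\<psi> (w i) = u i" if "i < h" for i
    using \<phi>u[OF that] T.w_R[OF that] inj by (metis inv_into_f_f)
qed

lemma nb_\<phi>: "v \<in> T.R \<Longrightarrow> nb G (\<phi> v) \<inter> G.R = \<phi> ` (nb T v \<inter> T.R)"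
  using giso_nb[OF iso, of v] \<phi>R[of v] by (simp add: nb_induce)

lemma attach_iff: "v \<in> T.R \<Longrightarrow> {i. i < h \<and> w i = \<phi> v} = {i. i < h \<and> u i = v}"
proof -
  assume v: "v \<in> T.R"
  have "w i = \<phi> v \<longleftrightarrow> u i = v" if "i < h" for i
    using \<phi>u[OF that] inj_on_eq_iff[OF inj T.w_R[OF that] v] by simp
  then show ?thesis by blast
qed

lemma card_nb_\<phi>: "v \<in> T.R \<Longrightarrow> card (nb G (\<phi> v)) = card (nb T v)"
proof -
  assume v: "v \<in> T.R"
  have "card (\<phi> ` (nb T v \<inter> T.R)) = card (nb T v \<inter> T.R)"
    using inj_on_subset[OF inj, of "nb T v \<inter> T.R"] by (simp add: card_image)
  then show ?thesis
    using T.card_nb_R[OF v] G.card_nb_R[OF \<phi>R[OF v]] nb_\<phi>[OF v] attach_iff[OF v] by simp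
qed

lemma transport_D:
  assumes "i < h" "v \<in> D i"
  shows "transport h D G.R \<psi> a g f v = f (a i) * g i v"
proof -
  have nR: "v \<notin> G.R" using assms by blast
  have sm: "(\<Sum>j<h. if v \<in> D j then f (a j) * g j v else 0) = (\<Sum>j<h. if j = i then f (a j) * g j v else 0)"
  proof (rule sum.cong[OF refl])
    fix j assume "j \<in> {..<h}"
    then have "v \<in> D j \<longleftrightarrow> j = i" using assms G.D_disj[of j i v] by blast
    then show "(if v \<in> D j then f (a j) * g j v else 0) = (if j = i then f (a j) * g j v else 0)" by simp
  qed
  show ?thesis unfolding transport_def if_not_P[OF nR] sm using assms by simp
qed

lemma transport_R: "v \<in> T.R \<Longrightarrow> transport h D G.R \<psi> a g f (\<phi> v) = f v"
proof -
  assume v: "v \<in> T.R"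
  show ?thesis unfolding transport_def if_P[OF \<phi>R[OF v]] inv_into_f_f[OF inj v] ..
qed

text \<open>Since \<open>g i\<close> has the value 1 at \<open>e i\<close>, scaling it by
  \<open>f (a i)\<close> shows the vertex of attachment the same value as before, so the equations
  on the rest are preserved.\<close>

lemma transport_eigsp:
  assumes g: "\<And>i. i < h \<Longrightarrow> g i \<in> eigsp (induce G (D i)) x \<and> g i (e i) = 1"
    and f: "f \<in> eigsp T x" and f0: "\<And>i. i < h \<Longrightarrow> f (u i) = 0"
  shows "transport h D G.R \<psi> a g f \<in> eigsp G x"
proof -
  let ?f = "transport h D G.R \<psi> a g f"
  have w0: "?f (w i) = 0" if "i < h" for i
    using transport_R[of "u i" g f] T.w_R[OF that] \<phi>u[OF that] f0[OF that] by simp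
  have fT: "(\<forall>i<h. (\<lambda>v. if v \<in> S i then f v else 0) \<in> eigsp (induce T (S i)) x) \<and>
    (\<forall>v\<in>T.R. (\<Sum>u\<in>nb T v \<inter> T.R. f u) + (\<Sum>i | i < h \<and> u i = v. f (a i)) = complex_of_real x * f v)"
    using iffD1[OF T.eigsp_att f] f0 by blast
  show ?thesis
  proof (intro iffD2[OF G.eigsp_att] conjI allI impI ballI)
    show "?f (w i) = 0" if "i < h" for i by (rule w0[OF that])
    show "?f v = 0" if "v \<notin> G.V" for v
    proof -
      have "v \<notin> D i" if "i < h" for i using G.D_V[OF that] \<open>v \<notin> G.V\<close> by blast
      moreover have nR: "v \<notin> G.R" using that by blast
      ultimately show ?thesis unfolding transport_def if_not_P[OF nR] by simp
    qed
    show "(\<lambda>v. if v \<in> D i then ?f v else 0) \<in> eigsp (induce G (D i)) x" if i: "i < h" for i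
    proof -
      have "(\<lambda>v. if v \<in> D i then ?f v else 0) = (\<lambda>v. f (a i) * g i v + 0 * g i v)"
      proof
        fix v
        show "(if v \<in> D i then ?f v else 0) = f (a i) * g i v + 0 * g i v"
          using g[OF i] transport_D[OF i, of v g f] by (cases "v \<in> D i") (simp_all add: eigsp_def)
      qed
      then show ?thesis using eigsp_comb[of "g i" "induce G (D i)" x "g i" "f (a i)" 0] g[OF i] by simp
    qed
    fix v' assume "v' \<in> G.R"
    then obtain v where v: "v \<in> T.R" "v' = \<phi> v" unfolding R_img by blast
    have "(\<Sum>z\<in>nb G v' \<inter> G.R. ?f z) = (\<Sum>z\<in>nb T v \<inter> T.R. ?f (\<phi> z))"
      unfolding v(2) nb_\<phi>[OF v(1)] using inj_on_subset[OF inj, of "nb T v \<inter> T.R"] by (simp add: sum.reindex)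
    also have "\<dots> = (\<Sum>z\<in>nb T v \<inter> T.R. f z)" by (rule sum.cong[OF refl], rule transport_R) blast
    finally have 1: "(\<Sum>z\<in>nb G v' \<inter> G.R. ?f z) = (\<Sum>z\<in>nb T v \<inter> T.R. f z)" .
    have "(\<Sum>i | i < h \<and> w i = v'. ?f (e i)) = (\<Sum>i | i < h \<and> u i = v. f (a i))"
      unfolding v(2) attach_iff[OF v(1)]
    proof (rule sum.cong[OF refl])
      fix i assume "i \<in> {i. i < h \<and> u i = v}"
      then have i: "i < h" by blast
      show "?f (e i) = f (a i)" using transport_D[OF i G.e_D[OF i]] g[OF i] by simp
    qed
    then show "(\<Sum>z\<in>nb G v' \<inter> G.R. ?f z) + (\<Sum>i | i < h \<and> w i = v'. ?f (e i)) = complex_of_real x * ?f v'"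
      using 1 fT v transport_R[OF v(1)] by simp
  qed
qed

end

section \<open>Exchanging branches\<close>

text \<open>A simple eigenvalue of the branch whose eigenvectors do not vanish at the end
  \<open>e\<close>.\<close>

definition Ttype :: "'a pair_pre_digraph \<Rightarrow> 'a \<Rightarrow> real \<Rightarrow> bool" where
  "Ttype H e x \<longleftrightarrow> (\<exists>g\<in>eigsp H x. g e = 1) \<and> (\<forall>g\<in>eigsp H x. g e = 0 \<longrightarrow> g = (\<lambda>_. 0))"

text \<open>A double eigenvalue of the branch: one eigenvector is 1 at the end \<open>e\<close>, and
  those vanishing at \<open>e\<close> form a line with coordinate \<open>y\<close>. This line is
  what the branch has in excess of \<open>Ttype\<close>.\<close>

definition Ctype :: "'a pair_pre_digraph \<Rightarrow> 'a \<Rightarrow> real \<Rightarrow> bool" where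
  "Ctype H e x \<longleftrightarrow> (\<exists>g\<in>eigsp H x. g e = 1) \<and> (\<exists>z\<in>eigsp H x. z \<noteq> (\<lambda>_. 0) \<and> z e = 0) \<and>
     (\<exists>y. \<forall>z\<in>eigsp H x. z e = 0 \<longrightarrow> z y = 0 \<longrightarrow> z = (\<lambda>_. 0))"

lemma giso_eigsp':
  assumes g: "giso \<phi> F H" and F: "pair_graph F" and z: "z \<in> eigsp F x"
  shows "\<exists>z'\<in>eigsp H x. \<forall>v\<in>pverts F. z' (\<phi> v) = z v"
proof -
  let ?\<psi> = "inv_into (pverts F) \<phi>"
  define z' where "z' = (\<lambda>v. if v \<in> pverts H then z (?\<psi> v) else 0)"
  have "z' \<in> eigsp H x" unfolding z'_def by (rule giso_eigsp[OF giso_inv[OF g] z])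
  moreover have "z' (\<phi> v) = z v" if "v \<in> pverts F" for v
    using g that by (simp add: giso_def z'_def)
  ultimately show ?thesis by blast
qed

lemma giso_eigsp_zero:
  assumes g: "giso \<phi> F H" and z: "z \<in> eigsp H x" and 0: "\<And>v. v \<in> pverts F \<Longrightarrow> z (\<phi> v) = 0"
  shows "z = (\<lambda>_. 0)"
proof
  fix v
  show "z v = 0"
  proof (cases "v \<in> pverts H")
    case True
    then obtain u where "u \<in> pverts F" "v = \<phi> u" using g by (auto simp: giso_def)
    then show ?thesis using 0 by simp
  qed (use z in \<open>simp add: eigsp_def\<close>)
qed

lemma Ttype_giso:
  assumes g: "giso \<phi> F H" and F: "pair_graph F" and e: "e \<in> pverts F" and T: "Ttype F e x"
  shows "Ttype H (\<phi> e) x"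
  unfolding Ttype_def
proof (intro conjI ballI impI)
  obtain z where z: "z \<in> eigsp F x" "z e = 1" using T by (auto simp: Ttype_def)
  then show "\<exists>z\<in>eigsp H x. z (\<phi> e) = 1" using giso_eigsp'[OF g F z(1)] e by metis
  fix z assume z: "z \<in> eigsp H x" "z (\<phi> e) = 0"
  have "(\<lambda>v. if v \<in> pverts F then z (\<phi> v) else 0) = (\<lambda>_. 0)"
    using T giso_eigsp[OF g z(1)] z(2) e by (simp add: Ttype_def)
  then have "(if v \<in> pverts F then z (\<phi> v) else 0) = 0" for v by (rule fun_cong)
  then show "z = (\<lambda>_. 0)" using giso_eigsp_zero[OF g z(1)] by presburger
qed

lemma Ctype_giso:
  assumes g: "giso \<phi> F H" and F: "pair_graph F" and e: "e \<in> pverts F" and C: "Ctype F e x"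
  shows "Ctype H (\<phi> e) x"
  unfolding Ctype_def
proof (intro conjI)
  obtain z where z: "z \<in> eigsp F x" "z e = 1" using C by (auto simp: Ctype_def)
  then show "\<exists>z\<in>eigsp H x. z (\<phi> e) = 1" using giso_eigsp'[OF g F z(1)] e by metis
next
  obtain z where z: "z \<in> eigsp F x" "z \<noteq> (\<lambda>_. 0)" "z e = 0" using C by (auto simp: Ctype_def)
  then obtain v where v: "z v \<noteq> 0" by (auto simp: fun_eq_iff)
  then have vF: "v \<in> pverts F" using z(1) by (auto simp: eigsp_def)
  obtain z' where z': "z' \<in> eigsp H x" "\<forall>v\<in>pverts F. z' (\<phi> v) = z v" using giso_eigsp'[OF g F z(1)] by blast
  then have "z' (\<phi> v) \<noteq> 0" "z' (\<phi> e) = 0" using v vF z e by auto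
  then show "\<exists>z\<in>eigsp H x. z \<noteq> (\<lambda>_. 0) \<and> z (\<phi> e) = 0" using z'(1) by (intro bexI[of _ z']) auto
next
  obtain y where y: "\<forall>z\<in>eigsp F x. z e = 0 \<longrightarrow> z y = 0 \<longrightarrow> z = (\<lambda>_. 0)" using C by (auto simp: Ctype_def)
  have "z = (\<lambda>_. 0)" if z: "z \<in> eigsp H x" "z (\<phi> e) = 0" "z (\<phi> y) = 0" for z
  proof -
    have "(\<lambda>v. if v \<in> pverts F then z (\<phi> v) else 0) = (\<lambda>_. 0)"
      using y giso_eigsp[OF g z(1)] z(2,3) e by simp
    then have "(if v \<in> pverts F then z (\<phi> v) else 0) = 0" for v by (rule fun_cong)
    then show "z = (\<lambda>_. 0)" using giso_eigsp_zero[OF g z(1)] by presburger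
  qed
  then show "\<exists>y. \<forall>z\<in>eigsp H x. z (\<phi> e) = 0 \<longrightarrow> z y = 0 \<longrightarrow> z = (\<lambda>_. 0)" by blast
qed

lemma sum_lessThan_add:
  fixes F :: "nat \<Rightarrow> 'a :: comm_monoid_add"
  shows "(\<Sum>j<m + h. F j) = (\<Sum>j<m. F j) + (\<Sum>i<h. F (m + i))"
  by (induction h) (auto simp: add.assoc)

context attached
begin

lemma eigsp_branch:
  assumes f: "f \<in> eigsp G x" and f0: "\<And>i. i < h \<Longrightarrow> f (w i) = 0" and i: "i < h"
  shows "(\<lambda>v. if v \<in> D i then f v else 0) \<in> eigsp (induce G (D i)) x"
proof (rule eigsp_restrict[OF G D_V[OF i] f])
  fix v u assume "v \<in> D i" "u \<in> nb G v" "u \<notin> D i"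
  then have "u = w i" using enter[OF i] by blast
  then show "f u = 0" using f0[OF i] by simp
qed

text \<open>Outside the branch only the equation of \<open>w i\<close> sees it, through
  \<open>e i\<close>, where \<open>z\<close> vanishes.\<close>

lemma eigsp_extend:
  assumes i: "i < h" and z: "z \<in> eigsp (induce G (D i)) x" "z (e i) = 0"
  shows "z \<in> eigsp G x"
proof -
  have z0: "z v = 0" if "v \<notin> D i" for v using z(1) that by (simp add: eigsp_def)
  have ze: "z (e j) = 0" if "j < h" for j
    using z(2) z0[of "e j"] e_D[OF that] D_disj[OF i that, of "e j"] by (cases "j = i") auto
  show ?thesis
  proof (intro iffD2[OF eigsp_att] conjI allI impI ballI)
    show "z (w j) = 0" if "j < h" for j using z0 w_notD[OF that i] by blast
    show "z v = 0" if "v \<notin> V" for v using z0 D_V[OF i] that by blast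
    show "(\<lambda>v. if v \<in> D j then z v else 0) \<in> eigsp (induce G (D j)) x" if j: "j < h" for j
    proof (cases "j = i")
      case True
      have "(\<lambda>v. if v \<in> D i then z v else 0) = z" using z0 by auto
      then show ?thesis using z(1) True by simp
    next
      case False
      have "z v = 0" if "v \<in> D j" for v using z0 D_disj[OF i j _ that] False by blast
      then have "(\<lambda>v. if v \<in> D j then z v else 0) = (\<lambda>_. 0)" by auto
      then show ?thesis by (simp add: eigsp_def)
    qed
    fix v assume v: "v \<in> R"
    have "z u = 0" if "u \<in> R" for u using z0[of u] that i by blast
    then have "(\<Sum>u\<in>nb G v \<inter> R. z u) = 0" "z v = 0" using v by (auto intro: sum.neutral)
    moreover have "(\<Sum>j | j < h \<and> w j = v. z (e j)) = 0" using ze by (intro sum.neutral) blast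
    ultimately show "(\<Sum>u\<in>nb G v \<inter> R. z u) + (\<Sum>j | j < h \<and> w j = v. z (e j)) = complex_of_real x * z v" by simp
  qed
qed

text \<open>To enter a branch the leg would have to continue from some \<open>w i\<close>, whose
  degree is too large for that.\<close>

lemma leg_in_R:
  assumes big: "\<And>i. i < h \<Longrightarrow> 3 \<le> card (nb G (w i))" and l: "legpath s G us" and 0: "us ! 0 \<in> R" and j: "j \<le> s"
  shows "us ! j \<in> R"
  using j
proof (induction j)
  case (Suc j)
  then have IH: "us ! j \<in> R" "j < s" by auto
  have n: "us ! Suc j \<in> nb G (us ! j)" using l IH(2) by (auto simp: legpath_def nb_def)
  show ?case
  proof (rule ccontr)
    assume c: "us ! Suc j \<notin> R"
    then obtain i where i: "i < h" "us ! Suc j \<in> D i" using n GD(5) by (auto simp: nb_def)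
    have "us ! j \<in> nb G (us ! Suc j)" using n by (rule nb_symm[THEN iffD1])
    then have "us ! j = w i" using enter[OF i] IH(1) i(1) by blast
    moreover have "card (nb G (us ! j)) \<le> 2" using legpath_nb[OF G l IH(2)] by (simp add: card_insert_if)
    ultimately show False using big[OF i(1)] by simp
  qed
qed (use 0 in simp)

end

context two_attached
begin

lemma legpath_map:
  assumes l: "legpath s T us" and R: "\<And>j. j \<le> s \<Longrightarrow> us ! j \<in> T.R"
  shows "legpath s G (map \<phi> us)"
proof -
  have len: "length us = Suc s" and dis: "distinct us" and arc: "\<And>i. i < s \<Longrightarrow> (us ! i, us ! Suc i) \<in> parcs T"
    using l by (auto simp: legpath_def)
  have sub: "set us \<subseteq> T.R"
  proof
    fix y assume "y \<in> set us"
    then obtain j where "j < length us" "us ! j = y" unfolding in_set_conv_nth by blast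
    then show "y \<in> T.R" using R[of j] len by simp
  qed
  have nth: "map \<phi> us ! j = \<phi> (us ! j)" if "j \<le> s" for j using that len by simp
  show ?thesis
    unfolding legpath_def
  proof (intro conjI allI impI)
    show "length (map \<phi> us) = Suc s" using len by simp
    show "distinct (map \<phi> us)" using dis inj_on_subset[OF inj sub] by (simp add: distinct_map)
    show "set (map \<phi> us) \<subseteq> pverts G" using sub \<phi>R by auto
    show "(map \<phi> us ! i, map \<phi> us ! Suc i) \<in> parcs G" if i: "i < s" for i
    proof -
      have Ri: "us ! i \<in> T.R" "us ! Suc i \<in> T.R" using R[of i] R[of "Suc i"] i by simp_all
      then have "(us ! i, us ! Suc i) \<in> parcs (induce T T.R)" using arc[OF i] by (simp add: induce_def)
      then have "(\<phi> (us ! i), \<phi> (us ! Suc i)) \<in> parcs (induce G G.R)"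
        using giso_arc[OF iso, of "us ! i" "us ! Suc i"] Ri by simp
      then show ?thesis using nth[of i] nth[of "Suc i"] i by (simp add: induce_def)
    qed
    show "card (nb G (map \<phi> us ! 0)) = 1" using nth[of 0] card_nb_\<phi>[OF R[of 0]] l by (simp add: legpath_def)
    show "card (nb G (map \<phi> us ! i)) = 2" if i: "1 \<le> i" "i < s" for i
      using nth[of i] card_nb_\<phi>[OF R[of i]] i l by (simp add: legpath_def)
  qed
qed

text \<open>Eigenvectors of both graphs vanish at the vertices of attachment, by
  \<open>attach_zero\<close> with the normalized eigenvectors of the branches. Transport matches the
  two eigenspaces up to the eigenvectors of \<open>G\<close> that are supported on one branch and
  vanish at its end: one dimension for each branch.\<close>

lemma mult_transfer:
  assumes TT: "\<And>i. i < h \<Longrightarrow> Ttype (induce T (S i)) (a i) x"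
    and CC: "\<And>i. i < h \<Longrightarrow> Ctype (induce G (D i)) (e i) x"
  shows "graph_mult G x = graph_mult T x + h"
proof -
  let ?m = "graph_mult T x"
  have "\<forall>i. \<exists>g. i < h \<longrightarrow> g \<in> eigsp (induce T (S i)) x \<and> g (a i) = 1" using TT by (auto simp: Ttype_def)
  then obtain gT where gT: "\<And>i. i < h \<Longrightarrow> gT i \<in> eigsp (induce T (S i)) x \<and> gT i (a i) = 1" by metis
  have "\<forall>i. \<exists>g. i < h \<longrightarrow> g \<in> eigsp (induce G (D i)) x \<and> g (e i) = 1" using CC by (auto simp: Ctype_def)
  then obtain gG where gG: "\<And>i. i < h \<Longrightarrow> gG i \<in> eigsp (induce G (D i)) x \<and> gG i (e i) = 1" by metis
  have "\<forall>i. \<exists>z. i < h \<longrightarrow> z \<in> eigsp (induce G (D i)) x \<and> z \<noteq> (\<lambda>_. 0) \<and> z (e i) = 0" using CC unfolding Ctype_def by blast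
  then obtain z where z: "\<And>i. i < h \<Longrightarrow> z i \<in> eigsp (induce G (D i)) x \<and> z i \<noteq> (\<lambda>_. 0) \<and> z i (e i) = 0" by metis
  have "\<forall>i. \<exists>y. i < h \<longrightarrow> (\<forall>z\<in>eigsp (induce G (D i)) x. z (e i) = 0 \<longrightarrow> z y = 0 \<longrightarrow> z = (\<lambda>_. 0))"
    using CC unfolding Ctype_def by blast
  then obtain y where y: "\<And>i z. i < h \<Longrightarrow> z \<in> eigsp (induce G (D i)) x \<Longrightarrow> z (e i) = 0 \<Longrightarrow> z (y i) = 0 \<Longrightarrow> z = (\<lambda>_. 0)" by metis
  have T0: "f (u i) = 0" if "f \<in> eigsp T x" "i < h" for f i
    using T.attach_zero[OF that(2,1), of "gT i"] gT[OF that(2)] by simp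
  have G0: "f (w i) = 0" if "f \<in> eigsp G x" "i < h" for f i
    using G.attach_zero[OF that(2,1), of "gG i"] gG[OF that(2)] by simp
  obtain b A where b: "\<And>j. j < ?m \<Longrightarrow> b j \<in> eigsp T x"
    and Ab: "\<And>i j. i < ?m \<Longrightarrow> j < ?m \<Longrightarrow> (\<Sum>v\<in>pverts T. A j v * b i v) = (if i = j then 1 else 0)"
    and A: "\<And>f. f \<in> eigsp T x \<Longrightarrow> (\<forall>j<?m. (\<Sum>v\<in>pverts T. A j v * f v) = 0) \<Longrightarrow> f = (\<lambda>_. 0)"
    using eigsp_dual[OF T.G, of x] by blast
  interpret sw: two_attached G T h D w e S u a \<psi> by (rule swap)
  define dn where "dn = transport h S T.R sw.\<psi> e gT"
  define up where "up = transport h D G.R \<psi> a gG"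
  have dn_E: "dn f \<in> eigsp T x" if "f \<in> eigsp G x" for f
    unfolding dn_def by (rule sw.transport_eigsp[OF gT that G0[OF that]])
  have up_E: "up f \<in> eigsp G x" if "f \<in> eigsp T x" for f
    unfolding up_def by (rule transport_eigsp[OF gG that T0[OF that]])
  \<comment> \<open>The tests are the dual functionals of \<open>T\<close> after transport and, for
    each branch, the coordinate \<open>y i\<close> of its additional eigenvector.\<close>
  have "graph_mult G x \<le> ?m + h"
  proof (rule graph_mult_le[OF G.G, where \<phi> = "\<lambda>j f. if j < ?m then \<Sum>v\<in>pverts T. A j v * dn f v else f (y (j - ?m))"])
    show "clin (\<lambda>f. if j < ?m then \<Sum>v\<in>pverts T. A j v * dn f v else f (y (j - ?m)))" for j
      unfolding dn_def by (cases "j < ?m") (simp_all only: if_True if_False clin_transport clin_eval)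
    fix f assume f: "f \<in> eigsp G x"
      and 0: "\<And>j. j < ?m + h \<Longrightarrow> (if j < ?m then \<Sum>v\<in>pverts T. A j v * dn f v else f (y (j - ?m))) = 0"
    have "(\<Sum>v\<in>pverts T. A j v * dn f v) = 0" if "j < ?m" for j using 0[of j] that by simp
    then have d0: "dn f = (\<lambda>_. 0)" using A[OF dn_E[OF f]] by blast
    have fR: "f v = 0" if "v \<in> G.R" for v
      using sw.transport_R[OF that, of gT f] fun_cong[OF d0, of "\<psi> v"] by (simp add: dn_def)
    have fe: "f (e i) = 0" if i: "i < h" for i
      using sw.transport_D[OF i T.e_D[OF i], of gT f] fun_cong[OF d0, of "a i"] gT[OF i] by (simp add: dn_def)
    have fD: "f v = 0" if i: "i < h" "v \<in> D i" for i v
    proof -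
      have ev: "(\<lambda>v. if v \<in> D i then f v else 0) \<in> eigsp (induce G (D i)) x"
        by (rule G.eigsp_branch[OF f G0[OF f] i(1)])
      have "f (y i) = 0" using 0[of "?m + i"] i by simp
      then have "(\<lambda>v. if v \<in> D i then f v else 0) = (\<lambda>_. 0)"
        using y[OF i(1) ev] fe[OF i(1)] by simp
      then have "(if v \<in> D i then f v else 0) = 0" by (rule fun_cong)
      then show ?thesis using i by simp
    qed
    show "f = (\<lambda>_. 0)"
    proof
      fix v
      consider "v \<notin> G.V" | "v \<in> G.R" | i where "i < h" "v \<in> D i" by blast
      then show "f v = 0" using fR fD f by cases (auto simp: eigsp_def)
    qed
  qed
  \<comment> \<open>The basis of \<open>T\<close> is transported, and each branch adds its
    eigenvector \<open>z i\<close>, extended by zero. For independence, the combination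
    \<open>F\<close> of the basis is shown to vanish first; then the \<open>z i\<close> are
    separated by their supports.\<close>
  moreover have "?m + h \<le> graph_mult G x"
  proof (rule graph_mult_ge[OF G.G, where b = "\<lambda>j. if j < ?m then up (b j) else z (j - ?m)"])
    show "(if j < ?m then up (b j) else z (j - ?m)) \<in> eigsp G x" if j: "j < ?m + h" for j
    proof (cases "j < ?m")
      case False
      then have "j - ?m < h" using j by simp
      then show ?thesis using G.eigsp_extend z False by simp
    qed (use up_E b in simp)
    fix c j assume c0: "\<And>v. (\<Sum>j<?m + h. c j * (if j < ?m then up (b j) else z (j - ?m)) v) = 0" and j: "j < ?m + h"
    have c: "(\<Sum>j<?m. c j * up (b j) v) + (\<Sum>i<h. c (?m + i) * z i v) = 0" for v
      using c0[of v] unfolding sum_lessThan_add by simp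
    have zz: "z i v = 0" if "i < h" "v \<notin> D i" for i v using z[OF that(1)] that(2) by (simp add: eigsp_def)
    define F where "F = (\<lambda>v. \<Sum>j<?m. c j * b j v)"
    have FE: "F \<in> eigsp T x" unfolding F_def by (rule eigsp_sum[OF b])
    have FR: "F v = 0" if v: "v \<in> T.R" for v
    proof -
      have "(\<Sum>i<h. c (?m + i) * z i (\<phi> v)) = 0"
        using \<phi>R[OF v] zz by (intro sum.neutral) auto
      moreover have "(\<Sum>j<?m. c j * up (b j) (\<phi> v)) = F v"
        unfolding F_def up_def transport_R[OF v] ..
      ultimately show ?thesis using c[of "\<phi> v"] by simp
    qed
    have Fa: "F (a i) = 0" if i: "i < h" for i
    proof -
      have "z k (e i) = 0" if "k < h" for k
        using z[OF i] zz[OF that, of "e i"] G.D_disj[OF i that G.e_D[OF i]] by (cases "k = i") auto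
      then have "(\<Sum>k<h. c (?m + k) * z k (e i)) = 0" by simp
      moreover have "(\<Sum>j<?m. c j * up (b j) (e i)) = F (a i)"
        unfolding F_def up_def transport_D[OF i G.e_D[OF i]] using gG[OF i] by simp
      ultimately show ?thesis using c[of "e i"] by simp
    qed
    have FD: "F v = 0" if i: "i < h" "v \<in> S i" for i v
    proof -
      have "(\<lambda>v. if v \<in> S i then F v else 0) \<in> eigsp (induce T (S i)) x"
        by (rule T.eigsp_branch[OF FE T0[OF FE] i(1)])
      then have "(\<lambda>v. if v \<in> S i then F v else 0) = (\<lambda>_. 0)"
        using TT[OF i(1)] Fa[OF i(1)] by (simp add: Ttype_def)
      then have "(if v \<in> S i then F v else 0) = 0" by (rule fun_cong)
      then show ?thesis using i by simp
    qed
    have F0: "F v = 0" for v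
    proof -
      consider "v \<notin> T.V" | "v \<in> T.R" | i where "i < h" "v \<in> S i" by blast
      then show "F v = 0" using FR FD FE by cases (auto simp: eigsp_def)
    qed
    have cb: "c k = 0" if k: "k < ?m" for k
    proof -
      have "0 = (\<Sum>v\<in>pverts T. A k v * F v)" by (simp add: F0)
      also have "\<dots> = (\<Sum>i<?m. c i * (\<Sum>v\<in>pverts T. A k v * b i v))"
        using clin_sum[OF clin_wsum[where S = "pverts T"], where b = b and c = c and n = ?m] by (simp add: F_def)
      also have "\<dots> = (\<Sum>i<?m. if i = k then c i else 0)" using Ab k by (intro sum.cong) auto
      also have "\<dots> = c k" using k by simp
      finally show ?thesis by simp
    qed
    show "c j = 0"
    proof (cases "j < ?m")
      case False
      define i where "i = j - ?m"
      have i: "i < h" "j = ?m + i" using False j by (auto simp: i_def)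
      obtain v where v: "z i v \<noteq> 0" using z[OF i(1)] by (auto simp: fun_eq_iff)
      then have vD: "v \<in> D i" using zz[OF i(1)] by blast
      have "0 = (\<Sum>k<h. c (?m + k) * z k v)" using c[of v] cb by simp
      also have "\<dots> = (\<Sum>k<h. if k = i then c (?m + k) * z k v else 0)"
      proof (rule sum.cong[OF refl])
        fix k assume k: "k \<in> {..<h}"
        show "c (?m + k) * z k v = (if k = i then c (?m + k) * z k v else 0)"
        proof (cases "k = i")
          case False
          then have "v \<notin> D k" using G.D_disj[OF i(1) _ vD, of k] k by blast
          then have "z k v = 0" using zz[of k v] k by blast
          then show ?thesis using False by simp
        qed simp
      qed
      also have "\<dots> = c j * z i v" using i by simp
      finally show ?thesis using v by simp
    qed (use cb in simp)
  qed
  ultimately show ?thesis by simp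
qed

text \<open>A branch of \<open>G\<close> has no leaf, so no leg starts in it, while all legs that
  start in a branch of \<open>T\<close> end at the one vertex \<open>c i\<close>. Legs that start in
  the rest stay there and correspond under \<phi>.\<close>

lemma q_transfer:
  assumes T: "legged T s x" and G: "legged G s x"
    and big: "\<And>i. i < h \<Longrightarrow> 3 \<le> card (nb T (u i))"
    and nl: "\<And>i v. i < h \<Longrightarrow> v \<in> D i \<Longrightarrow> card (nb G v) \<noteq> 1"
    and c: "\<And>i. i < h \<Longrightarrow> c i \<in> S i"
    and ex: "\<And>i. i < h \<Longrightarrow> \<exists>us. legpath s T us \<and> us ! s = c i"
    and un: "\<And>i us. i < h \<Longrightarrow> legpath s T us \<Longrightarrow> us ! 0 \<in> S i \<Longrightarrow> us ! s = c i"
  shows "q s T = q s G + h"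
proof -
  interpret LT: legged T s x by fact
  interpret LG: legged G s x by fact
  interpret sw: two_attached G T h D w e S u a \<psi> by (rule swap)
  have big': "3 \<le> card (nb G (w i))" if "i < h" for i
    using big[OF that] card_nb_\<phi>[OF T.w_R[OF that]] \<phi>u[OF that] by simp
  have R: "v \<in> T.R \<or> (\<exists>i<h. v \<in> S i)" if "v \<in> pverts T" for v using that by blast
  have QG: "\<exists>us. legpath s G us \<and> us ! 0 \<in> G.R \<and> us ! s = v" if v: "v \<in> LG.QQ" for v
  proof -
    have "us ! 0 \<in> G.R" if us: "legpath s G us" for us
    proof (rule ccontr)
      assume "us ! 0 \<notin> G.R"
      then obtain i where "i < h" "us ! 0 \<in> D i" using LG.legpath_in[OF us, of 0] by blast
      then show False using nl us by (auto simp: legpath_def)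
    qed
    moreover obtain us where "legpath s G us" "us ! s = v" using v LG.Q_iff[of v] by blast
    ultimately show ?thesis by blast
  qed
  have step: "us ! s \<in> G.R \<and> \<psi> (us ! s) \<in> LT.QQ" if us: "legpath s G us" "us ! 0 \<in> G.R" for us
  proof -
    have in_R: "us ! j \<in> G.R" if "j \<le> s" for j by (rule G.leg_in_R[OF big' us that])
    have "legpath s T (map \<psi> us)" by (rule sw.legpath_map[OF us(1) in_R])
    moreover have "map \<psi> us ! s = \<psi> (us ! s)" using us(1) by (simp add: legpath_def)
    ultimately have "\<psi> (us ! s) \<in> LT.QQ" using LT.Q_iff by blast
    then show ?thesis using in_R[of s] by blast
  qed
  have bk: "us ! s \<in> T.R \<and> \<phi> (us ! s) \<in> LG.QQ" if us: "legpath s T us" "us ! 0 \<in> T.R" for us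
  proof -
    have in_R: "us ! j \<in> T.R" if "j \<le> s" for j by (rule T.leg_in_R[OF big us that])
    have "legpath s G (map \<phi> us)" by (rule legpath_map[OF us(1) in_R])
    moreover have "map \<phi> us ! s = \<phi> (us ! s)" using us(1) by (simp add: legpath_def)
    ultimately have "\<phi> (us ! s) \<in> LG.QQ" using LG.Q_iff by blast
    then show ?thesis using in_R[of s] by blast
  qed
  have QR: "LG.QQ \<subseteq> G.R"
  proof
    fix v assume "v \<in> LG.QQ"
    then obtain us where "legpath s G us" "us ! 0 \<in> G.R" "us ! s = v" using QG by blast
    then show "v \<in> G.R" using step[of us] by blast
  qed
  have "LT.QQ = c ` {..<h} \<union> \<psi> ` LG.QQ"
  proof (intro equalityI subsetI)
    fix v assume "v \<in> LT.QQ"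
    then obtain us where us: "legpath s T us" "us ! s = v" using LT.Q_iff by blast
    from R[OF LT.legpath_in[OF us(1), of 0]] consider "us ! 0 \<in> T.R" | i where "i < h" "us ! 0 \<in> S i" by auto
    then show "v \<in> c ` {..<h} \<union> \<psi> ` LG.QQ"
    proof cases
      case 1
      have "v \<in> T.R" "\<phi> v \<in> LG.QQ" using bk[OF us(1) 1] us(2) by simp_all
      have "v = \<psi> (\<phi> v)" using inv_into_f_f[OF inj \<open>v \<in> T.R\<close>] by simp
      then show ?thesis using \<open>\<phi> v \<in> LG.QQ\<close> by blast
    next
      case 2
      then have "v = c i" using un[OF 2(1) us(1) 2(2)] us(2) by simp
      then show ?thesis using 2(1) by blast
    qed
  next
    fix v assume "v \<in> c ` {..<h} \<union> \<psi> ` LG.QQ"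
    then consider i where "i < h" "v = c i" | v' where "v' \<in> LG.QQ" "v = \<psi> v'" by blast
    then show "v \<in> LT.QQ"
    proof cases
      case 1
      then show ?thesis using ex[of i] LT.Q_iff[of v] by blast
    next
      case 2
      then obtain us where "legpath s G us" "us ! 0 \<in> G.R" "us ! s = v'" using QG by blast
      then show ?thesis using step[of us] 2 by blast
    qed
  qed
  moreover have "c ` {..<h} \<inter> \<psi> ` LG.QQ = {}"
  proof -
    have R': "\<psi> v \<in> T.R" if "v \<in> LG.QQ" for v using QR that sw.\<phi>R by blast
    show ?thesis
    proof (rule equals0I)
      fix y assume "y \<in> c ` {..<h} \<inter> \<psi> ` LG.QQ"
      then obtain i v where "i < h" "y = c i" "v \<in> LG.QQ" "y = \<psi> v" by blast
      then have "y \<in> S i" "y \<in> T.R" using c[of i] R'[of v] by simp_all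
      then show False using \<open>i < h\<close> by blast
    qed
  qed
  moreover have "card (c ` {..<h}) = h"
  proof -
    have "inj_on c {..<h}"
    proof (rule inj_onI)
      fix i j assume ij: "i \<in> {..<h}" "j \<in> {..<h}" "c i = c j"
      then have "c i \<in> S i" "c i \<in> S j" using c[of i] c[of j] by simp_all
      then show "i = j" using T.D_disj[of i j "c i"] ij by simp
    qed
    then show ?thesis by (simp add: card_image)
  qed
  moreover have "card (\<psi> ` LG.QQ) = card LG.QQ"
    by (rule card_image, rule inj_on_subset[OF sw.inj QR])
  ultimately show ?thesis
    unfolding q_def using LG.finite_Q by (simp add: card_Un_disjoint)
qed

end

section \<open>The branches \<open>C\<^bsub>g,l\<^esub>\<close> and \<open>T\<^bsub>k,l\<^esub>\<close>\<close>

lemma eigsp_zero_rule: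
  assumes G: "pair_graph G" and f: "f \<in> eigsp G x" and v: "v \<in> pverts G" "f v = 0"
    and z: "z \<in> nb G v" and others: "\<And>y. y \<in> nb G v \<Longrightarrow> y \<noteq> z \<Longrightarrow> f y = 0"
  shows "f z = 0"
proof -
  have "(\<Sum>y\<in>nb G v. f y) = f z" using z finite_nb[OF G] others by (simp add: sum.remove)
  then show ?thesis using f v by (simp add: eigsp_def)
qed

lemma eigsp_scale: "f \<in> eigsp G x \<Longrightarrow> (\<lambda>v. c * f v) \<in> eigsp G x"
  using eigsp_comb[of f G x f c 0] by simp

text \<open>At a zero \<open>g\<close> the recurrence starts afresh, scaled by
  \<open>chebU x (Suc g)\<close>. So all multiples of \<open>g\<close> are zeros too, which is what
  allows the cycle length and \<open>s\<close> to be reconciled when the tree is built.\<close>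

lemma chebU_add: "chebU x g = 0 \<Longrightarrow> chebU x (g + i) = chebU x (Suc g) * chebU x i"
proof (induction i rule: induct_nat_012)
  case (ge2 n)
  then show ?case by (simp add: algebra_simps)
qed simp_all

lemma chebU_mult: "chebU x g = 0 \<Longrightarrow> chebU x (k * g) = 0"
  by (induction k) (simp_all add: chebU_add)

lemma Suc_diff_pred: "Suc (m - k) < Suc m \<Longrightarrow> k \<le> m \<Longrightarrow> Suc (m - k) = m - (k - 1)" for m k :: nat
  by arith

context
  fixes g l :: nat
  assumes g: "3 \<le> g" and l: "1 \<le> l"
begin

lemma C_pair: "pair_graph (C_graph g l)"
  unfolding C_graph_def by (rule pair_graph_mk_graph) (use g in auto)

lemma C_verts: "pverts (C_graph g l) = {..<g + l - 1}"
  by (simp add: C_graph_def mk_graph_def)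

lemma C_nb: "i < g + l - 1 \<Longrightarrow> j \<in> nb (C_graph g l) i \<longleftrightarrow>
    j < g + l - 1 \<and> (j = Suc i \<or> i = Suc j \<or> i = 0 \<and> j = g - 1 \<or> j = 0 \<and> i = g - 1)"
  by (auto simp: nb_def C_graph_def mk_graph_def)

text \<open>The zeros at the adjacent vertices \<open>g - 1\<close> and \<open>0\<close> of the
  cycle run along the whole path \<open>0\<close>, ..., \<open>g + l - 2\<close>. So two vertices
  test the graph and its multiplicities are at most 2.\<close>

lemma C_zero:
  assumes f: "f \<in> eigsp (C_graph g l) x" and 0: "f 0 = 0" "f (g - 1) = 0"
  shows "f = (\<lambda>_. 0)"
proof -
  have step: "f i = 0 \<and> f (Suc i) = 0" if "Suc i < g + l - 1" for i
    using that
  proof (induction i)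
    case 0
    have "f 1 = 0"
    proof (rule eigsp_zero_rule[OF C_pair f, of 0])
      fix y assume "y \<in> nb (C_graph g l) 0" "y \<noteq> 1"
      then show "f y = 0" using C_nb[of 0 y] \<open>f (g - 1) = 0\<close> 0 by auto
    qed (use 0 \<open>f 0 = 0\<close> C_nb[of 0 1] in \<open>auto simp: C_verts\<close>)
    then show ?case using \<open>f 0 = 0\<close> by simp
  next
    case (Suc i)
    then have IH: "f i = 0" "f (Suc i) = 0" by auto
    have "f (Suc (Suc i)) = 0"
    proof (rule eigsp_zero_rule[OF C_pair f, of "Suc i"])
      fix y assume "y \<in> nb (C_graph g l) (Suc i)" "y \<noteq> Suc (Suc i)"
      then show "f y = 0" using C_nb[of "Suc i" y] IH(1) \<open>f 0 = 0\<close> Suc.prems by auto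
    qed (use Suc.prems IH C_nb[of "Suc i" "Suc (Suc i)"] in \<open>auto simp: C_verts\<close>)
    then show ?case using IH by simp
  qed
  show ?thesis
  proof
    fix i
    show "f i = 0"
    proof (cases "i < g + l - 1")
      case True
      then show ?thesis using 0(1) step[of "i - 1"] by (cases i) auto
    next
      case False
      then show ?thesis using f by (simp add: eigsp_def C_verts)
    qed
  qed
qed

text \<open>The zero moves inwards along the stem, which meets the cycle at
  \<open>g - 1\<close>.\<close>

lemma C_end_zero:
  assumes f: "f \<in> eigsp (C_graph g l) x" and 0: "f (C_end g l) = 0"
  shows "f (g - 1) = 0"
proof -
  have "\<forall>j\<le>k. f (g + l - 2 - j) = 0" if "k \<le> l - 1" for k
    using that
  proof (induction k)
    case 0
    then show ?case using assms(2) by (simp add: C_end_def)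
  next
    case (Suc k)
    define i where "i = g + l - 2 - k"
    have i: "g \<le> i" "i < g + l - 1" using Suc.prems g l by (auto simp: i_def)
    have fi: "f i = 0" using Suc by (simp add: i_def)
    have "f (i - 1) = 0"
    proof (rule eigsp_zero_rule[OF C_pair f, of i])
      fix y assume y: "y \<in> nb (C_graph g l) i" "y \<noteq> i - 1"
      then have "y = Suc i" "Suc i < g + l - 1" using C_nb[of i y] i g by auto
      moreover have "Suc (g + l - 2) = g + l - 1" "k \<le> g + l - 2" using g l Suc.prems by simp_all
      ultimately have "y = g + l - 2 - (k - 1)" using Suc_diff_pred[of "g + l - 2" k] unfolding i_def by simp
      moreover have IH: "\<forall>j\<le>k. f (g + l - 2 - j) = 0" using Suc by simp
      have "f (g + l - 2 - (k - 1)) = 0" by (rule IH[rule_format]) simp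
      ultimately show "f y = 0" by simp
    qed (use i g fi C_nb[of i "i - 1"] in \<open>auto simp: C_verts\<close>)
    moreover have "i - 1 = g + l - 2 - Suc k" by (simp add: i_def)
    ultimately show ?case using Suc by (auto simp: le_Suc_eq)
  qed
  then have "f (g + l - 2 - (l - 1)) = 0" by blast
  moreover have "g + l - 2 - (l - 1) = g - 1" using g l by simp
  ultimately show ?thesis by simp
qed

lemma C_mult_le: "graph_mult (C_graph g l) x \<le> 2"
proof -
  have "graph_mult (C_graph g l) x \<le> card {0, g - 1}"
    by (rule graph_mult_le_card[OF C_pair]) (auto intro: C_zero)
  also have "\<dots> \<le> 2" by (simp add: card_insert_if)
  finally show ?thesis .
qed

text \<open>The vertices \<open>C_end g l\<close> and \<open>0\<close> together test the eigenspace,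
  and with multiplicity 2 neither does so alone; this gives both kinds of eigenvectors. One that
  vanishes at the end vanishes at \<open>g - 1\<close>, hence is a multiple of the values of
  \<open>chebU\<close> along the rest of the cycle, and coming back to \<open>g - 1\<close> it
  exhibits the zero of \<open>chebU\<close>.\<close>

lemma C_mult_2:
  assumes m: "graph_mult (C_graph g l) x = 2"
  shows "Ctype (C_graph g l) (C_end g l) x" "chebU x g = 0"
proof -
  let ?e = "C_end g l"
  have e0: "z = (\<lambda>_. 0)" if "z \<in> eigsp (C_graph g l) x" "z ?e = 0" "z 0 = 0" for z
    using C_zero[OF that(1) that(3) C_end_zero[OF that(1,2)]] .
  have "\<exists>z\<in>eigsp (C_graph g l) x. z ?e \<noteq> 0"
  proof (rule ccontr)
    assume "\<not> ?thesis"
    then have "graph_mult (C_graph g l) x \<le> card {0 :: nat}"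
      by (intro graph_mult_le_card[OF C_pair]) (use e0 in auto)
    then show False using m by simp
  qed
  then obtain z1 where z1: "z1 \<in> eigsp (C_graph g l) x" "z1 ?e \<noteq> 0" by blast
  have "\<exists>z\<in>eigsp (C_graph g l) x. z \<noteq> (\<lambda>_. 0) \<and> z ?e = 0"
  proof (rule ccontr)
    assume "\<not> ?thesis"
    then have "graph_mult (C_graph g l) x \<le> card {?e}"
      by (intro graph_mult_le_card[OF C_pair]) auto
    then show False using m by simp
  qed
  then obtain z where z: "z \<in> eigsp (C_graph g l) x" "z \<noteq> (\<lambda>_. 0)" "z ?e = 0" by blast
  have "(\<lambda>v. inverse (z1 ?e) * z1 v) \<in> eigsp (C_graph g l) x" by (rule eigsp_scale[OF z1(1)])
  moreover have "inverse (z1 ?e) * z1 ?e = 1" using z1(2) by simp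
  ultimately have "\<exists>z\<in>eigsp (C_graph g l) x. z ?e = 1" by (intro bexI[of _ "\<lambda>v. inverse (z1 ?e) * z1 v"])
  then show "Ctype (C_graph g l) ?e x" unfolding Ctype_def using z e0 by blast
  have zg: "z (g - 1) = 0" by (rule C_end_zero[OF z(1,3)])
  have z0: "z 0 \<noteq> 0" using e0[OF z(1,3)] z(2) by blast
  have ev: "(\<Sum>j\<in>nb (C_graph g l) i. z j) = complex_of_real x * z i" if "i < g" for i
    using z(1) that l by (simp add: eigsp_def C_verts)
  have val: "z i = complex_of_real (chebU x (Suc i)) * z 0" if "i \<le> g - 1" for i
    using that
  proof (induction i rule: induct_nat_012)
    case 1
    have "nb (C_graph g l) 0 = {1, g - 1}"
    proof (rule Set.set_eqI)
      fix j
      have "0 < g + l - 1" using g l by simp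
      then show "j \<in> nb (C_graph g l) 0 \<longleftrightarrow> j \<in> {1, g - 1}"
        unfolding C_nb[OF \<open>0 < g + l - 1\<close>] insert_iff empty_iff using g l by arith
    qed
    then show ?case using ev[of 0] zg g by simp
  next
    case (ge2 i)
    have "nb (C_graph g l) (Suc i) = {i, Suc (Suc i)}"
    proof (rule Set.set_eqI)
      fix j
      have 1: "Suc i < g + l - 1" using ge2.prems g l by simp
      show "j \<in> nb (C_graph g l) (Suc i) \<longleftrightarrow> j \<in> {i, Suc (Suc i)}"
        unfolding C_nb[OF 1] insert_iff empty_iff using ge2.prems g l by arith
    qed
    then have "z i + z (Suc (Suc i)) = complex_of_real x * z (Suc i)"
      using ev[of "Suc i"] ge2.prems g by simp
    then have "z (Suc (Suc i)) = complex_of_real x * z (Suc i) - z i" by (simp add: algebra_simps)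
    then show ?case using ge2 by (simp add: algebra_simps)
  qed simp
  have "Suc (g - 1) = g" using g by simp
  then show "chebU x g = 0" using val[of "g - 1"] zg z0 by simp
qed

end

section \<open>The trees with pendant copies of \<open>P_s\<close>\<close>

context
  fixes s k l :: nat
  assumes s: "1 \<le> s" and l: "1 \<le> l"
begin

abbreviation "TG \<equiv> T_graph s k l"

lemma T_pair: "pair_graph TG"
  unfolding T_graph_def by (rule pair_graph_mk_graph) auto

lemma T_verts: "pverts TG = {0} \<times> {0..<l} \<union> {1..k} \<times> {1..s}"
  by (simp add: T_graph_def mk_graph_def)

lemma T_nb_leg:
  assumes "1 \<le> i" "i \<le> k" "1 \<le> j" "j \<le> s"
  shows "nb TG (i, j) = (if j = 1 then {(0, 0)} else {(i, j - 1)}) \<union> (if j < s then {(i, Suc j)} else {})"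
  using assms l by (auto simp: nb_def T_graph_def mk_graph_def)

lemma T_nb_stem:
  assumes "1 \<le> b" "b < l"
  shows "nb TG (0, b) = {(0, b - 1)} \<union> (if Suc b < l then {(0, Suc b)} else {})"
  using assms l by (auto simp: nb_def T_graph_def mk_graph_def)

lemma T_nb_center: "nb TG (0, 0) = (if 1 < l then {(0, 1)} else {}) \<union> (\<lambda>i. (i, 1)) ` {1..k}"
  using s l by (auto simp: nb_def T_graph_def mk_graph_def)

definition "Tleg i = map (\<lambda>j. if j < s then (i, s - j) else (0, 0)) [0..<Suc s]"

lemma Tleg_nth: "j \<le> s \<Longrightarrow> Tleg i ! j = (if j < s then (i, s - j) else (0, 0))"
  by (simp add: Tleg_def del: upt_Suc)

lemma Tleg_legpath:
  assumes i: "1 \<le> i" "i \<le> k"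
  shows "legpath s TG (Tleg i)"
  unfolding legpath_def
proof (intro conjI allI impI)
  show "length (Tleg i) = Suc s" by (simp add: Tleg_def)
  show "distinct (Tleg i)" using i by (auto simp: Tleg_def distinct_map inj_on_def)
  show "set (Tleg i) \<subseteq> pverts TG" using i l s by (auto simp: Tleg_def T_verts)
  show "(Tleg i ! j, Tleg i ! Suc j) \<in> parcs TG" if j: "j < s" for j
  proof -
    have "Tleg i ! Suc j \<in> nb TG (Tleg i ! j)"
      using T_nb_leg[OF i, of "s - j"] j Tleg_nth[of j i] Tleg_nth[of "Suc j" i] by auto
    then show ?thesis by (simp add: nb_def)
  qed
  show "card (nb TG (Tleg i ! 0)) = 1"
    using T_nb_leg[OF i, of s] Tleg_nth[of 0 i] s by simp
  show "card (nb TG (Tleg i ! j)) = 2" if j: "1 \<le> j" "j < s" for j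
    using T_nb_leg[OF i, of "s - j"] Tleg_nth[of j i] j by auto
qed

lemma T_zero:
  assumes x: "x \<notin> graph_spectrum (path_graph s)" and f: "f \<in> eigsp TG x"
    and 0: "\<And>b. b < l \<Longrightarrow> f (0, b) = 0"
  shows "f = (\<lambda>_. 0)"
proof
  fix v :: "nat \<times> nat"
  consider "v \<notin> pverts TG" | b where "v = (0, b)" "b < l" | i j where "v = (i, j)" "1 \<le> i" "i \<le> k" "1 \<le> j" "j \<le> s"
    by (cases v) (auto simp: T_verts)
  then show "f v = 0"
  proof cases
    case 3
    have "f (Tleg i ! s) = 0" using 0[of 0] l Tleg_nth[of s i] by simp
    then have "f (Tleg i ! (s - j)) = 0"
      using legpath_eig[OF T_pair x s f Tleg_legpath[OF 3(2,3)], of "s - j"] by simp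
    moreover have "Tleg i ! (s - j) = (i, j)" using Tleg_nth[of "s - j" i] 3(4,5) by simp
    ultimately show ?thesis using 3(1) by simp
  next
    case 1
    then show ?thesis using f unfolding eigsp_def by blast
  next
    case 2
    then show ?thesis using 0 by simp
  qed
qed

text \<open>The zero moves from the \<open>l\<close>-vertex along the stem to the center, and from
  there into the legs because \<open>x\<close> is not an eigenvalue of \<open>P_s\<close>. So the
  \<open>l\<close>-vertex alone tests the eigenspace.\<close>

lemma T_end_zero:
  assumes x: "x \<notin> graph_spectrum (path_graph s)" and f: "f \<in> eigsp TG x" and 0: "f (T_end l) = 0"
  shows "f = (\<lambda>_. 0)"
proof (rule T_zero[OF x f])
  have all: "\<forall>j\<le>n. f (0, l - 1 - j) = 0" if "n \<le> l - 1" for n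
    using that
  proof (induction n)
    case 0
    then show ?case using assms(3) by (simp add: T_end_def)
  next
    case (Suc n)
    define b where "b = l - 1 - n"
    have b: "1 \<le> b" "b < l" using Suc.prems by (auto simp: b_def)
    have fb: "f (0, b) = 0" using Suc by (simp add: b_def)
    have "f (0, b - 1) = 0"
    proof (rule eigsp_zero_rule[OF T_pair f, of "(0, b)"])
      fix y assume y: "y \<in> nb TG (0, b)" "y \<noteq> (0, b - 1)"
      then have "y = (0, Suc b)" "Suc b < l" using T_nb_stem[OF b] by (auto split: if_splits)
      moreover have "Suc (l - 1) = l" "n \<le> l - 1" using l Suc.prems by simp_all
      ultimately have "y = (0, l - 1 - (n - 1))" using Suc_diff_pred[of "l - 1" n] unfolding b_def by simp
      moreover have IH: "\<forall>j\<le>n. f (0, l - 1 - j) = 0" using Suc by simp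
      have "f (0, l - 1 - (n - 1)) = 0" by (rule IH[rule_format]) simp
      ultimately show "f y = 0" by simp
    qed (use b fb T_nb_stem[OF b] in \<open>auto simp: T_verts\<close>)
    moreover have "b - 1 = l - 1 - Suc n" by (simp add: b_def)
    ultimately show ?case using Suc by (auto simp: le_Suc_eq)
  qed
  fix b assume "b < l"
  then have "l - 1 - (l - 1 - b) = b" "l - 1 - b \<le> l - 1" by auto
  then show "f (0, b) = 0" using all[of "l - 1"] by (metis order_refl)
qed

lemma T_Ttype:
  assumes x: "x \<notin> graph_spectrum (path_graph s)" and xT: "x \<in> graph_spectrum TG"
  shows "Ttype TG (T_end l) x"
  unfolding Ttype_def
proof (intro conjI ballI impI)
  obtain f where f: "f \<in> eigsp TG x" "f \<noteq> (\<lambda>_. 0)" using xT graph_spectrum_iff[OF T_pair] by blast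
  then have "f (T_end l) \<noteq> 0" using T_end_zero[OF x] by blast
  then have "inverse (f (T_end l)) * f (T_end l) = 1" by simp
  then show "\<exists>f\<in>eigsp TG x. f (T_end l) = 1"
    by (intro bexI[OF _ eigsp_scale[OF f(1), of "inverse (f (T_end l))"]])
qed (rule T_end_zero[OF x])

lemma T_mult_1:
  assumes x: "x \<notin> graph_spectrum (path_graph s)"
  shows "graph_mult TG x \<le> 1"
proof -
  have "graph_mult TG x \<le> card {T_end l}"
    by (rule graph_mult_le_card[OF T_pair]) (auto intro: T_end_zero[OF x])
  then show ?thesis by simp
qed

end

text \<open>With one leg the tree is a path on \<open>s + l\<close> vertices, and the values of
  \<open>chebU\<close> form an eigenvector once the value one step beyond the last vertex is
  zero.\<close>

lemma T_path_spectrum: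
  assumes s: "1 \<le> s" and l: "1 \<le> l" and U: "chebU x (Suc (s + l)) = 0"
  shows "x \<in> graph_spectrum (T_graph s 1 l)"
proof -
  let ?T = "T_graph s 1 l"
  \<comment> \<open>Position on the path, counted from 1 at the leaf \<open>(1, s)\<close>; the
    center has position \<open>s + 1\<close> and the \<open>l\<close>-vertex position
    \<open>s + l\<close>.\<close>
  define pos where "pos = (\<lambda>(a, b). if a = (1 :: nat) then Suc s - b else Suc s + b)"
  define f where "f = (\<lambda>v. if v \<in> pverts ?T then complex_of_real (chebU x (pos v)) else 0)"
  note Tv = T_verts[OF s l, of 1]
  have rec: "chebU x n + chebU x (Suc (Suc n)) = x * chebU x (Suc n)" for n by simp
  have leg: "f (1, j) = complex_of_real (chebU x (Suc s - j))" if "1 \<le> j" "j \<le> s" for j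
  proof -
    have "(1, j) \<in> pverts ?T" unfolding Tv using that by auto
    moreover have "pos (1, j) = Suc s - j" by (simp add: pos_def)
    ultimately show ?thesis by (simp only: f_def if_True)
  qed
  have stem: "f (0, b) = complex_of_real (chebU x (Suc s + b))" if "b < l" for b
  proof -
    have "(0, b) \<in> pverts ?T" unfolding Tv using that by auto
    moreover have "pos (0, b) = Suc s + b" by (simp add: pos_def)
    ultimately show ?thesis by (simp only: f_def if_True)
  qed
  have "f \<in> eigsp ?T x"
    unfolding eigsp_def
  proof (intro CollectI conjI ballI)
    show "\<forall>v. v \<notin> pverts ?T \<longrightarrow> f v = 0" by (simp add: f_def)
    fix v assume "v \<in> pverts ?T"
    then consider j where "v = (1, j)" "1 \<le> j" "j \<le> s" | b where "v = (0, b)" "1 \<le> b" "b < l" | "v = (0, 0)"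
    proof -
      obtain a b where ab: "v = (a, b)" by (cases v)
      have "a = 0 \<and> b < l \<or> a = 1 \<and> 1 \<le> b \<and> b \<le> s" using \<open>v \<in> pverts ?T\<close> unfolding Tv ab by simp
      then show thesis using that ab by (cases "b = 0") auto
    qed
    then show "(\<Sum>w\<in>nb ?T v. f w) = complex_of_real x * f v"
    proof cases
      case 1
      note n = T_nb_leg[OF s l, of 1 1 j, OF _ _ 1(2,3), simplified]
      define i where "i = s - j"
      have i: "Suc s - j = Suc i" "i \<le> s - 1" using 1 by (auto simp: i_def)
      have up: "f (if j = 1 then (0, 0) else (1, j - 1)) = complex_of_real (chebU x (Suc (Suc i)))"
        using leg[of "j - 1"] stem[of 0] 1 l i by (cases "j = 1") (auto simp: i_def Suc_diff_le)
      have dn: "(\<Sum>w\<in>(if j < s then {(1, Suc j)} else {}). f w) = complex_of_real (chebU x i)"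
        using leg[of "Suc j"] 1 by (auto simp: i_def)
      have "nb ?T v = insert (if j = 1 then (0, 0) else (1, j - 1)) (if j < s then {(1, Suc j)} else {})"
        using n 1(1) by (cases "j = 1"; cases "j < s") (simp_all add: insert_commute)
      then have "(\<Sum>w\<in>nb ?T v. f w) = f (if j = 1 then (0, 0) else (1, j - 1)) + (\<Sum>w\<in>(if j < s then {(1, Suc j)} else {}). f w)"
        by (cases "j = 1"; cases "j < s") simp_all
      also have "\<dots> = complex_of_real (chebU x i + chebU x (Suc (Suc i)))" unfolding up dn by simp
      also have "\<dots> = complex_of_real x * f v" unfolding rec using leg[OF 1(2,3)] 1(1) i by simp
      finally show ?thesis .
    next
      case 2
      note n = T_nb_stem[OF s l 2(2,3), of 1]
      have up: "(\<Sum>w\<in>(if Suc b < l then {(0, Suc b)} else {}). f w) = complex_of_real (chebU x (Suc (Suc (s + b))))"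
        using stem[of "Suc b"] U 2 by (cases "Suc b = l") (auto simp del: chebU.simps)
      have "(\<Sum>w\<in>nb ?T v. f w) = f (0, b - 1) + (\<Sum>w\<in>(if Suc b < l then {(0, Suc b)} else {}). f w)"
        unfolding 2(1) n by (cases "Suc b < l") simp_all
      also have "\<dots> = complex_of_real (chebU x (s + b) + chebU x (Suc (Suc (s + b))))"
        unfolding up using stem[of "b - 1"] 2 by simp
      also have "\<dots> = complex_of_real x * f v" unfolding rec using stem[OF 2(3)] 2(1) by simp
      finally show ?thesis .
    next
      case 3
      note n = T_nb_center[OF s l, of 1]
      have up: "(\<Sum>w\<in>(if 1 < l then {(0, 1)} else {}). f w) = complex_of_real (chebU x (Suc (Suc s)))"
        using stem[of 1] U l by (cases "l = 1") (auto simp del: chebU.simps)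
      have "nb ?T v = insert (1, 1) (if 1 < l then {(0, 1)} else {})" unfolding 3 n by auto
      then have "(\<Sum>w\<in>nb ?T v. f w) = f (1, 1) + (\<Sum>w\<in>(if 1 < l then {(0, 1)} else {}). f w)"
        by (cases "1 < l") simp_all
      also have "\<dots> = complex_of_real (chebU x s + chebU x (Suc (Suc s)))"
        unfolding up using leg[of 1] s by simp
      also have "\<dots> = complex_of_real x * f v" unfolding rec using stem[of 0] l 3 by simp
      finally show ?thesis .
    qed
  qed
  moreover have "f (1, s) = 1" using leg[of s] s by simp
  then have "f \<noteq> (\<lambda>_. 0)" by (metis zero_neq_one)
  ultimately show ?thesis using graph_spectrum_iff[OF T_pair[OF s l]] by blast
qed

section \<open>Pendant trees and pendant cycles as branches\<close>

lemma att_pendants: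
  assumes G: "pair_graph G" and dis: "disjoint_family_on D {..<h}"
    and w: "\<And>i. i < h \<Longrightarrow> w i \<in> pverts G - (\<Union>j<h. D j)"
    and pend: "\<And>i. i < h \<Longrightarrow> pendant_at G (D i) (w i) (F i) (r i)"
    and r: "\<And>i. i < h \<Longrightarrow> r i \<in> pverts (F i)"
  shows "\<exists>\<phi>. att G h D w (\<lambda>i. \<phi> i (r i)) \<and> (\<forall>i<h. giso (\<phi> i) (F i) (induce G (D i)) \<and>
    2 \<le> card (nb (induce G (pverts G - D i)) (w i)))"
proof -
  have "\<forall>i. \<exists>f. i < h \<longrightarrow> iso_via f (F i) (induce G (D i)) \<and>
    parcs G \<inter> (pverts G - D i) \<times> D i = {(w i, iso_verts f (r i))}"
    using pend unfolding pendant_at_def by blast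
  then obtain f where f: "\<And>i. i < h \<Longrightarrow> iso_via (f i) (F i) (induce G (D i)) \<and>
    parcs G \<inter> (pverts G - D i) \<times> D i = {(w i, iso_verts (f i) (r i))}" by metis
  have g: "giso (iso_verts (f i)) (F i) (induce G (D i))" if "i < h" for i
    using iso_via_giso f[OF that] by blast
  have "att G h D w (\<lambda>i. iso_verts (f i) (r i))"
    unfolding att_def
  proof (intro conjI allI impI)
    fix i assume i: "i < h"
    show "D i \<subseteq> pverts G" using pend[OF i] by (simp add: pendant_at_def)
    have "D i = iso_verts (f i) ` pverts (F i)" using g[OF i] by (simp add: giso_def)
    then show "iso_verts (f i) (r i) \<in> D i" using r[OF i] by blast
    show "parcs G \<inter> (pverts G - D i) \<times> D i = {(w i, iso_verts (f i) (r i))}" using f[OF i] by blast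
  qed (use G dis w in blast)+
  moreover have "2 \<le> card (nb (induce G (pverts G - D i)) (w i))" if "i < h" for i
    using pend[OF that] by (simp add: pendant_at_def out_degree_nb)
  ultimately show ?thesis using g by (intro exI[of _ "\<lambda>i. iso_verts (f i)"]) blast
qed

context attached
begin

text \<open>A pendant is attached at a vertex of degree at least 2 in the graph without it; the
  attaching edge raises this to the degree 3 that stops legs.\<close>

lemma card_nb_w:
  assumes i: "i < h"
  shows "card (nb G (w i)) = Suc (card (nb (induce G (V - D i)) (w i)))"
proof -
  have w: "w i \<in> V - D i" using w_R[OF i] i by blast
  have V: "nb G (w i) \<subseteq> V" using GD(5) by (auto simp: nb_def)
  have "e i \<in> nb G (w i)" using we[OF i] by blast
  moreover have "u = e i" if u: "u \<in> nb G (w i)" "u \<in> D i" for u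
  proof -
    have "w i \<in> nb G u" using u(1) by (rule nb_symm[THEN iffD1])
    then show ?thesis using enter[OF i u(2)] w by blast
  qed
  ultimately have "nb G (w i) = insert (e i) (nb G (w i) \<inter> (V - D i))" using V by blast
  moreover have "e i \<notin> nb G (w i) \<inter> (V - D i)" using e_D[OF i] by blast
  ultimately have "card (nb G (w i)) = Suc (card (nb G (w i) \<inter> (V - D i)))"
    using card_insert_disjoint[of "nb G (w i) \<inter> (V - D i)" "e i"] fin_nb by simp
  then show ?thesis unfolding nb_induce[OF w] .
qed

lemma branch_nb:
  assumes i: "i < h" and g: "giso \<phi> F (induce G (D i))" and y: "y \<in> pverts F"
  shows "nb G (\<phi> y) = \<phi> ` nb F y \<union> (if \<phi> y = e i then {w i} else {})"
proof -
  have "\<phi> y \<in> D i" using g y by (auto simp: giso_def)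
  then show ?thesis using nb_D[OF i, of "\<phi> y"] giso_nb[OF g y] by (simp add: nb_induce)
qed

lemma branch_card_nb:
  assumes i: "i < h" and g: "giso \<phi> F (induce G (D i))" and y: "y \<in> pverts F"
  shows "card (nb G (\<phi> y)) = card (nb F y) + (if \<phi> y = e i then 1 else 0)"
proof -
  have inj: "inj_on \<phi> (nb F y)"
    using g giso_nb_sub[OF g, of y] inj_on_subset unfolding giso_def by blast
  have "\<phi> ` nb F y \<subseteq> D i" using g giso_nb_sub[OF g, of y] by (auto simp: giso_def)
  then have "w i \<notin> \<phi> ` nb F y" using w_notD[OF i i] by blast
  moreover have "finite (\<phi> ` nb F y)"
    using \<open>\<phi> ` nb F y \<subseteq> D i\<close> D_V[OF i] GD(1) by (meson finite_subset)
  ultimately show ?thesis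
    unfolding branch_nb[OF assms] using card_image[OF inj] by simp
qed

text \<open>The copies of \<open>P_s\<close> in the branch are legs of \<open>G\<close> ending at
  the center, and every leaf of \<open>G\<close> in the branch starts one of them. So the legs
  starting in the branch contribute exactly its center to \<open>Q\<close>.\<close>

lemma T_branch:
  assumes i: "i < h" and s: "1 \<le> s" and k: "1 \<le> k" and l: "1 \<le> l"
    and g: "giso \<phi> (T_graph s k l) (induce G (D i))" and e: "e i = \<phi> (T_end l)"
  shows "\<exists>us. legpath s G us \<and> us ! s = \<phi> (0, 0)"
    and "legpath s G us \<Longrightarrow> us ! 0 \<in> D i \<Longrightarrow> us ! s = \<phi> (0, 0)"
    and "\<phi> (0, 0) \<in> D i"
    and "v \<in> D i \<Longrightarrow> card (nb G v) = 1 \<Longrightarrow> \<exists>us. legpath s G us \<and> us ! 0 = v \<and> us ! s = \<phi> (0, 0)"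
proof -
  let ?T = "T_graph s k l"
  note Tv = T_verts[OF s l, of k]
  have inj: "inj_on \<phi> (pverts ?T)" and img: "D i = \<phi> ` pverts ?T"
    and arcs: "parcs (induce G (D i)) = map_prod \<phi> \<phi> ` parcs ?T" using g by (auto simp: giso_def)
  have endV: "T_end l \<in> pverts ?T" unfolding Tv T_end_def using l by simp
  have "(0, 0) \<in> pverts ?T" unfolding Tv using l by simp
  then show "\<phi> (0, 0) \<in> D i" unfolding img by (rule imageI)
  have ne: "\<phi> (a, b) \<noteq> e i" if ab: "(a, b) \<in> pverts ?T" "(a, b) \<noteq> T_end l" for a b
  proof
    assume "\<phi> (a, b) = e i"
    then have "(a, b) = T_end l" using inj_onD[OF inj _ ab(1) endV] unfolding e by blast
    then show False using ab(2) by blast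
  qed
  have leg: "legpath s G (map \<phi> (Tleg s m))" if m: "1 \<le> m" "m \<le> k" for m
  proof -
    note lp = Tleg_legpath[OF s l m, unfolded legpath_def]
    have len: "length (Tleg s m) = Suc s" using lp by blast
    have nth: "map \<phi> (Tleg s m) ! j = \<phi> (Tleg s m ! j)" if "j \<le> s" for j using that len by simp
    have subT: "set (Tleg s m) \<subseteq> pverts ?T" using lp by blast
    have inT: "Tleg s m ! j \<in> pverts ?T" if "j \<le> s" for j
      by (rule subsetD[OF subT], rule nth_mem) (use len that in simp)
    have cd: "card (nb G (\<phi> (Tleg s m ! j))) = card (nb ?T (Tleg s m ! j))" if "j < s" for j
    proof -
      have "Tleg s m ! j = (m, s - j)" using Tleg_nth[OF s l, of j m] that by simp
      moreover have "(m, s - j) \<noteq> T_end l" using m by (simp add: T_end_def)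
      ultimately have "\<phi> (Tleg s m ! j) \<noteq> e i" using ne[of m "s - j"] inT[of j] that by simp
      then show ?thesis using branch_card_nb[OF i g inT[of j]] that by simp
    qed
    show ?thesis
      unfolding legpath_def
    proof (intro conjI allI impI)
      show "length (map \<phi> (Tleg s m)) = Suc s" using len by simp
      show "distinct (map \<phi> (Tleg s m))" using lp inj_on_subset[OF inj subT] by (simp add: distinct_map)
      have "\<phi> ` set (Tleg s m) \<subseteq> D i" unfolding img using subT by (rule image_mono)
      then show "set (map \<phi> (Tleg s m)) \<subseteq> V" using D_V[OF i] by simp
      show "(map \<phi> (Tleg s m) ! j, map \<phi> (Tleg s m) ! Suc j) \<in> parcs G" if j: "j < s" for j
      proof -
        have "(Tleg s m ! j, Tleg s m ! Suc j) \<in> parcs ?T" using lp j by blast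
        then have "(\<phi> (Tleg s m ! j), \<phi> (Tleg s m ! Suc j)) \<in> parcs (induce G (D i))" unfolding arcs by force
        then show ?thesis using nth[of j] nth[of "Suc j"] j by (simp add: induce_def)
      qed
      show "card (nb G (map \<phi> (Tleg s m) ! 0)) = 1" using nth[of 0] cd[of 0] conjunct1[OF conjunct2[OF conjunct2[OF conjunct2[OF conjunct2[OF lp]]]]] s by simp
      show "card (nb G (map \<phi> (Tleg s m) ! j)) = 2" if "1 \<le> j" "j < s" for j
        using nth[of j] cd[of j] lp that by simp
    qed
  qed
  have last: "map \<phi> (Tleg s m) ! s = \<phi> (0, 0)" for m
    using Tleg_nth[OF s l, of s m] Tleg_def[of s l m] s l by (simp add: Tleg_def[OF s l] del: upt_Suc)
  show "\<exists>us. legpath s G us \<and> us ! s = \<phi> (0, 0)" using leg[of 1] k last by blast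
  show leaf: "\<exists>us. legpath s G us \<and> us ! 0 = v \<and> us ! s = \<phi> (0, 0)" if v: "v \<in> D i" "card (nb G v) = 1" for v
  proof -
    obtain a b where ab: "(a, b) \<in> pverts ?T" "v = \<phi> (a, b)" using v(1) unfolding img by auto
    have c1: "card (nb ?T (a, b)) + (if \<phi> (a, b) = e i then 1 else 0) = 1"
      using v(2) branch_card_nb[OF i g ab(1)] ab(2) by simp
    have eend: "\<phi> (T_end l) = e i" using e by simp
    have "1 \<le> a \<and> a \<le> k \<and> b = s"
    proof (rule ccontr)
      assume c: "\<not> ?thesis"
      consider "1 \<le> a" "a \<le> k" "1 \<le> b" "b < s" | "a = 0" "1 \<le> b" "b < l" | "a = 0" "b = 0"
        using ab(1) c unfolding Tv by fastforce
      then show False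
      proof cases
        case 1
        then show False using c1 T_nb_leg[OF s l, of a k b] by (auto split: if_splits)
      next
        case 2
        show False
        proof (cases "Suc b < l")
          case True
          then show False using c1 T_nb_stem[OF s l 2(2,3), of k] 2(1) by (auto split: if_splits)
        next
          case False
          then have "(a, b) = T_end l" using 2 by (simp add: T_end_def)
          then show False using c1 T_nb_stem[OF s l 2(2,3), of k] 2(1) False eend by auto
        qed
      next
        case 3
        \<comment> \<open>The center is not a leaf: for \<open>l = 1\<close> it has the attaching
          edge besides a leg, otherwise a leg and a neighbour on the stem.\<close>
        have n: "(1, 1) \<in> nb ?T (0, 0)" using T_nb_center[OF s l, of k] k by auto
        have f: "finite (nb ?T (0, 0))" by (rule finite_nb[OF T_pair[OF s l]])
        show False
        proof (cases "l = 1")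
          case True
          then have "(a, b) = T_end l" using 3 by (simp add: T_end_def)
          moreover have "1 \<le> card (nb ?T (0, 0))" using n f by (metis card_gt_0_iff empty_iff less_eq_Suc_le One_nat_def)
          ultimately show False using c1 eend 3 by simp
        next
          case False
          then have "(0, 1) \<in> nb ?T (0, 0)" using T_nb_center[OF s l, of k] l by auto
          then have "card {(1, 1), (0 :: nat, 1 :: nat)} \<le> card (nb ?T (0, 0))" using n f by (intro card_mono) auto
          then show False using c1 3 by simp
        qed
      qed
    qed
    then have "v = map \<phi> (Tleg s a) ! 0"
      using Tleg_nth[OF s l, of 0 a] s ab(2) Tleg_legpath[OF s l, of a k] by (simp add: legpath_def)
    moreover have "legpath s G (map \<phi> (Tleg s a))" using leg \<open>1 \<le> a \<and> a \<le> k \<and> b = s\<close> by blast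
    ultimately show ?thesis using last by blast
  qed
  show "us ! s = \<phi> (0, 0)" if us: "legpath s G us" "us ! 0 \<in> D i"
  proof -
    have "card (nb G (us ! 0)) = 1" using us(1) by (simp add: legpath_def)
    then obtain vs where vs: "legpath s G vs" "vs ! 0 = us ! 0" "vs ! s = \<phi> (0, 0)" using leaf us(2) by blast
    then show ?thesis
      using legpath_dist[OF G us(1), of "us ! s"] legpath_dist[OF G vs(1), of "us ! s"] by simp
  qed
qed

text \<open>Every vertex but a proper end of the stem has two neighbours inside the branch, and the
  end gains the attaching edge.\<close>

lemma C_branch:
  assumes i: "i < h" and gg: "3 \<le> g" and l: "1 \<le> l"
    and g: "giso \<phi> (C_graph g l) (induce G (D i))" and e: "e i = \<phi> (C_end g l)" and v: "v \<in> D i"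
  shows "card (nb G v) \<noteq> 1"
proof -
  let ?C = "C_graph g l"
  have img: "D i = \<phi> ` pverts ?C" using g by (auto simp: giso_def)
  obtain y where y: "y < g + l - 1" "v = \<phi> y" using v unfolding img C_verts[OF gg l] by blast
  have yV: "y \<in> pverts ?C" unfolding C_verts[OF gg l] using y by simp
  have fin: "finite (nb ?C y)" by (rule finite_nb[OF C_pair[OF gg l]])
  have cd: "card (nb G v) = card (nb ?C y) + (if \<phi> y = e i then 1 else 0)"
    using branch_card_nb[OF i g yV] y(2) by simp
  have two: "2 \<le> card (nb ?C y)" if "a \<in> nb ?C y" "b \<in> nb ?C y" "a \<noteq> b" for a b
  proof -
    have "card {a, b} \<le> card (nb ?C y)" by (rule card_mono[OF fin]) (use that in blast)
    then show ?thesis using that(3) by simp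
  qed
  note nb = C_nb[OF gg l y(1)]
  consider "y = 0" | "0 < y" "Suc y < g + l - 1" | "0 < y" "Suc y = g + l - 1" using y(1) by linarith
  then show ?thesis
  proof cases
    case 1
    have "1 \<in> nb ?C y" "g - 1 \<in> nb ?C y" "1 \<noteq> g - 1" using 1 gg l nb[of 1] nb[of "g - 1"] by auto
    then show ?thesis using two[of 1 "g - 1"] cd by simp
  next
    case 2
    have "y - 1 \<in> nb ?C y" "Suc y \<in> nb ?C y" "y - 1 \<noteq> Suc y" using 2 nb[of "y - 1"] nb[of "Suc y"] by auto
    then show ?thesis using two[of "y - 1" "Suc y"] cd by simp
  next
    case 3
    have "y - 1 \<in> nb ?C y" using 3 nb[of "y - 1"] by auto
    then have "1 \<le> card (nb ?C y)" using fin by (metis One_nat_def Suc_leI card_gt_0_iff empty_iff)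
    moreover have "y = C_end g l" using 3 by (simp add: C_end_def)
    ultimately show ?thesis using cd e by simp
  qed
qed

end

text \<open>If the branch had no eigenvector for \<open>x\<close>, then \<open>Q\<close> without
  \<open>c i\<close> and without the root would test \<open>T\<close>: \<open>f\<close> vanishes at
  \<open>u i\<close>, hence on the whole branch, hence at \<open>c i\<close>. That bounds the
  multiplicity by \<open>q - 2\<close>, against extremality.\<close>

lemma tree_pendant_spectrum:
  assumes L: "legged T s x" and A: "att T h S u a" and tree: "is_tree T"
    and m: "int (graph_mult T x) = int (q s T) - 1" and q3: "3 \<le> q s T"
    and big: "\<And>i. i < h \<Longrightarrow> 3 \<le> card (nb T (u i))"
    and c: "\<And>i. i < h \<Longrightarrow> c i \<in> S i" "\<And>i. i < h \<Longrightarrow> \<exists>us. legpath s T us \<and> us ! s = c i"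
    and un: "\<And>i us. i < h \<Longrightarrow> legpath s T us \<Longrightarrow> us ! 0 \<in> S i \<Longrightarrow> us ! s = c i"
    and deg: "\<And>i. i < h \<Longrightarrow> 2 \<le> card (nb (induce T (pverts T - S i)) (u i))"
    and i: "i < h"
  shows "\<exists>f\<in>eigsp (induce T (S i)) x. f \<noteq> (\<lambda>_. 0)"
proof (rule ccontr)
  assume no: "\<not> ?thesis"
  interpret LT: legged T s x by fact
  interpret A: attached T h S u a by unfold_locales fact
  have cQ: "c i \<in> LT.QQ" using c(2)[OF i] LT.Q_iff by blast
  have out: "v \<notin> S i" if v: "v \<in> LT.QQ" "v \<noteq> c i" for v
  proof -
    obtain us where us: "legpath s T us" "us ! s = v" using v(1) LT.Q_iff by blast
    have "us ! 0 \<in> LT.V" using LT.legpath_in[OF us(1), of 0] by simp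
    then consider "us ! 0 \<in> A.R" | j where "j < h" "us ! 0 \<in> S j" by blast
    then show ?thesis
    proof cases
      case 1
      have "us ! s \<in> A.R" using A.leg_in_R[OF _ us(1) 1, of s] big by blast
      then show ?thesis using us(2) i by blast
    next
      case 2
      then have vj: "v = c j" using un us by metis
      then have "j \<noteq> i" using v(2) by blast
      then show ?thesis using A.D_disj[OF 2(1) i, of v] c(1)[OF 2(1)] vj by blast
    qed
  qed
  have "card (LT.QQ - {c i}) = card LT.QQ - 1" using cQ LT.finite_Q by simp
  then have "2 \<le> card (LT.QQ - {c i})" using q3 by (simp add: q_def)
  \<comment> \<open>Three vertices of \<open>Q\<close> allow a root \<open>r\<close> different from
    both \<open>c i\<close> and \<open>u i\<close>, so that \<open>u i\<close> has a parent and, if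
    it lies in \<open>Q\<close>, remains a test vertex.\<close>
  then have "\<not> LT.QQ - {c i} \<subseteq> {u i}" using card_mono[of "{u i}" "LT.QQ - {c i}"] by auto
  then obtain r where r: "r \<in> LT.QQ" "r \<noteq> c i" "r \<noteq> u i" by blast
  have rS: "r \<notin> S i" by (rule out[OF r(1,2)])
  obtain p d where t: "rtree T r p d" using rtree_exists[OF LT.G LT.c] r(1) LT.Q_sub by blast
  interpret R: rooted_legged T s x r p d by unfold_locales (use t r in auto)
  have N: "R.N = {}"
  proof (rule ccontr)
    assume "R.N \<noteq> {}"
    then obtain y z where "(y, z) \<in> R.N" by auto
    then show False using ntarcs_cycle[OF LT.G t] tree unfolding is_tree_def by blast
  qed
  \<comment> \<open>Climbing from a vertex of the branch to \<open>y\<close> outside it crosses the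
    edge between \<open>a i\<close> and \<open>u i\<close>, the only one that leaves the
    branch.\<close>
  have up: "v \<in> R.ds y \<Longrightarrow> v \<in> S i \<Longrightarrow> y \<notin> S i \<Longrightarrow> u i \<in> R.ds y \<and> p (a i) = u i" for v y
  proof (induction rule: dsc.induct)
    case (dsc_step v)
    show ?case
    proof (cases "p v \<in> S i")
      case False
      have "p v \<in> nb T v" using R.t_parent_nb dsc_step by blast
      then have "v = a i \<and> p v = u i" using A.enter[OF i, of v "p v"] dsc_step.prems False by blast
      then show ?thesis using dsc_step by auto
    qed (use dsc_step in blast)
  qed blast
  have ci: "c i \<in> S i" by (rule c(1)[OF i])
  have "c i \<in> LT.V" using ci A.D_V[OF i] by blast
  then have pa: "p (a i) = u i" using up[OF dsc_root[OF LT.G t] ci rS] by blast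
  have aV: "a i \<in> LT.V" "a i \<noteq> r" using A.e_D[OF i] A.D_V[OF i] rS by auto
  have uV: "u i \<in> LT.V" "u i \<notin> S i" using A.w_R[OF i] i by auto
  have pu: "p (u i) \<notin> S i"
  proof
    assume pS: "p (u i) \<in> S i"
    have "u i \<in> nb T (p (u i))" using R.t_parent_nb[OF uV(1) r(3)[symmetric]] LT.nb_symm by blast
    then have "p (u i) = a i" using A.enter[OF i pS] uV(2) by blast
    then have "d (p (u i)) = d (a i)" by simp
    moreover have "d (a i) = Suc (d (u i))" using R.d_parent[OF aV] unfolding pa .
    moreover have "d (u i) = Suc (d (p (u i)))" using R.d_parent[OF uV(1) r(3)[symmetric]] .
    ultimately show False by linarith
  qed
  have le: "graph_mult T x \<le> card (LT.QQ - {c i} - {r})"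
  proof (rule graph_mult_le_card[OF LT.G])
    fix f assume f: "f \<in> eigsp T x" "\<And>w. w \<in> LT.QQ - {c i} - {r} \<Longrightarrow> f w = 0"
    \<comment> \<open>Either \<open>u i\<close> is tested as a vertex of \<open>Q\<close>, or it has
      a nonleg child outside the branch, whose subtree avoids \<open>c i\<close> and therefore
      vanishes.\<close>
    have fu: "f (u i) = 0"
    proof (cases "u i \<in> LT.QQ")
      case True
      have "u i \<noteq> c i" using ci uV(2) by metis
      then have "u i \<in> LT.QQ - {c i} - {r}" using True r(3) by auto
      then show ?thesis by (rule f(2))
    next
      case False
      have uL: "u i \<notin> LT.L" using big[OF i] LT.deg_L[of "u i"] by force
      have "u i \<in> LT.V - S i" using uV by blast
      then have "2 \<le> card (nb T (u i) \<inter> (LT.V - S i))" using deg[OF i] by (simp add: nb_induce)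
      then have "\<not> nb T (u i) \<inter> (LT.V - S i) \<subseteq> {p (u i)}"
        using card_mono[of "{p (u i)}" "nb T (u i) \<inter> (LT.V - S i)"] by auto
      then obtain w where w: "w \<in> nb T (u i)" "w \<notin> S i" "w \<noteq> p (u i)" by blast
      then have wc: "w \<in> LT.V" "w \<noteq> r" "p w = u i" using R.t_nb[OF uV(1)] N by (auto split: if_splits)
      have wL: "w \<notin> LT.L" using R.L_child_Q[OF wc(1,2)] uL False wc(3) by auto
      have nu: "u i \<notin> R.ds w" using parent_notin_dsc[OF LT.G t wc(1,2)] wc(3) by simp
      have "f w = 0 \<and> f (p w) = 0"
      proof (rule R.zero_upward[OF f(1), of "R.ds w - LT.L"])
        show "R.ds w - LT.L \<subseteq> LT.V - LT.L - {r}" using R.t_dsc_in R.r_notin_dsc[OF wc(2)] by blast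
        show "v \<in> R.ds w - LT.L" if "w' \<in> R.ds w - LT.L" "v \<in> LT.V" "v \<noteq> r" "v \<notin> LT.L" "p v = w'" for w' v
          using that by (auto intro: dsc_step)
        show "f w' = 0" if w': "w' \<in> R.ds w - LT.L" "w' \<in> LT.QQ" for w'
        proof -
          have "w' \<noteq> c i" using up[of "c i" w] ci w(2) nu w'(1) by blast
          moreover have "w' \<noteq> r" using w' R.r_notin_dsc[OF wc(2)] by blast
          ultimately show ?thesis using f(2)[of w'] w'(2) by blast
        qed
        show "w \<in> R.ds w - LT.L" using wc wL by (auto intro: dsc_base)
      qed (use N in blast)
      then show ?thesis using wc(3) by simp
    qed
    have "(\<lambda>v. if v \<in> S i then f v else 0) \<in> eigsp (induce T (S i)) x"
    proof (rule eigsp_restrict[OF LT.G A.D_V[OF i] f(1)])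
      fix v y assume "v \<in> S i" "y \<in> nb T v" "y \<notin> S i"
      then have "y = u i" using A.enter[OF i] by blast
      then show "f y = 0" using fu by simp
    qed
    then have "(\<lambda>v. if v \<in> S i then f v else 0) = (\<lambda>_. 0)" using no by blast
    then have "(if c i \<in> S i then f (c i) else 0) = 0" by (rule fun_cong)
    then have fc: "f (c i) = 0" using ci by simp
    have "c i \<in> LT.V" "c i \<notin> LT.L" using cQ LT.Q_sub LT.Q_L_disjoint by blast+
    then show "f = (\<lambda>_. 0)"
    proof (rule R.zero_everywhere[OF f(1) _ _ r(2)[symmetric]])
      show "f w = 0" if "w \<in> fst ` R.N" for w using that N by simp
      show "f w = 0" if "w \<in> LT.QQ" "w \<noteq> r" for w using f(2)[of w] that fc by blast
    qed
  qed (use LT.finite_Q in simp)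
  have "card (LT.QQ - {c i} - {r}) + 2 = card LT.QQ"
    using cQ r LT.finite_Q card_Suc_Diff1[of "LT.QQ - {c i}" r] card_Suc_Diff1[of LT.QQ "c i"] by simp
  then show False using le m by (simp add: q_def)
qed

section \<open>The two implications\<close>

text \<open>\<open>2 c\<close> counts the nontree arcs of a spanning tree, and a connected graph
  without nontree arcs is a tree.\<close>

lemma cyclomatic_nonneg:
  assumes G: "pair_graph G" and c: "Digraph_Component.connected (with_proj G)"
  shows "0 \<le> cyclomatic G" and "\<not> is_tree G \<Longrightarrow> 1 \<le> cyclomatic G"
proof -
  obtain r where "r \<in> pverts G" using c connected_iff[OF G] by blast
  then obtain p d where t: "rtree G r p d" using rtree_exists[OF G c] by blast
  note cn = card_ntarcs[OF G t]
  show "0 \<le> cyclomatic G" using cn by linarith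
  show "1 \<le> cyclomatic G" if nt: "\<not> is_tree G"
  proof -
    have "ntarcs G r p \<noteq> {}"
      using no_ntarcs_no_cycle[OF G t] nt G c unfolding is_tree_def by blast
    moreover have "finite (ntarcs G r p)"
      by (rule finite_subset[OF _ pair_graph_simps(2)[OF G]]) (auto simp: ntarcs_def)
    ultimately have "0 < card (ntarcs G r p)" by (simp add: card_gt_0_iff)
    then show ?thesis using cn by linarith
  qed
qed

text \<open>The exchange gives \<open>m_G = m_T + c\<close> and \<open>q(T) = q(G) + c\<close>; with
  \<open>m_T = q(T) - 1\<close> this is the claim. The work lies in checking that each tree branch
  has \<open>x\<close> as an eigenvalue.\<close>

lemma base_tree_backward:
  fixes G :: "'a pair_pre_digraph" and T :: "'b pair_pre_digraph"
  assumes s: "1 \<le> s" and x: "x \<notin> graph_spectrum (path_graph s)" and GGs: "G \<in> GG s"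
    and nt: "\<not> is_tree G" and cq: "3 \<le> cyclomatic G + int (q s G)"
    and BB: "G \<in> BB s x T (nat (cyclomatic G))"
  shows "int (graph_mult G x) = 2 * cyclomatic G + int (q s G) - 1"
proof -
  define h where "h = nat (cyclomatic G)"
  have G: "pair_graph G" and Gc: "Digraph_Component.connected (with_proj G)" using GGs by (auto simp: GG_def)
  have h: "int h = cyclomatic G" "1 \<le> h" using cyclomatic_nonneg(2)[OF G Gc nt] by (auto simp: h_def)
  have bt: "base_tree s x T" using BB by (simp add: BB_def)
  have ex: "\<exists>S u D w f. disjoint_family_on S {..<h} \<and> disjoint_family_on D {..<h} \<and>
    (\<forall>i<h. u i \<in> pverts T - (\<Union>j<h. S j) \<and> w i \<in> pverts G - (\<Union>j<h. D j)) \<and>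
    (\<forall>i<h. \<exists>k l. pendant_T s k l T (S i) (u i)) \<and>
    (\<forall>i<h. \<exists>g l. pendant_C g l G (D i) (w i) \<and> graph_mult (C_graph g l) x = 2) \<and>
    (iso_via f (induce T (pverts T - (\<Union>j<h. S j))) (induce G (pverts G - (\<Union>j<h. D j)))) \<and>
    (\<forall>i<h. iso_verts f (u i) = w i)"
    using BB unfolding BB_def mem_Collect_eq h_def[symmetric] by (elim conjE)
  obtain S u D w f where
    dS: "disjoint_family_on S {..<h}" and dD: "disjoint_family_on D {..<h}"
    and uw: "\<forall>i<h. u i \<in> pverts T - (\<Union>j<h. S j) \<and> w i \<in> pverts G - (\<Union>j<h. D j)"
    and pT: "\<forall>i<h. \<exists>k l. pendant_T s k l T (S i) (u i)"
    and pC: "\<forall>i<h. \<exists>g l. pendant_C g l G (D i) (w i) \<and> graph_mult (C_graph g l) x = 2"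
    and f: "iso_via f (induce T (pverts T - (\<Union>j<h. S j))) (induce G (pverts G - (\<Union>j<h. D j)))"
    and fu: "\<forall>i<h. iso_verts f (u i) = w i"
    using ex by (elim exE conjE) (rule that)
  have "\<forall>i. \<exists>k l. i < h \<longrightarrow> pendant_T s k l T (S i) (u i)" using pT by blast
  then obtain k l where kl: "\<And>i. i < h \<Longrightarrow> pendant_T s (k i) (l i) T (S i) (u i)" by metis
  have "\<forall>i. \<exists>g m. i < h \<longrightarrow> pendant_C g m G (D i) (w i) \<and> graph_mult (C_graph g m) x = 2" using pC by blast
  then obtain g m where gm: "\<And>i. i < h \<Longrightarrow> pendant_C (g i) (m i) G (D i) (w i) \<and> graph_mult (C_graph (g i) (m i)) x = 2" by metis
  have k1: "1 \<le> k i" "1 \<le> l i" "pendant_at T (S i) (u i) (T_graph s (k i) (l i)) (T_end (l i))" if "i < h" for i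
    using kl[OF that] by (auto simp: pendant_T_def)
  have g3: "3 \<le> g i" "1 \<le> m i" "pendant_at G (D i) (w i) (C_graph (g i) (m i)) (C_end (g i) (m i))"
    "graph_mult (C_graph (g i) (m i)) x = 2" if "i < h" for i
    using gm[OF that] by (auto simp: pendant_C_def)
  have T: "pair_graph T" "Digraph_Component.connected (with_proj T)" "is_tree T" "T \<in> GG s"
    "int (graph_mult T x) = int (q s T) - 1"
    using bt by (auto simp: base_tree_def is_tree_def)
  have endT: "T_end (l i) \<in> pverts (T_graph s (k i) (l i))" if "i < h" for i
    unfolding T_verts[OF s k1(2)[OF that]] T_end_def using k1(2)[OF that] by simp
  have endC: "C_end (g i) (m i) \<in> pverts (C_graph (g i) (m i))" if "i < h" for i
    unfolding C_verts[OF g3(1,2)[OF that]] C_end_def using g3(1,2)[OF that] by simp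
  obtain \<phi> where \<phi>: "att T h S u (\<lambda>i. \<phi> i (T_end (l i)))"
    "\<And>i. i < h \<Longrightarrow> giso (\<phi> i) (T_graph s (k i) (l i)) (induce T (S i)) \<and> 2 \<le> card (nb (induce T (pverts T - S i)) (u i))"
    using att_pendants[OF T(1) dS, of u "\<lambda>i. T_graph s (k i) (l i)" "\<lambda>i. T_end (l i)"] uw k1(3) endT by blast
  obtain \<psi> where \<psi>: "att G h D w (\<lambda>i. \<psi> i (C_end (g i) (m i)))"
    "\<And>i. i < h \<Longrightarrow> giso (\<psi> i) (C_graph (g i) (m i)) (induce G (D i)) \<and> 2 \<le> card (nb (induce G (pverts G - D i)) (w i))"
    using att_pendants[OF G dD, of w "\<lambda>i. C_graph (g i) (m i)" "\<lambda>i. C_end (g i) (m i)"] uw g3(3) endC by blast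
  interpret TG: two_attached T G h S u "\<lambda>i. \<phi> i (T_end (l i))" D w "\<lambda>i. \<psi> i (C_end (g i) (m i))" "iso_verts f"
    by unfold_locales (use \<phi>(1) \<psi>(1) iso_via_giso[OF f] fu in auto)
  have bigT: "3 \<le> card (nb T (u i))" if "i < h" for i using TG.T.card_nb_w[OF that] \<phi>(2)[OF that] by linarith
  have bigG: "3 \<le> card (nb G (w i))" if "i < h" for i using TG.G.card_nb_w[OF that] \<psi>(2)[OF that] by linarith
  have h0: "0 < h" using h(2) by simp
  have u0: "u 0 \<in> pverts T" "w 0 \<in> pverts G" using uw h0 by auto
  have LT: "legged T s x" by (rule legged.intro[OF T(1,2,4) s x]) (use u0(1) bigT[OF h0] in blast)
  have LG: "legged G s x" by (rule legged.intro[OF G Gc GGs s x]) (use u0(2) bigG[OF h0] in blast)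
  have gi: "giso (\<phi> i) (T_graph s (k i) (l i)) (induce T (S i))" if "i < h" for i using \<phi>(2)[OF that] by blast
  note TB = TG.T.T_branch[OF _ s k1(1,2) gi refl]
  have qT: "q s T = q s G + h"
  proof (rule TG.q_transfer[OF LT LG bigT, where c = "\<lambda>i. \<phi> i (0, 0)"])
    show "card (nb G v) \<noteq> 1" if "i < h" "v \<in> D i" for i v
      using TG.G.C_branch[OF that(1) g3(1,2)[OF that(1)] conjunct1[OF \<psi>(2)[OF that(1)]] refl that(2)] .
    show "\<phi> i (0, 0) \<in> S i" if "i < h" for i using TB(3)[of i] that by blast
    show "\<exists>us. legpath s T us \<and> us ! s = \<phi> i (0, 0)" if "i < h" for i using TB(1)[of i] that by blast
    show "us ! s = \<phi> i (0, 0)" if "i < h" "legpath s T us" "us ! 0 \<in> S i" for i us using TB(2)[of i] that by blast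
  qed
  have q3: "3 \<le> q s T" using qT cq h(1) by linarith
  have spec: "x \<in> graph_spectrum (T_graph s (k i) (l i))" if i: "i < h" for i
  proof -
    have "\<exists>f\<in>eigsp (induce T (S i)) x. f \<noteq> (\<lambda>_. 0)"
    proof (rule tree_pendant_spectrum[OF LT \<phi>(1) T(3,5) q3 bigT, where c = "\<lambda>i. \<phi> i (0, 0)"])
      show "\<phi> i (0, 0) \<in> S i" if "i < h" for i using TB(3)[of i] that by blast
      show "\<exists>us. legpath s T us \<and> us ! s = \<phi> i (0, 0)" if "i < h" for i using TB(1)[of i] that by blast
      show "us ! s = \<phi> i (0, 0)" if "i < h" "legpath s T us" "us ! 0 \<in> S i" for i us using TB(2)[of i] that by blast
    qed (use \<phi>(2) i in blast)+
    then obtain z v where z: "z \<in> eigsp (induce T (S i)) x" "z v \<noteq> 0" by (auto simp: fun_eq_iff)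
    have "v \<in> S i" using z by (auto simp: eigsp_def)
    then obtain y where y: "y \<in> pverts (T_graph s (k i) (l i))" "v = \<phi> i y" using gi[OF i] by (auto simp: giso_def)
    define z' where "z' = (\<lambda>v. if v \<in> pverts (T_graph s (k i) (l i)) then z (\<phi> i v) else 0)"
    have "z' \<in> eigsp (T_graph s (k i) (l i)) x" unfolding z'_def by (rule giso_eigsp[OF gi[OF i] z(1)])
    moreover have "z' y \<noteq> 0" using z(2) y by (simp add: z'_def)
    then have "z' \<noteq> (\<lambda>_. 0)" by auto
    ultimately show ?thesis using graph_spectrum_iff[OF T_pair[OF s k1(2)[OF i]]] by blast
  qed
  have "graph_mult G x = graph_mult T x + h"
  proof (rule TG.mult_transfer)
    show "Ttype (induce T (S i)) (\<phi> i (T_end (l i))) x" if i: "i < h" for i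
      by (rule Ttype_giso[OF gi[OF i] T_pair[OF s k1(2)[OF i]] endT[OF i] T_Ttype[OF s k1(2)[OF i] x spec[OF i]]])
    show "Ctype (induce G (D i)) (\<psi> i (C_end (g i) (m i))) x" if i: "i < h" for i
      by (rule Ctype_giso[OF conjunct1[OF \<psi>(2)[OF i]] C_pair[OF g3(1,2)[OF i]] endC[OF i] C_mult_2(1)[OF g3(1,2,4)[OF i]]])
  qed
  then show ?thesis using T(5) qT h(1) by linarith
qed

section \<open>The pendant cycle as a copy of \<open>C_graph\<close>\<close>

context back_arc
begin

lemma only_b:
  assumes "i < t" "z \<in> ds (P i)" "z \<notin> L" "\<And>w. w \<in> V \<Longrightarrow> w \<noteq> r \<Longrightarrow> p w \<noteq> z"
  shows "z = b"
proof -
  obtain j where j: "j \<le> i" "z = P j" using dsc_chain_P[OF _ assms(2,3)] sc_t assms(1) by fastforce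
  show ?thesis
  proof (cases j)
    case (Suc k)
    have kd: "k < d b" using j(1) Suc assms(1) t_facts(2) by linarith
    then have "P k \<in> V" "P k \<noteq> r" "p (P k) = z" using chain[of k] P_r[of k] j Suc by simp_all
    then show ?thesis using assms(4) by blast
  qed (use j in simp)
qed

lemma chain_distinct_children:
  assumes i: "i < t" and w: "w \<in> V" "w \<noteq> r" "w \<notin> L" "p w = P i" and w': "w' \<in> V" "w' \<noteq> r" "w' \<notin> L" "p w' = P i"
  shows "w = w'"
proof (cases "i = 0")
  case True
  then show ?thesis using b_childless w by simp
next
  case False
  then show ?thesis using sc_t[of i] i w w' by (metis One_nat_def Suc_leI neq0_conv)
qed

text \<open>The cycle \<open>P 0\<close>, ..., \<open>P n\<close> has length \<open>n + 1\<close>,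
  and the stem \<open>P n\<close>, ..., \<open>P (t - 1)\<close> has \<open>t - n\<close> vertices,
  the first of which it shares with the cycle.\<close>

lemma D_giso: "giso (\<lambda>i. P i) (C_graph (Suc n) (t - n)) (induce G D)"
proof -
  have n3: "3 \<le> Suc n" "1 \<le> t - n" using n(2) n_less_t by auto
  let ?C = "C_graph (Suc n) (t - n)"
  have sz: "Suc n + (t - n) - 1 = t" using n_less_t by simp
  have Cv: "pverts ?C = {..<t}" unfolding C_verts[OF n3] sz ..
  have inj: "inj_on (\<lambda>i. P i) {..<t}"
    by (rule inj_onI) (use P_inj t_facts(2) in \<open>meson le_trans less_imp_le lessThan_iff\<close>)
  have adj: "(P i, P j) \<in> parcs G \<longleftrightarrow> (i, j) \<in> parcs ?C" if ij: "i < t" "j < t" for i j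
  proof -
    have eq: "P j = P m \<longleftrightarrow> j = m" if "m \<le> t" for m
      using P_inj[of j m] ij t_facts(2) that by auto
    have "(P i, P j) \<in> parcs G \<longleftrightarrow> P j \<in> nb G (P i)" by (simp add: nb_def)
    also have "\<dots> \<longleftrightarrow> P j = P (Suc i) \<or> (if i = 0 then P j = P n else P j = P (i - 1)) \<or> (i = n \<and> P j = P 0)"
      unfolding nb_chain[OF ij(1)] n(1) by auto
    also have "\<dots> \<longleftrightarrow> j = Suc i \<or> (if i = 0 then j = n else j = i - 1) \<or> (i = n \<and> j = 0)"
      using eq[of "Suc i"] eq[of n] eq[of "i - 1"] eq[of 0] ij n_less_t by simp
    also have "\<dots> \<longleftrightarrow> j \<in> nb ?C i"
      unfolding C_nb[OF n3, unfolded sz, OF ij(1)] using ij by auto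
    also have "\<dots> \<longleftrightarrow> (i, j) \<in> parcs ?C" by (simp add: nb_def)
    finally show ?thesis .
  qed
  have sub: "parcs ?C \<subseteq> {..<t} \<times> {..<t}" using pair_graph_simps(4,5)[OF C_pair[OF n3]] Cv by auto
  have "parcs (induce G D) = map_prod (\<lambda>i. P i) (\<lambda>i. P i) ` parcs ?C"
  proof (intro equalityI subsetI)
    fix e assume e: "e \<in> parcs (induce G D)"
    then obtain i j where ij: "i < t" "j < t" "e = (P i, P j)" "(P i, P j) \<in> parcs G"
      by (auto simp: induce_def)
    then have "(i, j) \<in> parcs ?C" using adj by blast
    then show "e \<in> map_prod (\<lambda>i. P i) (\<lambda>i. P i) ` parcs ?C" using ij(3) by force
  next
    fix e assume "e \<in> map_prod (\<lambda>i. P i) (\<lambda>i. P i) ` parcs ?C"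
    then obtain i j where ij: "(i, j) \<in> parcs ?C" "e = (P i, P j)" by auto
    then have "i < t" "j < t" using sub by auto
    then show "e \<in> parcs (induce G D)" using adj[of i j] ij by (auto simp: induce_def)
  qed
  then show ?thesis unfolding giso_def Cv using inj sub by simp
qed

lemma D_cut: "parcs G \<inter> (V - D) \<times> D = {(P t, P (t - 1))}"
proof -
  have t0: "t - 1 < t" "Suc (t - 1) = t" using n_less_t by auto
  have "P t \<in> nb G (P (t - 1))" using nb_chain[OF t0(1)] unfolding t0(2) by blast
  then have "(P t, P (t - 1)) \<in> parcs G" using nb_symm[of "P t" "P (t - 1)"] by (simp add: nb_def)
  moreover have "P t \<in> V" using chain[OF t_facts(2)] by blast
  moreover have "P (t - 1) \<in> D" using t0 by blast
  ultimately have 1: "(P t, P (t - 1)) \<in> parcs G \<inter> (V - D) \<times> D" using D_sub(5) by blast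
  have "e = (P t, P (t - 1))" if eD: "e \<in> parcs G \<inter> (V - D) \<times> D" for e
  proof -
    obtain y z where e: "e = (y, z)" "(y, z) \<in> parcs G" "y \<notin> D" "z \<in> D" using eD by (cases e) blast
    then have "y \<in> nb G z" using nb_symm[of z y] by (simp add: nb_def)
    then show ?thesis using nb_D[OF e(4)] e by blast
  qed
  then show ?thesis using 1 by blast
qed

text \<open>What is known about one pendant cycle, with \<open>n\<close> and \<open>t\<close> bound
  so that they can be chosen for all back arcs at once. The clauses on children separate the
  branches: from any vertex of a branch the only childless nonleg vertex below is \<open>b\<close>,
  and it has at most one nonleg child, whereas \<open>P t\<close> has two.\<close>

lemma pendant_summary:
  "\<exists>n t. 3 \<le> Suc n \<and> n < t \<and> giso (\<lambda>i. P i) (C_graph (Suc n) (t - n)) (induce G (P ` {..<t})) \<and>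
     P ` {..<t} \<subseteq> V - L \<and> r \<notin> P ` {..<t} \<and> P t \<in> V - P ` {..<t} \<and> b \<in> P ` {..<t} \<and> v \<in> P ` {..<t} \<and>
     parcs G \<inter> (V - P ` {..<t}) \<times> P ` {..<t} = {(P t, P (t - 1))} \<and> p (P (t - 1)) = P t \<and>
     3 \<le> card (nb G (P t)) \<and> 2 \<le> graph_mult (induce G (P ` {..<t})) x \<and>
     (\<forall>y \<in> P ` {..<t}. b \<in> ds y \<and> (\<forall>z\<in>ds y. z \<notin> L \<longrightarrow> (\<forall>w\<in>V. w \<noteq> r \<longrightarrow> p w \<noteq> z) \<longrightarrow> z = b) \<and>
        (\<forall>w\<in>V. \<forall>w'\<in>V. w \<noteq> r \<longrightarrow> w \<notin> L \<longrightarrow> p w = y \<longrightarrow> w' \<noteq> r \<longrightarrow> w' \<notin> L \<longrightarrow> p w' = y \<longrightarrow> w = w')) \<and>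
     (\<exists>w\<in>V. \<exists>w'\<in>V. w \<noteq> r \<and> w \<notin> L \<and> p w = P t \<and> w' \<noteq> r \<and> w' \<notin> L \<and> p w' = P t \<and> w \<noteq> w')"
proof -
  have t0: "t - 1 < t" "Suc (t - 1) = t" "0 < t" using n_less_t by auto
  have 1: "3 \<le> Suc n" "n < t" using n(2) n_less_t by auto
  have 2: "D \<subseteq> V - L" "r \<notin> D" using D_sub by blast+
  have 3: "P t \<in> V - D" using D_sub(5) chain[OF t_facts(2)] by blast
  have 4: "b \<in> D" using imageI[of 0 "{..<t}" "\<lambda>i. P i"] t0 by simp
  have 5: "v \<in> D" using imageI[of n "{..<t}" "\<lambda>i. P i"] n_less_t n(1) by simp
  have 6: "p (P (t - 1)) = P t" using p_P[of "t - 1"] unfolding t0(2) .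
  have t1: "t - 1 < d b" using t0 t_facts(2) by linarith
  obtain w where w: "w \<in> V" "w \<noteq> r" "w \<notin> L" "p w = P t" "w \<noteq> P (t - 1)" using other_child by blast
  have w': "P (t - 1) \<in> V" "P (t - 1) \<noteq> r" "P (t - 1) \<notin> L" using chain[of "t - 1"] P_r[OF t1] t1 by simp_all
  have 7: "\<exists>w\<in>V. \<exists>w'\<in>V. w \<noteq> r \<and> w \<notin> L \<and> p w = P t \<and> w' \<noteq> r \<and> w' \<notin> L \<and> p w' = P t \<and> w \<noteq> w'"
    using w w' 6 by blast
  have 8: "\<forall>y\<in>D. b \<in> ds y \<and> (\<forall>z\<in>ds y. z \<notin> L \<longrightarrow> (\<forall>w\<in>V. w \<noteq> r \<longrightarrow> p w \<noteq> z) \<longrightarrow> z = b) \<and>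
        (\<forall>w\<in>V. \<forall>w'\<in>V. w \<noteq> r \<longrightarrow> w \<notin> L \<longrightarrow> p w = y \<longrightarrow> w' \<noteq> r \<longrightarrow> w' \<notin> L \<longrightarrow> p w' = y \<longrightarrow> w = w')"
    (is "\<forall>y\<in>D. ?B y")
  proof
    fix y assume yD: "y \<in> D"
    obtain i where i: "i < t" "y = P i" using yD by blast
    have "b \<in> ds y" using chain[of i] i t_facts(2) by simp
    moreover have "\<forall>z\<in>ds y. z \<notin> L \<longrightarrow> (\<forall>w\<in>V. w \<noteq> r \<longrightarrow> p w \<noteq> z) \<longrightarrow> z = b"
      using only_b[OF i(1)] i(2) by blast
    moreover have "\<forall>w\<in>V. \<forall>w'\<in>V. w \<noteq> r \<longrightarrow> w \<notin> L \<longrightarrow> p w = y \<longrightarrow> w' \<noteq> r \<longrightarrow> w' \<notin> L \<longrightarrow> p w' = y \<longrightarrow> w = w'"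
      by (intro ballI impI, rule chain_distinct_children[OF i(1)]) (simp_all add: i(2))
    ultimately show "?B y" by (intro conjI)
  qed
  show ?thesis
    by (rule exI[of _ n], rule exI[of _ t], intro conjI)
      (rule 1 2 3 4 5 6 7 8 D_giso D_cut card_nb_t(2) mult_D)+
qed

end

section \<open>Construction of a tree with given branches\<close>

lemma rtree_giso:
  assumes g: "giso \<phi> F H" and F: "pair_graph F" and t: "rtree F r p d" and N: "ntarcs F r p = {}"
  shows "\<exists>p' d'. rtree H (\<phi> r) p' d' \<and> ntarcs H (\<phi> r) p' = {}"
proof -
  define \<psi> where "\<psi> = inv_into (pverts F) \<phi>"
  have inj: "inj_on \<phi> (pverts F)" and V: "pverts H = \<phi> ` pverts F"
    and A: "parcs H = map_prod \<phi> \<phi> ` parcs F" using g by (auto simp: giso_def)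
  have \<psi>: "\<psi> (\<phi> v) = v" if "v \<in> pverts F" for v unfolding \<psi>_def by (rule inv_into_f_f[OF inj that])
  note rV = rtreeD(1)[OF t]
  have "rtree H (\<phi> r) (\<lambda>v. \<phi> (p (\<psi> v))) (\<lambda>v. d (\<psi> v))"
    unfolding rtree_def
  proof (intro conjI ballI)
    show "\<phi> r \<in> pverts H" using rV V by blast
    show "d (\<psi> (\<phi> r)) = 0" unfolding \<psi>[OF rV] by (rule rtreeD(2)[OF t])
    fix v assume "v \<in> pverts H - {\<phi> r}"
    then obtain y where y: "y \<in> pverts F" "v = \<phi> y" "y \<noteq> r" using V by blast
    note py = rtree_p[OF F t y(1,3)]
    show "(v, \<phi> (p (\<psi> v))) \<in> parcs H" unfolding y(2) \<psi>[OF y(1)] A using py by force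
    show "d (\<psi> v) = Suc (d (\<psi> (\<phi> (p (\<psi> v)))))"
      unfolding y(2) \<psi>[OF y(1)] \<psi>[OF conjunct1[OF conjunct2[OF py]]] using py by blast
  qed
  moreover have "ntarcs H (\<phi> r) (\<lambda>v. \<phi> (p (\<psi> v))) = {}"
  proof -
    have "e \<notin> ntarcs H (\<phi> r) (\<lambda>v. \<phi> (p (\<psi> v)))" for e
    proof
      assume "e \<in> ntarcs H (\<phi> r) (\<lambda>v. \<phi> (p (\<psi> v)))"
      then obtain v w where e: "e = (v, w)" "(v, w) \<in> parcs H"
        "\<not> (v \<noteq> \<phi> r \<and> w = \<phi> (p (\<psi> v)))" "\<not> (w \<noteq> \<phi> r \<and> v = \<phi> (p (\<psi> w)))" by (auto simp: ntarcs_def)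
      obtain a b where ab: "(a, b) \<in> parcs F" "v = \<phi> a" "w = \<phi> b" using e(2) A by auto
      note abV = pair_graph_simps(4,5)[OF F ab(1)]
      have "a \<noteq> r \<and> b = p a \<or> b \<noteq> r \<and> a = p b" using ab(1) N by (auto simp: ntarcs_def)
      moreover have "\<phi> a \<noteq> \<phi> r" if "a \<noteq> r" using inj_on_eq_iff[OF inj abV(1) rV] that by simp
      moreover have "\<phi> b \<noteq> \<phi> r" if "b \<noteq> r" using inj_on_eq_iff[OF inj abV(2) rV] that by simp
      ultimately show False using e(3,4) unfolding ab(2,3) \<psi>[OF abV(1)] \<psi>[OF abV(2)] by blast
    qed
    then show ?thesis by blast
  qed
  ultimately show ?thesis by blast
qed

text \<open>The tree of each branch is rooted at its end \<open>e i\<close> and hung below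
  \<open>w i\<close>. A spanning tree without nontree arcs serves as the certificate that a graph is
  a tree.\<close>

lemma (in attached) glue_tree:
  assumes t: "rtree (induce G R) r p d" and N: "ntarcs (induce G R) r p = {}"
    and DT: "\<And>i. i < h \<Longrightarrow> \<exists>p' d'. rtree (induce G (D i)) (e i) p' d' \<and> ntarcs (induce G (D i)) (e i) p' = {}"
  shows "\<exists>p d. rtree G r p d \<and> ntarcs G r p = {}"
proof -
  have "\<forall>i. \<exists>p' d'. i < h \<longrightarrow> rtree (induce G (D i)) (e i) p' d' \<and> ntarcs (induce G (D i)) (e i) p' = {}"
    using DT by blast
  then obtain pD dD where pD: "\<And>i. i < h \<Longrightarrow> rtree (induce G (D i)) (e i) (pD i) (dD i)"
    "\<And>i. i < h \<Longrightarrow> ntarcs (induce G (D i)) (e i) (pD i) = {}" by metis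
  define ix where "ix v = (THE i. i < h \<and> v \<in> D i)" for v
  have ix: "ix v = i" if "i < h" "v \<in> D i" for v i
    unfolding ix_def using that D_disj by (intro the_equality) blast+
  define p' where "p' v = (if v \<in> R then p v else if v = e (ix v) then w (ix v) else pD (ix v) v)" for v
  \<comment> \<open>The successor accounts for the edge from \<open>e i\<close> up to
    \<open>w i\<close>.\<close>
  define d' where "d' v = (if v \<in> R then d v else Suc (d (w (ix v)) + dD (ix v) v))" for v
  have rR: "r \<in> R" using rtreeD(1)[OF t] by simp
  have pR: "p' v = p v" "d' v = d v" if "v \<in> R" for v using that by (simp_all add: p'_def d'_def)
  have DR: "v \<notin> R" if "i < h" "v \<in> D i" for i v using that by blast
  have pD': "p' v = (if v = e i then w i else pD i v)" "d' v = Suc (d (w i) + dD i v)" if "i < h" "v \<in> D i" for i v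
    unfolding p'_def d'_def if_not_P[OF DR[OF that]] ix[OF that] by (rule refl)+
  have cases: "v \<in> R \<or> (\<exists>i<h. v \<in> D i)" if "v \<in> V" for v using that by blast
  have "rtree G r p' d'"
    unfolding rtree_def
  proof (intro conjI ballI)
    show "r \<in> V" using rR by blast
    show "d' r = 0" unfolding pR(2)[OF rR] by (rule rtreeD(2)[OF t])
    fix v assume v: "v \<in> V - {r}"
    show "(v, p' v) \<in> parcs G"
    proof (cases "v \<in> R")
      case True
      have "(v, p v) \<in> parcs (induce G R)" using rtreeD(3)[OF t, of v] True v by simp
      then show ?thesis unfolding pR(1)[OF True] by (simp add: induce_def)
    next
      case False
      then obtain i where i: "i < h" "v \<in> D i" using cases v by blast
      show ?thesis
      proof (cases "v = e i")
        case True
        then show ?thesis using we[OF i(1)] pD'(1)[OF i] by (simp add: nb_def)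
      next
        case ne: False
        have "(v, pD i v) \<in> parcs (induce G (D i))" using rtreeD(3)[OF pD(1)[OF i(1)], of v] i ne by simp
        then show ?thesis using pD'(1)[OF i] ne by (simp add: induce_def)
      qed
    qed
    show "d' v = Suc (d' (p' v))"
    proof (cases "v \<in> R")
      case True
      have "(v, p v) \<in> parcs (induce G R)" using rtreeD(3)[OF t, of v] True v by simp
      then have "p v \<in> R" by (simp add: induce_def)
      then show ?thesis unfolding pR(1)[OF True] pR(2)[OF True] using pR(2)[of "p v"] rtreeD(4)[OF t, of v] True v by simp
    next
      case False
      then obtain i where i: "i < h" "v \<in> D i" using cases v by blast
      show ?thesis
      proof (cases "v = e i")
        case True
        then show ?thesis
          using pD'[OF i] pR(2)[OF w_R[OF i(1)]] rtreeD(2)[OF pD(1)[OF i(1)]] by simp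
      next
        case ne: False
        have "(v, pD i v) \<in> parcs (induce G (D i))" using rtreeD(3)[OF pD(1)[OF i(1)], of v] i ne by simp
        then have pi: "pD i v \<in> D i" by (simp add: induce_def)
        have "dD i v = Suc (dD i (pD i v))" using rtreeD(4)[OF pD(1)[OF i(1)], of v] i ne by simp
        moreover have "p' v = pD i v" using pD'(1)[OF i] ne by simp
        ultimately show ?thesis unfolding pD'(2)[OF i] using pD'(2)[OF i(1) pi] by simp
      qed
    qed
  qed
  moreover have "ntarcs G r p' = {}"
  proof -
    have tree: "a \<noteq> r \<and> b = p' a \<or> b \<noteq> r \<and> a = p' b" if ab: "(a, b) \<in> parcs G" for a b
    proof -
      have abn: "b \<in> nb G a" "a \<in> nb G b" using ab nb_symm[of b a] by (auto simp: nb_def)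
      note abV = GD(4,5)[OF ab]
      consider "a \<in> R" "b \<in> R" | i where "i < h" "a \<in> D i" | i where "i < h" "b \<in> D i"
        using cases abV by blast
      then show ?thesis
      proof cases
        case 1
        then have "(a, b) \<in> parcs (induce G R)" using ab by (simp add: induce_def)
        then have "a \<noteq> r \<and> b = p a \<or> b \<noteq> r \<and> a = p b" using N by (auto simp: ntarcs_def)
        then show ?thesis using pR(1)[OF 1(1)] pR(1)[OF 1(2)] by simp
      next
        case (2 i)
        have ar: "a \<noteq> r" using DR[OF 2] rR by blast
        show ?thesis
        proof (cases "b \<in> D i")
          case True
          have br: "b \<noteq> r" using DR[OF 2(1) True] rR by blast
          have "(a, b) \<in> parcs (induce G (D i))" using ab 2 True by (simp add: induce_def)
          then have "a \<noteq> e i \<and> b = pD i a \<or> b \<noteq> e i \<and> a = pD i b" using pD(2)[OF 2(1)] by (auto simp: ntarcs_def)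
          then show ?thesis using ar br pD'(1)[OF 2] pD'(1)[OF 2(1) True] by (elim disjE conjE) simp_all
        next
          case False
          have "a = e i \<and> b = w i" by (rule enter[OF 2 abn(1) False])
          then show ?thesis using pD'(1)[OF 2] ar by simp
        qed
      next
        case (3 i)
        have br: "b \<noteq> r" using DR[OF 3] rR by blast
        show ?thesis
        proof (cases "a \<in> D i")
          case True
          have ar: "a \<noteq> r" using DR[OF 3(1) True] rR by blast
          have "(a, b) \<in> parcs (induce G (D i))" using ab 3 True by (simp add: induce_def)
          then have "a \<noteq> e i \<and> b = pD i a \<or> b \<noteq> e i \<and> a = pD i b" using pD(2)[OF 3(1)] by (auto simp: ntarcs_def)
          then show ?thesis using ar br pD'(1)[OF 3] pD'(1)[OF 3(1) True] by (elim disjE conjE) simp_all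
        next
          case False
          have "b = e i \<and> a = w i" by (rule enter[OF 3 abn(2) False])
          then show ?thesis using pD'(1)[OF 3] br by simp
        qed
      qed
    qed
    then show ?thesis unfolding ntarcs_def by blast
  qed
  ultimately show ?thesis by blast
qed

lemma is_tree_rtree:
  assumes "pair_graph G" "rtree G r p d" "ntarcs G r p = {}"
  shows "is_tree G"
  unfolding is_tree_def using assms rtree_connected[OF assms(1,2)] no_ntarcs_no_cycle[OF assms] by blast

lemma T_rtree:
  assumes s: "1 \<le> s" and l: "1 \<le> l"
  shows "\<exists>p d. rtree (T_graph s 1 l) (T_end l) p d \<and> ntarcs (T_graph s 1 l) (T_end l) p = {}"
proof -
  define p where "p = (\<lambda>(a :: nat, b :: nat). if a = 0 then (0 :: nat, Suc b) else if b = 1 then (0, 0) else (1, b - 1))"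
  define d where "d = (\<lambda>(a :: nat, b). if a = 0 then l - 1 - b else l - 1 + b)"
  define TT where "TT = T_graph s 1 l"
  have arcs: "((a, b), (a', b')) \<in> parcs TT \<longleftrightarrow> (a, b) \<in> pverts TT \<and> (a', b') \<in> pverts TT \<and>
    (a = a' \<and> b' = Suc b \<or> a = a' \<and> b = Suc b' \<or> a = 0 \<and> b = 0 \<and> 1 \<le> a' \<and> b' = 1 \<or>
     a' = 0 \<and> b' = 0 \<and> 1 \<le> a \<and> b = 1)" for a b a' b'
    by (auto simp: TT_def T_graph_def mk_graph_def)
  have V: "(a, b) \<in> pverts TT \<longleftrightarrow> a = 0 \<and> b < l \<or> a = 1 \<and> 1 \<le> b \<and> b \<le> s" for a b
    unfolding TT_def T_verts[OF s l] by auto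
  have "rtree TT (T_end l) p d"
    unfolding rtree_def
  proof (intro conjI ballI)
    show "T_end l \<in> pverts TT" using l by (simp add: T_end_def V)
    show "d (T_end l) = 0" by (simp add: T_end_def d_def)
    fix v assume v: "v \<in> pverts TT - {T_end l}"
    obtain a b where ab: "v = (a, b)" by fastforce
    have c: "a = 0 \<and> Suc b < l \<or> a = 1 \<and> 1 \<le> b \<and> b \<le> s" using v l unfolding ab by (auto simp: V T_end_def)
    show "(v, p v) \<in> parcs TT" unfolding ab using c l by (auto simp: p_def arcs V)
    show "d v = Suc (d (p v))" unfolding ab using c l by (auto simp: p_def d_def)
  qed
  moreover have "ntarcs TT (T_end l) p = {}"
  proof -
    have "(a, b) \<noteq> T_end l \<and> (a', b') = p (a, b) \<or> (a', b') \<noteq> T_end l \<and> (a, b) = p (a', b')"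
      if "((a, b), (a', b')) \<in> parcs TT" for a b a' b'
      using that unfolding arcs V p_def T_end_def by auto
    then show ?thesis unfolding ntarcs_def by fast
  qed
  ultimately show ?thesis unfolding TT_def by blast
qed

text \<open>A pendant path shorter than \<open>s\<close> can only follow the leg of its leaf, so its
  final vertex of degree at least 3 would be an inner vertex of that leg.\<close>

lemma GG_from_legs:
  assumes G: "pair_graph G" and c: "Digraph_Component.connected (with_proj G)"
    and legs: "\<And>l. l \<in> pverts G \<Longrightarrow> card (nb G l) = 1 \<Longrightarrow> \<exists>us. legpath s G us \<and> us ! 0 = l"
  shows "G \<in> GG s"
proof -
  have "s \<le> length us" if pp: "pendant_path G us" for us
  proof (rule ccontr)
    assume ls: "\<not> s \<le> length us"
    obtain w where us: "us \<noteq> []" and ip: "induced_path G (us @ [w])" and h1: "card (nb G (hd us)) = 1"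
      and w3: "3 \<le> card (nb G w)"
      using pp unfolding pendant_path_def out_degree_nb by blast
    let ?xs = "us @ [w]"
    have arc: "(?xs ! i, ?xs ! Suc i) \<in> parcs G" if "i < length us" for i
      using ip that unfolding induced_path_def by simp
    have dist: "distinct ?xs" and sub: "set ?xs \<subseteq> pverts G" using ip by (auto simp: induced_path_def)
    have "hd us \<in> pverts G" using sub us by auto
    then obtain vs where vs: "legpath s G vs" "vs ! 0 = hd us" using legs h1 by blast
    have "i \<le> length us \<Longrightarrow> ?xs ! i = vs ! i" for i
    proof (induction i rule: less_induct)
      case (less i)
      show ?case
      proof (cases i)
        case 0
        then show ?thesis using vs(2) us by (simp add: nth_append hd_conv_nth)
      next
        case (Suc k)
        have k: "k < length us" "k < s" using less.prems Suc ls by linarith+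
        have xk: "?xs ! k = vs ! k" using less.IH[of k] Suc k by simp
        have n: "?xs ! i \<in> nb G (vs ! k)" using arc[OF k(1)] unfolding xk Suc by (simp add: nb_def)
        show ?thesis
        proof (cases "k = 0")
          case True
          then show ?thesis using n legpath_nb[OF G vs(1) k(2)] Suc by simp
        next
          case False
          have "?xs ! (k - 1) = vs ! (k - 1)" using less.IH[of "k - 1"] Suc k by simp
          moreover have "?xs ! i \<noteq> ?xs ! (k - 1)"
          proof
            assume "?xs ! i = ?xs ! (k - 1)"
            then have "i = k - 1" using nth_eq_iff_index_eq[OF dist, of i "k - 1"] k Suc by simp
            then show False using Suc by simp
          qed
          ultimately show ?thesis using n legpath_nb[OF G vs(1) k(2)] False Suc by auto
        qed
      qed
    qed
    from this[OF order_refl] have "w = vs ! length us" by simp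
    moreover have "card (nb G (vs ! length us)) = 2" using vs(1) us ls by (cases us) (auto simp: legpath_def)
    ultimately show False using w3 by simp
  qed
  then show ?thesis using G c by (simp add: GG_def)
qed

text \<open>Puts prescribed branches on the rest of \<open>G\<close>. Encoded pairs keep the pieces
  apart, with tag 0 for the rest and tag \<open>i + 1\<close> for the \<open>i\<close>-th branch;
  the vertices become natural numbers, as the theorem asks.\<close>

lemma glue_exists:
  fixes G :: "'a pair_pre_digraph" and F :: "nat \<Rightarrow> (nat \<times> nat) pair_pre_digraph"
  assumes A: "att G h D w e" and F: "\<And>i. i < h \<Longrightarrow> pair_graph (F i)" and r: "\<And>i. i < h \<Longrightarrow> \<rho> i \<in> pverts (F i)"
  shows "\<exists>(T :: nat pair_pre_digraph) S u \<phi> \<eta>. two_attached T G h S u (\<lambda>i. \<phi> i (\<rho> i)) D w e \<eta> \<and>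
    (\<forall>i<h. giso (\<phi> i) (F i) (induce T (S i)))"
proof -
  interpret A: attached G h D w e by unfold_locales fact
  obtain f :: "'a \<Rightarrow> nat" where f: "inj_on f A.V" using finite_imp_inj_to_nat_seg[OF A.GD(1)] by blast
  define \<iota> where "\<iota> v = prod_encode (0, f v)" for v
  define \<phi> where "\<phi> i y = prod_encode (Suc i, prod_encode y)" for i y
  have \<iota>\<iota>: "\<iota> a = \<iota> b \<longleftrightarrow> a = b" if "a \<in> A.R" "b \<in> A.R" for a b
    using inj_on_eq_iff[OF f, of a b] that by (simp add: \<iota>_def)
  have \<phi>\<phi>: "\<phi> i y = \<phi> j z \<longleftrightarrow> i = j \<and> y = z" for i y j z by (simp add: \<phi>_def)
  have \<iota>\<phi>: "\<iota> a \<noteq> \<phi> i y" "\<phi> i y \<noteq> \<iota> a" for a i y by (simp_all add: \<iota>_def \<phi>_def)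
  note FD = pair_graph_simps[OF F]
  define S where "S i = \<phi> i ` pverts (F i)" for i
  define AR where "AR = map_prod \<iota> \<iota> ` parcs (induce G A.R)"
  define AF where "AF i = map_prod (\<phi> i) (\<phi> i) ` parcs (F i)" for i
  define AC where "AC = (\<Union>i<h. {(\<iota> (w i), \<phi> i (\<rho> i)), (\<phi> i (\<rho> i), \<iota> (w i))})"
  define T :: "nat pair_pre_digraph" where
    "T = \<lparr>pverts = \<iota> ` A.R \<union> (\<Union>i<h. S i), parcs = AR \<union> (\<Union>i<h. AF i) \<union> AC\<rparr>"
  have TV: "pverts T = \<iota> ` A.R \<union> (\<Union>i<h. S i)" and TA: "parcs T = AR \<union> (\<Union>i<h. AF i) \<union> AC"
    by (simp_all add: T_def)
  have ARs: "AR \<subseteq> \<iota> ` A.R \<times> \<iota> ` A.R" by (auto simp: AR_def induce_def)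
  have AFs: "AF i \<subseteq> S i \<times> S i" if "i < h" for i using FD(4,5)[OF that] by (auto simp: AF_def S_def)
  have rS: "\<phi> i (\<rho> i) \<in> S i" if "i < h" for i using r[OF that] by (simp add: S_def)
  have w\<iota>: "\<iota> (w i) \<in> \<iota> ` A.R" if "i < h" for i using A.w_R[OF that] by (rule imageI)
  have \<iota>S: "\<iota> a \<notin> S i" for a i using \<iota>\<phi> by (auto simp: S_def)
  have SS: "i = j" if "y \<in> S i" "y \<in> S j" for i j y using that \<phi>\<phi> by (auto simp: S_def)
  have TR: "pverts T - (\<Union>i<h. S i) = \<iota> ` A.R" unfolding TV using \<iota>S by blast
  have finS: "finite (S i)" if "i < h" for i unfolding S_def using FD(1)[OF that] by simp
  have Tp: "pair_graph T"
  proof (rule pair_graphI)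
    show "finite (pverts T)" unfolding TV using A.GD(1) finS by simp
    have S: "S i \<subseteq> pverts T" if "i < h" for i unfolding TV using that by blast
    have R: "\<iota> ` A.R \<subseteq> pverts T" unfolding TV by (rule Un_upper1)
    show "parcs T \<subseteq> pverts T \<times> pverts T"
      unfolding TA
    proof (intro Un_least UN_least)
      show "AR \<subseteq> pverts T \<times> pverts T" by (rule order_trans[OF ARs Sigma_mono[OF R R]])
      show "AF i \<subseteq> pverts T \<times> pverts T" if "i \<in> {..<h}" for i
        using order_trans[OF AFs Sigma_mono[OF S S]] that by simp
      show "AC \<subseteq> pverts T \<times> pverts T"
        unfolding AC_def
      proof (rule UN_least)
        fix i assume "i \<in> {..<h}"
        then have "\<iota> (w i) \<in> pverts T" "\<phi> i (\<rho> i) \<in> pverts T"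
          using w\<iota>[of i] R rS[of i] S[of i] by (simp_all add: subset_iff)
        then show "{(\<iota> (w i), \<phi> i (\<rho> i)), (\<phi> i (\<rho> i), \<iota> (w i))} \<subseteq> pverts T \<times> pverts T" by simp
      qed
    qed
    have "sym AR"
    proof (rule symI)
      fix a b assume "(a, b) \<in> AR"
      then obtain a' b' where ab: "(a', b') \<in> parcs G" "a' \<in> A.R" "b' \<in> A.R" "a = \<iota> a'" "b = \<iota> b'"
        by (auto simp: AR_def induce_def)
      then have "(b', a') \<in> parcs (induce G A.R)" using symD[OF A.GD(3)] by (simp add: induce_def)
      then show "(b, a) \<in> AR" unfolding AR_def ab(4,5) by force
    qed
    moreover have "sym (AF i)" if "i < h" for i
    proof (rule symI)
      fix a b assume "(a, b) \<in> AF i"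
      then obtain a' b' where ab: "(a', b') \<in> parcs (F i)" "a = \<phi> i a'" "b = \<phi> i b'" by (auto simp: AF_def)
      then have "(b', a') \<in> parcs (F i)" using symD[OF FD(3)[OF that]] by blast
      then show "(b, a) \<in> AF i" unfolding AF_def ab(2,3) by force
    qed
    then have "sym (\<Union>i<h. AF i)" by (intro sym_UNION ballI) simp
    moreover have "sym AC" unfolding AC_def sym_def by blast
    ultimately show "sym (parcs T)" unfolding TA by (intro sym_Un)
    show "(u, u) \<notin> parcs T" for u
    proof
      assume "(u, u) \<in> parcs T"
      then consider "(u, u) \<in> AR" | i where "i < h" "(u, u) \<in> AF i" | "(u, u) \<in> AC" unfolding TA by blast
      then show False
      proof cases
        case 1
        then obtain a b where ab: "(a, b) \<in> parcs G" "a \<in> A.R" "b \<in> A.R" "\<iota> a = \<iota> b" by (auto simp: AR_def induce_def)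
        then show False using \<iota>\<iota>[OF ab(2,3)] A.GD(6) by simp
      next
        case (2 i)
        then show False using FD(6)[OF 2(1)] \<phi>\<phi> by (auto simp: AF_def)
      next
        case 3
        then obtain i where "u = \<iota> (w i) \<and> u = \<phi> i (\<rho> i)" unfolding AC_def by blast
        then have "\<iota> (w i) = \<phi> i (\<rho> i)" by simp
        then show False by (rule notE[OF \<iota>\<phi>(1)])
      qed
    qed
  qed
  have gR: "giso \<iota> (induce G A.R) (induce T (pverts T - (\<Union>i<h. S i)))"
  proof -
    have "parcs T \<inter> \<iota> ` A.R \<times> \<iota> ` A.R = AR"
    proof -
      have "e \<in> AR" if e: "e \<in> parcs T" "e \<in> \<iota> ` A.R \<times> \<iota> ` A.R" for e
      proof -
        obtain a b where ab: "e = (\<iota> a, \<iota> b)" using e(2) by blast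
        have "e \<notin> AF i" if "i < h" for i using AFs[OF that] \<iota>S ab by blast
        moreover have "e \<notin> AC"
        proof
          assume "e \<in> AC"
          then obtain i where "\<iota> a = \<phi> i (\<rho> i) \<or> \<iota> b = \<phi> i (\<rho> i)" unfolding AC_def ab by blast
          then show False using \<iota>\<phi>(1) by blast
        qed
        ultimately show ?thesis using e(1) unfolding TA by blast
      qed
      then show ?thesis using ARs TA by blast
    qed
    then show ?thesis unfolding TR giso_def using \<iota>\<iota> by (auto simp: inj_on_def induce_def AR_def)
  qed
  have gS: "giso (\<phi> i) (F i) (induce T (S i))" if i: "i < h" for i
  proof -
    have "parcs T \<inter> S i \<times> S i = AF i"
    proof -
      have "e \<in> AF i" if e: "e \<in> parcs T" "e \<in> S i \<times> S i" for e
      proof -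
        have "e \<notin> AR" using ARs e(2) \<iota>S by blast
        moreover have "e \<notin> AC" using e(2) \<iota>S unfolding AC_def by blast
        moreover have "j = i" if "j < h" "e \<in> AF j" for j using AFs[OF that(1)] that(2) e(2) SS by blast
        ultimately show ?thesis using e(1) unfolding TA by blast
      qed
      then show ?thesis using AFs[OF i] TA i by blast
    qed
    moreover have "inj_on (\<phi> i) (pverts (F i))" using \<phi>\<phi> by (auto simp: inj_on_def)
    moreover have "parcs (F i) \<subseteq> pverts (F i) \<times> pverts (F i)" using FD(4,5)[OF i] by auto
    ultimately show ?thesis unfolding giso_def by (simp add: induce_def AF_def S_def)
  qed
  have Tatt: "att T h S (\<lambda>i. \<iota> (w i)) (\<lambda>i. \<phi> i (\<rho> i))"
    unfolding att_def
  proof (intro conjI allI impI)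
    show "pair_graph T" by (rule Tp)
    show "disjoint_family_on S {..<h}" unfolding disjoint_family_on_def using SS by blast
    fix i assume i: "i < h"
    show "S i \<subseteq> pverts T" unfolding TV using i by blast
    show "\<iota> (w i) \<in> pverts T - (\<Union>j<h. S j)" unfolding TR by (rule w\<iota>[OF i])
    show "\<phi> i (\<rho> i) \<in> S i" by (rule rS[OF i])
    show "parcs T \<inter> (pverts T - S i) \<times> S i = {(\<iota> (w i), \<phi> i (\<rho> i))}"
    proof (intro equalityI subsetI)
      fix e assume e: "e \<in> parcs T \<inter> (pverts T - S i) \<times> S i"
      then have "e \<notin> AR" using ARs \<iota>S by blast
      moreover have "e \<notin> AF j" if "j < h" for j using AFs[OF that] e SS[of _ i j] by blast
      ultimately have "e \<in> AC" using e unfolding TA by blast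
      then obtain j where j: "j < h" "e = (\<iota> (w j), \<phi> j (\<rho> j)) \<or> e = (\<phi> j (\<rho> j), \<iota> (w j))"
        unfolding AC_def by blast
      have "e = (\<iota> (w j), \<phi> j (\<rho> j))" using j(2) e \<iota>S by blast
      moreover from this have "j = i" using e rS[OF j(1)] SS by blast
      ultimately show "e \<in> {(\<iota> (w i), \<phi> i (\<rho> i))}" by simp
    next
      fix e assume "e \<in> {(\<iota> (w i), \<phi> i (\<rho> i))}"
      moreover have "(\<iota> (w i), \<phi> i (\<rho> i)) \<in> AC" unfolding AC_def using i by blast
      ultimately show "e \<in> parcs T \<inter> (pverts T - S i) \<times> S i"
        using w\<iota>[OF i] \<iota>S rS[OF i] unfolding TA TV by blast
    qed
  qed
  have "two_attached T G h S (\<lambda>i. \<iota> (w i)) (\<lambda>i. \<phi> i (\<rho> i)) D w e (inv_into A.R \<iota>)"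
  proof unfold_locales
    show "giso (inv_into A.R \<iota>) (induce T (pverts T - (\<Union>i<h. S i))) (induce G A.R)"
      using giso_inv[OF gR] by simp
    show "inv_into A.R \<iota> (\<iota> (w i)) = w i" if "i < h" for i
      using A.w_R[OF that] \<iota>\<iota> by (intro inv_into_f_f) (auto simp: inj_on_def)
  qed (rule Tatt)
  then show ?thesis using gS by blast
qed

lemma graph_spectrum_mult:
  assumes G: "pair_graph G" and m: "0 < graph_mult G x"
  shows "x \<in> graph_spectrum G"
proof (rule ccontr)
  assume "x \<notin> graph_spectrum G"
  then have "f = (\<lambda>_. 0)" if "f \<in> eigsp G x" for f using that graph_spectrum_iff[OF G, of x] by blast
  then have "graph_mult G x \<le> card ({} :: 'a set)" by (intro graph_mult_le_card[OF G]) auto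
  then show False using m by simp
qed

lemma choice_pair: "\<forall>i. \<exists>n t. A i n t \<Longrightarrow> \<exists>n t. \<forall>i. A i (n i) (t i)"
  by metis

section \<open>From equality to membership in \<open>BB\<close>\<close>

context extremal_normal
begin

lemma pendant_family:
  "\<exists>h D w n m \<phi>. int h = cyclomatic G \<and> att G h D w (\<lambda>i. \<phi> i (C_end (Suc (n i)) (m i))) \<and>
     (\<forall>i<h. 3 \<le> Suc (n i) \<and> 1 \<le> m i \<and> giso (\<phi> i) (C_graph (Suc (n i)) (m i)) (induce G (D i)) \<and>
        graph_mult (C_graph (Suc (n i)) (m i)) x = 2 \<and> r \<notin> D i \<and> 3 \<le> card (nb G (w i)) \<and>
        p (\<phi> i (C_end (Suc (n i)) (m i))) = w i) \<and>
     (\<forall>a y. (a, y) \<in> N \<longrightarrow> (\<exists>i<h. a \<in> D i \<and> y \<in> D i))"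
proof -
  \<comment> \<open>The arcs from lower to upper ends. \<open>N\<close> consists of these and their
    reversals, so \<open>card A\<close> is the cyclomatic number.\<close>
  define A where "A = {(b, v) \<in> N. b \<in> ds v}"
  have NA: "N = A \<union> prod.swap ` A"
  proof (intro equalityI subsetI)
    fix e assume eN: "e \<in> N"
    obtain b v where e: "e = (b, v)" by fastforce
    then have bv: "(b, v) \<in> N" "(v, b) \<in> N" using eN N_sym by simp_all
    show "e \<in> A \<union> prod.swap ` A"
    proof (cases "b \<in> ds v")
      case True
      then show ?thesis using bv e by (simp add: A_def)
    next
      case False
      then have "(v, b) \<in> A" using normal[OF bv(1)] bv by (simp add: A_def)
      then have "prod.swap (v, b) \<in> prod.swap ` A" by (rule imageI)
      then show ?thesis using e by simp
    qed
  next
    fix e assume "e \<in> A \<union> prod.swap ` A"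
    then show "e \<in> N" using N_sym by (auto simp: A_def)
  qed
  have finA: "finite A" using finite_N by (rule finite_subset[rotated]) (auto simp: A_def)
  have "A \<inter> prod.swap ` A = {}"
  proof -
    have False if "(b, v) \<in> A" "(v, b) \<in> A" for b v
    proof -
      have bv: "(b, v) \<in> N" "b \<in> ds v" "v \<in> ds b" using that by (auto simp: A_def)
      have "b = v" by (rule dsc_eq[OF G t bv(2) t_dsc_le[OF bv(3)]])
      then show False using N_V[OF bv(1)] by simp
    qed
    then show ?thesis by auto
  qed
  then have "card N = card A + card (prod.swap ` A)"
    unfolding NA using finA by (intro card_Un_disjoint) auto
  also have "card (prod.swap ` A) = card A" by (intro card_image) (auto simp: inj_on_def)
  finally have hA: "int (card A) = cyclomatic G" using card_ntarcs[OF G t] by simp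
  define h where "h = card A"
  obtain f where f: "bij_betw f {0..<h} A" using ex_bij_betw_nat_finite[OF finA] unfolding h_def by blast
  define \<beta> where "\<beta> i = fst (f i)" for i
  define \<nu> where "\<nu> i = snd (f i)" for i
  have fA: "(\<beta> i, \<nu> i) \<in> A" if "i < h" for i
    using bij_betwE[OF f] that by (simp add: \<beta>_def \<nu>_def)
  have \<beta>N: "(\<beta> i, \<nu> i) \<in> N" "\<beta> i \<in> ds (\<nu> i)" if "i < h" for i using fA[OF that] by (auto simp: A_def)
  have LB: "back_arc G s x r p d (\<beta> i) (\<nu> i)" if "i < h" for i
    by unfold_locales (use \<beta>N[OF that] in auto)
  define P where "P i k = (p ^^ k) (\<beta> i)" for i k
  have "\<forall>i. \<exists>n t. i < h \<longrightarrow> 3 \<le> Suc n \<and> n < t \<and> giso (\<lambda>k. P i k) (C_graph (Suc n) (t - n)) (induce G (P i ` {..<t})) \<and>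
     P i ` {..<t} \<subseteq> V - L \<and> r \<notin> P i ` {..<t} \<and> P i t \<in> V - P i ` {..<t} \<and> \<beta> i \<in> P i ` {..<t} \<and> \<nu> i \<in> P i ` {..<t} \<and>
     parcs G \<inter> (V - P i ` {..<t}) \<times> P i ` {..<t} = {(P i t, P i (t - 1))} \<and> p (P i (t - 1)) = P i t \<and>
     3 \<le> card (nb G (P i t)) \<and> 2 \<le> graph_mult (induce G (P i ` {..<t})) x \<and>
     (\<forall>y \<in> P i ` {..<t}. \<beta> i \<in> ds y \<and> (\<forall>z\<in>ds y. z \<notin> L \<longrightarrow> (\<forall>w\<in>V. w \<noteq> r \<longrightarrow> p w \<noteq> z) \<longrightarrow> z = \<beta> i) \<and>
        (\<forall>w\<in>V. \<forall>w'\<in>V. w \<noteq> r \<longrightarrow> w \<notin> L \<longrightarrow> p w = y \<longrightarrow> w' \<noteq> r \<longrightarrow> w' \<notin> L \<longrightarrow> p w' = y \<longrightarrow> w = w')) \<and>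
     (\<exists>w\<in>V. \<exists>w'\<in>V. w \<noteq> r \<and> w \<notin> L \<and> p w = P i t \<and> w' \<noteq> r \<and> w' \<notin> L \<and> p w' = P i t \<and> w \<noteq> w')"
    (is "\<forall>i. \<exists>n t. ?A i n t")
  proof
    fix i
    show "\<exists>n t. ?A i n t"
    proof (cases "i < h")
      case True
      show ?thesis using back_arc.pendant_summary[OF LB[OF True]] unfolding P_def by (elim exE) (intro exI impI)
    qed simp
  qed
  from choice_pair[OF this] obtain n t where nt: "\<forall>i. ?A i (n i) (t i)" by (elim exE)
  define D where "D i = P i ` {..<t i}" for i
  note nt = nt[THEN spec, THEN mp, folded D_def]
  have 1: "3 \<le> Suc (n i)" if "i < h" for i using nt[OF that] by (elim conjE)
  have 2: "n i < t i" if "i < h" for i using nt[OF that] by (elim conjE)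
  have 3: "giso (P i) (C_graph (Suc (n i)) (t i - n i)) (induce G (D i))" if "i < h" for i
    using nt[OF that] by (elim conjE)
  have 4: "D i \<subseteq> V - L" if "i < h" for i using nt[OF that] by (elim conjE)
  have 5: "r \<notin> D i" if "i < h" for i using nt[OF that] by (elim conjE)
  have 6: "\<beta> i \<in> D i" if "i < h" for i using nt[OF that] by (elim conjE)
  have 7: "\<nu> i \<in> D i" if "i < h" for i using nt[OF that] by (elim conjE)
  have 8: "parcs G \<inter> (V - D i) \<times> D i = {(P i (t i), P i (t i - 1))}" if "i < h" for i using nt[OF that] by (elim conjE)
  have 9: "p (P i (t i - 1)) = P i (t i)" if "i < h" for i using nt[OF that] by (elim conjE)
  have 10: "3 \<le> card (nb G (P i (t i)))" if "i < h" for i using nt[OF that] by (elim conjE)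
  have 11: "2 \<le> graph_mult (induce G (D i)) x" if "i < h" for i using nt[OF that] by (elim conjE)
  have 12: "\<forall>y\<in>D i. \<beta> i \<in> ds y \<and> (\<forall>z\<in>ds y. z \<notin> L \<longrightarrow> (\<forall>w\<in>V. w \<noteq> r \<longrightarrow> p w \<noteq> z) \<longrightarrow> z = \<beta> i) \<and>
        (\<forall>w\<in>V. \<forall>w'\<in>V. w \<noteq> r \<longrightarrow> w \<notin> L \<longrightarrow> p w = y \<longrightarrow> w' \<noteq> r \<longrightarrow> w' \<notin> L \<longrightarrow> p w' = y \<longrightarrow> w = w')"
    if "i < h" for i using nt[OF that] by (elim conjE)
  have 13: "\<exists>w\<in>V. \<exists>w'\<in>V. w \<noteq> r \<and> w \<notin> L \<and> p w = P i (t i) \<and> w' \<noteq> r \<and> w' \<notin> L \<and> p w' = P i (t i) \<and> w \<noteq> w'"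
    if "i < h" for i using nt[OF that] by (elim conjE)
  have 14: "P i (t i) \<in> V" if "i < h" for i using nt[OF that] by (elim conjE) (erule DiffD1)
  have ends: "C_end (Suc (n i)) (t i - n i) = t i - 1" if "i < h" for i
    using 2[OF that] by (simp add: C_end_def)
  \<comment> \<open>A common vertex \<open>y\<close> has both lower ends below it, but only one
    childless nonleg vertex; and a lower end determines its nontree arc by
    \<open>N_unique\<close>.\<close>
  have disj: "i = j" if i: "i < h" and j: "j < h" and y: "y \<in> D i" "y \<in> D j" for i j y
  proof -
    have bj: "\<beta> j \<in> ds y" using 12[OF j] y(2) by blast
    note b = back_arc.b_facts[OF LB[OF j]]
    have "\<forall>w\<in>V. w \<noteq> r \<longrightarrow> p w \<noteq> \<beta> j" using back_arc.b_childless[OF LB[OF j]] by blast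
    then have "\<beta> j = \<beta> i" using 12[OF i] y(1) bj b(4) by blast
    moreover from this have "\<nu> j = \<nu> i" using N_unique[OF \<beta>N(1)[OF i], of "\<nu> j"] \<beta>N(1)[OF j] by simp
    ultimately have "f i = f j" by (simp add: \<beta>_def \<nu>_def prod_eq_iff)
    then show ?thesis using inj_onD[OF bij_betw_imp_inj_on[OF f], of i j] i j by simp
  qed
  \<comment> \<open>A vertex of attachment has two nonleg children, a vertex of a branch at most
    one.\<close>
  have w: "P i (t i) \<notin> D j" if i: "i < h" and j: "j < h" for i j
  proof
    assume D: "P i (t i) \<in> D j"
    from 13[OF i] obtain w w' where w: "w \<in> V" "w' \<in> V" "w \<noteq> r" "w \<notin> L" "p w = P i (t i)"
      "w' \<noteq> r" "w' \<notin> L" "p w' = P i (t i)" "w \<noteq> w'" by (elim bexE conjE)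
    have "\<forall>w\<in>V. \<forall>w'\<in>V. w \<noteq> r \<longrightarrow> w \<notin> L \<longrightarrow> p w = P i (t i) \<longrightarrow> w' \<noteq> r \<longrightarrow> w' \<notin> L \<longrightarrow> p w' = P i (t i) \<longrightarrow> w = w'"
      using bspec[OF 12[OF j] D] by (elim conjE)
    then have "w = w'" using w(1-8) by simp
    then show False using w(9) by simp
  qed
  have att: "att G h D (\<lambda>i. P i (t i)) (\<lambda>i. P i (C_end (Suc (n i)) (t i - n i)))"
    unfolding att_def
  proof (intro conjI allI impI)
    show "pair_graph G" by (rule G)
    show "disjoint_family_on D {..<h}" unfolding disjoint_family_on_def using disj by blast
    fix i assume i: "i < h"
    show "D i \<subseteq> V" using 4[OF i] by blast
    show "P i (t i) \<in> V - (\<Union>j<h. D j)" using 14[OF i] w[OF i] by blast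
    have "t i - 1 < t i" using 2[OF i] by linarith
    then show "P i (C_end (Suc (n i)) (t i - n i)) \<in> D i" unfolding ends[OF i] D_def by blast
    show "parcs G \<inter> (V - D i) \<times> D i = {(P i (t i), P i (C_end (Suc (n i)) (t i - n i)))}"
      unfolding ends[OF i] by (rule 8[OF i])
  qed
  have m: "1 \<le> t i - n i" if "i < h" for i using 2[OF that] by linarith
  have mult: "graph_mult (C_graph (Suc (n i)) (t i - n i)) x = 2" if i: "i < h" for i
    using graph_mult_giso[OF 3[OF i] C_pair[OF 1[OF i] m[OF i]], of x] 11[OF i] C_mult_le[OF 1[OF i] m[OF i], of x] by linarith
  have cover: "\<exists>i<h. a \<in> D i \<and> y \<in> D i" if ay: "(a, y) \<in> N" for a y
  proof -
    have "(a, y) \<in> A \<or> (y, a) \<in> A" using ay unfolding NA by auto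
    then obtain i where i: "i < h" "f i = (a, y) \<or> f i = (y, a)"
      using bij_betw_imp_surj_on[OF f] by (metis atLeastLessThan_iff imageE)
    then show ?thesis using 6[OF i(1)] 7[OF i(1)] by (auto simp: \<beta>_def \<nu>_def)
  qed
  show ?thesis
  proof (rule exI[of _ h], rule exI[of _ D], rule exI[of _ "\<lambda>i. P i (t i)"], rule exI[of _ n],
      rule exI[of _ "\<lambda>i. t i - n i"], rule exI[of _ P], intro conjI)
    show "int h = cyclomatic G" using hA unfolding h_def .
    show "att G h D (\<lambda>i. P i (t i)) (\<lambda>i. P i (C_end (Suc (n i)) (t i - n i)))" by (rule att)
    show "\<forall>i<h. 3 \<le> Suc (n i) \<and> 1 \<le> t i - n i \<and> giso (P i) (C_graph (Suc (n i)) (t i - n i)) (induce G (D i)) \<and>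
        graph_mult (C_graph (Suc (n i)) (t i - n i)) x = 2 \<and> r \<notin> D i \<and> 3 \<le> card (nb G (P i (t i))) \<and>
        p (P i (C_end (Suc (n i)) (t i - n i))) = P i (t i)"
    proof (intro allI impI conjI)
      fix i assume i: "i < h"
      show "p (P i (C_end (Suc (n i)) (t i - n i))) = P i (t i)" unfolding ends[OF i] by (rule 9[OF i])
    qed (rule 1 m 3 mult 5 10; assumption)+
    show "\<forall>a y. (a, y) \<in> N \<longrightarrow> (\<exists>i<h. a \<in> D i \<and> y \<in> D i)" using cover by blast
  qed
qed

text \<open>Each pendant cycle is replaced by a pendant path \<open>T_graph s 1 (l i)\<close> with
  eigenvalue \<open>x\<close>, attached at the same vertex; the transfer lemmas then give the
  multiplicity and \<open>q\<close> of the tree obtained.\<close>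

lemma base_tree_forward:
  assumes c1: "1 \<le> cyclomatic G" and eq': "int (graph_mult G x) = 2 * cyclomatic G + int (card QQ) - 1"
  shows "\<exists>T :: nat pair_pre_digraph. G \<in> BB s x T (nat (cyclomatic G))"
proof -
  obtain h D w n m \<psi> where h: "int h = cyclomatic G" and A: "att G h D w (\<lambda>i. \<psi> i (C_end (Suc (n i)) (m i)))"
    and fam: "\<forall>i<h. 3 \<le> Suc (n i) \<and> 1 \<le> m i \<and> giso (\<psi> i) (C_graph (Suc (n i)) (m i)) (induce G (D i)) \<and>
        graph_mult (C_graph (Suc (n i)) (m i)) x = 2 \<and> r \<notin> D i \<and> 3 \<le> card (nb G (w i)) \<and>
        p (\<psi> i (C_end (Suc (n i)) (m i))) = w i"
    and cover: "\<forall>a y. (a, y) \<in> N \<longrightarrow> (\<exists>i<h. a \<in> D i \<and> y \<in> D i)"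
    using pendant_family by (elim exE conjE) (rule that)
  have h0: "0 < h" using h c1 by linarith
  have n3: "3 \<le> Suc (n i)" and m1: "1 \<le> m i" and gC: "giso (\<psi> i) (C_graph (Suc (n i)) (m i)) (induce G (D i))"
    and mC: "graph_mult (C_graph (Suc (n i)) (m i)) x = 2" and rD: "r \<notin> D i" and w3: "3 \<le> card (nb G (w i))"
    and pe: "p (\<psi> i (C_end (Suc (n i)) (m i))) = w i" if "i < h" for i
    using fam that by blast+
  \<comment> \<open>\<open>T\<^bsub>1,l\<^esub>\<close> is a path on \<open>s + l\<close> vertices, and this choice makes \<open>s + l + 1\<close> a multiple of
    the length \<open>n i + 1\<close> of the cycle.\<close>
  define l where "l i = n i * Suc s" for i
  have l1: "1 \<le> l i" if "i < h" for i using n3[OF that] by (simp add: l_def)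
  have spec: "x \<in> graph_spectrum (T_graph s 1 (l i))" if i: "i < h" for i
  proof (rule T_path_spectrum[OF s l1[OF i]])
    have "Suc (s + l i) = Suc s * Suc (n i)" by (simp add: l_def)
    then show "chebU x (Suc (s + l i)) = 0"
      using chebU_mult[OF C_mult_2(2)[OF n3[OF i] m1[OF i] mC[OF i]], of "Suc s"] by (simp only:)
  qed
  have endT: "T_end (l i) \<in> pverts (T_graph s 1 (l i))" if "i < h" for i
    unfolding T_verts[OF s l1[OF that]] T_end_def using l1[OF that] by simp
  have endC: "C_end (Suc (n i)) (m i) \<in> pverts (C_graph (Suc (n i)) (m i))" if "i < h" for i
    unfolding C_verts[OF n3[OF that] m1[OF that]] C_end_def using n3[OF that] m1[OF that] by simp
  obtain T :: "nat pair_pre_digraph" and S u \<phi> \<eta> where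
    ta: "two_attached T G h S u (\<lambda>i. \<phi> i (T_end (l i))) D w (\<lambda>i. \<psi> i (C_end (Suc (n i)) (m i))) \<eta>"
    and gT: "\<forall>i<h. giso (\<phi> i) (T_graph s 1 (l i)) (induce T (S i))"
    using glue_exists[OF A, of "\<lambda>i. T_graph s 1 (l i)" "\<lambda>i. T_end (l i)"] T_pair[OF s l1] endT by blast
  interpret TG: two_attached T G h S u "\<lambda>i. \<phi> i (T_end (l i))" D w "\<lambda>i. \<psi> i (C_end (Suc (n i)) (m i))" \<eta>
    by (rule ta)
  interpret GT: two_attached G T h D w "\<lambda>i. \<psi> i (C_end (Suc (n i)) (m i))" S u "\<lambda>i. \<phi> i (T_end (l i))" TG.\<psi>
    by (rule TG.swap)
  have gi: "giso (\<phi> i) (T_graph s 1 (l i)) (induce T (S i))" if "i < h" for i using gT that by blast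
  note T = TG.T.G
  have rR: "r \<in> TG.G.R" using rV rD by blast
  \<comment> \<open>A parent inside a branch would be the end of that branch as seen from
    \<open>w i\<close>; but by \<open>pe\<close> it is \<open>w i\<close> that is the parent of this
    end. So the spanning tree restricts to the rest.\<close>
  have pR: "p v \<in> TG.G.R" if v: "v \<in> TG.G.R" "v \<noteq> r" for v
  proof (rule ccontr)
    have vV: "v \<in> V" using v(1) by blast
    assume "p v \<notin> TG.G.R"
    then obtain i where i: "i < h" "p v \<in> D i" using p_in[OF vV v(2)] by blast
    have "v \<in> nb G (p v)" by (rule t_child_nb[OF vV v(2) refl])
    moreover have "v \<notin> D i" using v(1) i(1) by blast
    ultimately have e: "p v = \<psi> i (C_end (Suc (n i)) (m i)) \<and> v = w i" by (rule TG.G.enter[OF i])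
    then have "p (p v) = v" using pe[OF i(1)] by metis
    moreover have "p v \<noteq> r" using i rD by blast
    ultimately have "d (p v) = Suc (d v)" using d_parent[OF p_in[OF vV v(2)]] by simp
    then show False using d_parent[OF vV v(2)] by linarith
  qed
  have tR: "rtree (induce G TG.G.R) r p d"
    unfolding rtree_def
  proof (intro conjI ballI)
    show "r \<in> pverts (induce G TG.G.R)" using rR by simp
    show "d r = 0" by (rule rtreeD(2)[OF t])
    fix v assume "v \<in> pverts (induce G TG.G.R) - {r}"
    then have v: "v \<in> TG.G.R" "v \<noteq> r" by simp_all
    then have vV: "v \<in> V" by blast
    have "(v, p v) \<in> parcs G" by (rule rtreeD(3)[OF t vV v(2)])
    then show "(v, p v) \<in> parcs (induce G TG.G.R)" using v(1) pR[OF v] by (simp add: induce_def)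
    show "d v = Suc (d (p v))" by (rule d_parent[OF vV v(2)])
  qed
  have NR: "ntarcs (induce G TG.G.R) r p = {}"
  proof -
    have False if ay: "(a, y) \<in> ntarcs (induce G TG.G.R) r p" for a y
    proof -
      have "(a, y) \<in> N" "a \<in> TG.G.R" using ay by (auto simp: ntarcs_def induce_def)
      then show False using cover by blast
    qed
    then show ?thesis by auto
  qed
  have "\<exists>p' d'. rtree (induce T TG.T.R) (TG.\<psi> r) p' d' \<and> ntarcs (induce T TG.T.R) (TG.\<psi> r) p' = {}"
    by (rule rtree_giso[OF GT.iso _ tR NR]) (rule pair_graph_induce[OF G], blast)
  then obtain p1 d1 where 1: "rtree (induce T TG.T.R) (TG.\<psi> r) p1 d1" "ntarcs (induce T TG.T.R) (TG.\<psi> r) p1 = {}"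
    by blast
  have "\<exists>p d. rtree T (TG.\<psi> r) p d \<and> ntarcs T (TG.\<psi> r) p = {}"
  proof (rule TG.T.glue_tree[OF 1])
    fix i assume i: "i < h"
    obtain p2 d2 where 2: "rtree (T_graph s 1 (l i)) (T_end (l i)) p2 d2"
      "ntarcs (T_graph s 1 (l i)) (T_end (l i)) p2 = {}" using T_rtree[OF s l1[OF i]] by blast
    show "\<exists>p' d'. rtree (induce T (S i)) (\<phi> i (T_end (l i))) p' d' \<and> ntarcs (induce T (S i)) (\<phi> i (T_end (l i))) p' = {}"
      by (rule rtree_giso[OF gi[OF i] T_pair[OF s l1[OF i]] 2])
  qed
  then obtain p3 d3 where 3: "rtree T (TG.\<psi> r) p3 d3" "ntarcs T (TG.\<psi> r) p3 = {}" by blast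
  have tree: "is_tree T" by (rule is_tree_rtree[OF T 3])
  have Tc: "Digraph_Component.connected (with_proj T)" by (rule rtree_connected[OF T 3(1)])
  note TB = TG.T.T_branch[OF _ s order_refl l1 gi refl]
  have bigT: "3 \<le> card (nb T (u i))" if "i < h" for i
    using w3[OF that] TG.card_nb_\<phi>[OF TG.T.w_R[OF that]] TG.\<phi>u[OF that] by simp
  have TGG: "T \<in> GG s"
  proof (rule GG_from_legs[OF T Tc])
    fix y assume y: "y \<in> pverts T" "card (nb T y) = 1"
    show "\<exists>us. legpath s T us \<and> us ! 0 = y"
    proof (cases "y \<in> TG.T.R")
      case True
      have "\<eta> y \<in> TG.G.R" by (rule TG.\<phi>R[OF True])
      moreover have "card (nb G (\<eta> y)) = 1" using TG.card_nb_\<phi>[OF True] y(2) by simp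
      ultimately obtain us where us: "legpath s G us" "us ! 0 = \<eta> y" using leaf_leg[of "\<eta> y"] by blast
      have "us ! j \<in> TG.G.R" if "j \<le> s" for j
        using TG.G.leg_in_R[OF w3 us(1) _ that] us(2) \<open>\<eta> y \<in> TG.G.R\<close> by simp
      then have "legpath s T (map TG.\<psi> us)" by (rule GT.legpath_map[OF us(1)])
      moreover have "map TG.\<psi> us ! 0 = y"
      proof -
        have "length us = Suc s" using us(1) by (simp add: legpath_def)
        then have "map TG.\<psi> us ! 0 = TG.\<psi> (\<eta> y)" using us(2) by simp
        then show ?thesis using inv_into_f_f[OF TG.inj True] by simp
      qed
      ultimately show ?thesis by blast
    next
      case False
      then obtain i where i: "i < h" "y \<in> S i" using y(1) by blast
      show ?thesis using TB(4)[OF i(1) i(1) i(1) i(2) y(2)] by blast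
    qed
  qed
  have LG: "legged G s x" by unfold_locales
  have LT: "legged T s x"
    by (rule legged.intro[OF T Tc TGG s x]) (use TG.T.w_R[OF h0] bigT[OF h0] in blast)
  have qT: "q s T = q s G + h"
  proof (rule TG.q_transfer[OF LT LG bigT, where c = "\<lambda>i. \<phi> i (0, 0)"])
    show "card (nb G v) \<noteq> 1" if "i < h" "v \<in> D i" for i v
      using TG.G.C_branch[OF that(1) n3[OF that(1)] m1[OF that(1)] gC[OF that(1)] refl that(2)] .
    show "\<phi> i (0, 0) \<in> S i" if "i < h" for i using TB(3)[of i] that by blast
    show "\<exists>us. legpath s T us \<and> us ! s = \<phi> i (0, 0)" if "i < h" for i using TB(1)[of i] that by blast
    show "us ! s = \<phi> i (0, 0)" if "i < h" "legpath s T us" "us ! 0 \<in> S i" for i us using TB(2)[of i] that by blast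
  qed
  have mT: "graph_mult G x = graph_mult T x + h"
  proof (rule TG.mult_transfer)
    show "Ttype (induce T (S i)) (\<phi> i (T_end (l i))) x" if i: "i < h" for i
      by (rule Ttype_giso[OF gi[OF i] T_pair[OF s l1[OF i]] endT[OF i] T_Ttype[OF s l1[OF i] x spec[OF i]]])
    show "Ctype (induce G (D i)) (\<psi> i (C_end (Suc (n i)) (m i))) x" if i: "i < h" for i
      by (rule Ctype_giso[OF gC[OF i] C_pair[OF n3[OF i] m1[OF i]] endC[OF i] C_mult_2(1)[OF n3[OF i] m1[OF i] mC[OF i]]])
  qed
  have eqT: "int (graph_mult T x) = int (q s T) - 1" using mT qT eq' h unfolding q_def by linarith
  have q3: "3 \<le> q s T" using qT cq h unfolding q_def by linarith
  have m2: "2 \<le> graph_mult T x" using eqT q3 by linarith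
  \<comment> \<open>Every \<open>T_k\<close> has multiplicity at most 1 at \<open>x\<close>, whereas
    \<open>T\<close> has multiplicity at least 2.\<close>
  have notT: "\<not> digraph_iso (with_proj T) (with_proj (T_graph s k 1))" for k
  proof
    assume "digraph_iso (with_proj T) (with_proj (T_graph s k 1))"
    then obtain f where "iso_via f T (T_graph s k 1)" unfolding digraph_iso_def iso_via_def by auto
    then have "graph_mult (T_graph s k 1) x = graph_mult T x" using graph_mult_giso[OF iso_via_giso T] by blast
    then show False using T_mult_1[OF s order_refl x, of k] m2 by linarith
  qed
  have bt: "base_tree s x T"
    unfolding base_tree_def using tree TGG notT graph_spectrum_mult[OF T, of x] m2 x eqT by simp
  obtain f where f: "iso_via f (induce T TG.T.R) (induce G TG.G.R)" "iso_verts f = \<eta>"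
    using giso_iso_via[OF TG.iso] by blast
  have "G \<in> BB s x T h"
    unfolding BB_def mem_Collect_eq
  proof (intro conjI exI[of _ S] exI[of _ u] exI[of _ D] exI[of _ w] exI[of _ f])
    show "pair_graph G" "base_tree s x T" by (rule G bt)+
    show "h \<le> q s T" using qT by simp
    show "disjoint_family_on S {..<h}" "disjoint_family_on D {..<h}"
      using TG.T.att TG.G.att by (simp_all add: att_def)
    show "\<forall>i<h. u i \<in> TG.T.R \<and> w i \<in> TG.G.R" using TG.T.w_R TG.G.w_R by blast
    show "iso_via f (induce T TG.T.R) (induce G TG.G.R)" by (rule f(1))
    show "\<forall>i<h. iso_verts f (u i) = w i" using TG.\<phi>u f(2) by simp
    show "\<forall>i<h. \<exists>k l. pendant_T s k l T (S i) (u i)"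
    proof (intro allI impI)
      fix i assume i: "i < h"
      obtain g where g: "iso_via g (T_graph s 1 (l i)) (induce T (S i))" "iso_verts g = \<phi> i"
        using giso_iso_via[OF gi[OF i]] by blast
      have "pendant_at T (S i) (u i) (T_graph s 1 (l i)) (T_end (l i))"
        unfolding pendant_at_def out_degree_nb
        using TG.T.D_V[OF i] TG.T.w_R[OF i] i TG.T.card_nb_w[OF i] bigT[OF i] g TG.T.cut[OF i] by auto
      then show "\<exists>k l. pendant_T s k l T (S i) (u i)" unfolding pendant_T_def using l1[OF i] by blast
    qed
    show "\<forall>i<h. \<exists>g l. pendant_C g l G (D i) (w i) \<and> graph_mult (C_graph g l) x = 2"
    proof (intro allI impI)
      fix i assume i: "i < h"
      obtain g where g: "iso_via g (C_graph (Suc (n i)) (m i)) (induce G (D i))" "iso_verts g = \<psi> i"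
        using giso_iso_via[OF gC[OF i]] by blast
      have "pendant_at G (D i) (w i) (C_graph (Suc (n i)) (m i)) (C_end (Suc (n i)) (m i))"
        unfolding pendant_at_def out_degree_nb
        using TG.G.D_V[OF i] TG.G.w_R[OF i] i TG.G.card_nb_w[OF i] w3[OF i] g TG.G.cut[OF i] by auto
      then show "\<exists>g l. pendant_C g l G (D i) (w i) \<and> graph_mult (C_graph g l) x = 2"
        unfolding pendant_C_def using n3[OF i] m1[OF i] mC[OF i] by blast
    qed
  qed
  moreover have "nat (cyclomatic G) = h" using h by simp
  ultimately show ?thesis by blast
qed

end

text \<open>From \<open>c >= 1\<close> the degree sum is at least twice the number of vertices. A
  graph without leaves would be its own \<open>core\<close>, so there is a leaf, and a vertex of
  degree at least 3 has to make up for it.\<close>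

lemma cyclic_leaf_legged:
  assumes s: "1 \<le> s" and x: "x \<notin> graph_spectrum (path_graph s)" and GGs: "G \<in> GG s"
    and c1: "1 \<le> cyclomatic G" and core: "G \<noteq> core G"
  shows "legged G s x" "\<exists>l\<in>pverts G. card (nb G l) = 1"
proof -
  have G: "pair_graph G" and c: "Digraph_Component.connected (with_proj G)" using GGs by (auto simp: GG_def)
  note GD = pair_graph_simps[OF G]
  have parcs: "parcs G = Sigma (pverts G) (nb G)" using GD(4) by (auto simp: nb_def)
  have sum: "card (parcs G) = (\<Sum>v\<in>pverts G. card (nb G v))"
    unfolding parcs using GD(1) finite_nb[OF G] by simp
  have E: "2 * int (card (pverts G)) \<le> int (\<Sum>v\<in>pverts G. card (nb G v))"
    using card_parcs_edges[OF G] c1 unfolding sum[symmetric] cyclomatic_def by linarith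
  have V: "pverts G \<noteq> {}" using c connected_iff[OF G] by blast
  \<comment> \<open>An isolated vertex would be the whole graph, with degree sum 0.\<close>
  have pos: "1 \<le> card (nb G v)" if v: "v \<in> pverts G" for v
  proof (rule ccontr)
    assume "\<not> 1 \<le> card (nb G v)"
    then have n: "nb G v = {}" using card_gt_0_iff[of "nb G v"] finite_nb[OF G, of v] by linarith
    have "pverts G \<subseteq> {v}" by (rule closed_all[OF G c singletonI v]) (simp add: n)
    then have "pverts G = {v}" using v by blast
    then show False using E n by simp
  qed
  have leaf: "\<exists>l\<in>pverts G. card (nb G l) = 1"
  proof (rule ccontr)
    assume no: "\<not> (\<exists>l\<in>pverts G. card (nb G l) = 1)"
    have 2: "2 \<le> card (nb G v)" if v: "v \<in> pverts G" for v
    proof -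
      have "card (nb G v) \<noteq> 1" using no v by blast
      then show ?thesis using pos[OF v] by linarith
    qed
    have I: "induce G (pverts G) = G"
      using GD(4,5) by (cases G) (auto simp: induce_def)
    have "leaf_free (induce G (pverts G))" unfolding I leaf_free_def out_degree_nb using 2 by blast
    then have "\<Union>{W. W \<subseteq> pverts G \<and> leaf_free (induce G W)} = pverts G" by blast
    then have "core G = G" by (simp only: core_def I)
    then show False using core by simp
  qed
  have "\<exists>w\<in>pverts G. 3 \<le> card (nb G w)"
  proof (rule ccontr)
    assume no: "\<not> (\<exists>w\<in>pverts G. 3 \<le> card (nb G w))"
    have le: "card (nb G v) \<le> 2" if "v \<in> pverts G" for v
    proof -
      have "\<not> 3 \<le> card (nb G v)" using no that by blast
      then show ?thesis by linarith
    qed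
    obtain l where l: "l \<in> pverts G" "card (nb G l) = 1" using leaf by blast
    have "(\<Sum>v\<in>pverts G. card (nb G v)) < (\<Sum>v\<in>pverts G. 2)"
      by (rule sum_strict_mono_ex1[OF GD(1)]) (use le l in \<open>auto intro!: bexI[of _ l]\<close>)
    then show False using E by simp
  qed
  then show "legged G s x" by (rule legged.intro[OF G c GGs s x])
  show "\<exists>l\<in>pverts G. card (nb G l) = 1" by (rule leaf)
qed

theorem theorem2p5:
  fixes s :: nat and x :: real and G :: "'a pair_pre_digraph"
  assumes "1 \<le> s"
    and "x \<notin> graph_spectrum (path_graph s)"
    and "G \<in> GG s"
    and "\<not> is_tree G"
    and "G \<noteq> core G"
    and "cyclomatic G + int (q s G) \<ge> 3"
  shows "int (graph_mult G x) = 2 * cyclomatic G + int (q s G) - 1 \<longleftrightarrow>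
         (\<exists>T :: nat pair_pre_digraph. G \<in> BB s x T (nat (cyclomatic G)))"
proof
  assume "\<exists>T :: nat pair_pre_digraph. G \<in> BB s x T (nat (cyclomatic G))"
  then obtain T :: "nat pair_pre_digraph" where "G \<in> BB s x T (nat (cyclomatic G))" by blast
  then show "int (graph_mult G x) = 2 * cyclomatic G + int (q s G) - 1"
    by (rule base_tree_backward[OF assms(1-4) assms(6)])
next
  assume m: "int (graph_mult G x) = 2 * cyclomatic G + int (q s G) - 1"
  have G: "pair_graph G" and c: "Digraph_Component.connected (with_proj G)" using assms(3) by (auto simp: GG_def)
  have c1: "1 \<le> cyclomatic G" by (rule cyclomatic_nonneg(2)[OF G c assms(4)])
  note CL = cyclic_leaf_legged[OF assms(1-3) c1 assms(5)]
  interpret legged G s x by (rule CL(1))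
  obtain l where l: "l \<in> V" "card (nb G l) = 1" using CL(2) by blast
  obtain us where us: "legpath s G us" using leaf_leg[OF l] by blast
  define r where "r = us ! s"
  have rQ: "r \<in> QQ" unfolding Q_iff r_def using us by blast
  \<comment> \<open>As \<open>c >= 1\<close>, any spanning tree leaves a nontree arc; its ends are
    distinct and lie outside the legs, so one of them is not the root.\<close>
  have nontriv: "\<exists>v\<in>V. v \<notin> L \<and> v \<noteq> r"
  proof -
    have "r \<in> V" using rQ Q_sub by blast
    then obtain p d where t: "rtree G r p d" using rtree_exists[OF G c] by blast
    interpret rooted_legged G s x r p d by unfold_locales (rule t rQ)+
    have "card N \<noteq> 0" using card_ntarcs[OF G t] c1 by linarith
    then have "N \<noteq> {}" by (metis card.empty)
    then obtain a y where ay: "(a, y) \<in> N" by (metis ex_in_conv surj_pair)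
    then show ?thesis using N_V[OF ay] N_L[OF ay] by metis
  qed
  have m': "2 * cyclomatic G + int (card QQ) - 1 \<le> int (graph_mult G x)" using m by (simp add: q_def)
  obtain p d where t: "rtree G r p d"
    and nt: "\<forall>(a, y)\<in>ntarcs G r p. a \<in> dsc G r p y \<or> y \<in> dsc G r p a"
    using normal_tree[OF rQ m' nontriv] by blast
  have lt: "rooted_legged G s x r p d" by unfold_locales (rule t rQ)+
  have le: "extremal G s x r p d" by (rule extremal.intro[OF lt]) (unfold_locales, rule m', rule nontriv)
  have ln: "extremal_normal G s x r p d"
  proof (rule extremal_normal.intro[OF le], unfold_locales)
    show "a \<in> dsc G r p y \<or> y \<in> dsc G r p a" if "(a, y) \<in> ntarcs G r p" for a y using nt that by blast
    show "3 \<le> cyclomatic G + int (card QQ)" using assms(6) by (simp add: q_def)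
  qed
  show "\<exists>T :: nat pair_pre_digraph. G \<in> BB s x T (nat (cyclomatic G))"
    by (rule extremal_normal.base_tree_forward[OF ln c1]) (use m in \<open>simp add: q_def\<close>)
qed

end
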